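(* For any $v\in\mathbb{R}^3_1\setminus\{0\}$ and $c\in\mathbb{R}$, there is a 2-parameter family of spacelike curves $X$ (satisfying $k=c+\langle T,v\rangle$) which are non-trivial self-similar solutions (soliton solutions when $c=0$) to the curvature flow (CF) on the 2-dimensional light cone $Q^2_+$. There are three classes of such solutions, corresponding to each type (timelike, lightlike, spacelike) of the vector $v$. Moreover, the curvature function of $X$ has at most two zeros and, at each end, the curvature function is either unbounded or it tends to one of the constants in $\{c,0\}$. Each curve $-Y$, where $Y$ is the curve associated to $X$, is a self-similar solution to the inverse curvature flow (ICF) and it has at most three connected components.
   Context: $\mathbb{R}^3_1$ is $\mathbb{R}^3$ with the Minkowski metric $\langle u,v\rangle=-u_1v_1+u_2v_2+u_3v_3$. The light cone is $Q^2=\{p\in\mathbb{R}^3_1\setminus\{0\}:\langle p,p\rangle=0\}$ and $Q^2_+=\{p\in Q^2:p_1>0\}$. For a (smooth) spacelike curve $X$ on $Q^2$ parametrized by arc length $s$, $T=X'$ is the unit tangent field, $Y(s)$ is the unique lightlike vector orthogonal to $T(s)$ with $\langle X(s),Y(s)\rangle=1$ (the associated curve), and the curvature $k$ is defined by $T'=kX-Y$. For an arbitrary parameter, $T,Y,k$ are those obtained via arc-length reparametrization. A 1-parameter family of spacelike curves $\hat X:I\times J\to Q^2_+$, $J$ an interval containing $0$, with associated curves $\hat Y^t$ and curvatures $\hat k^t$, is a solution to the CF (resp. ICF, for non-vanishing curvatures) with initial condition $X$ if $\hat X^0=X$ and $\langle \frac{\partial}{\partial t}\hat X^t,\hat Y^t\rangle=\hat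 k^t$ (resp. $=-1/\hat k^t$). An isometry of $Q^2_+$ is an element of the Lie group $O_1(3)$ (linear isometries of $\mathbb{R}^3_1$) preserving $Q^2_+$. The curve $X$ is a self-similar solution to the CF (resp. ICF) if there is a solution of the form $\hat X^t(s)=f(t)M(t)X(s)$, with $f>0$ smooth, $f(0)=1$, and $M(t)$ a smooth family of isometries of $Q^2_+$ with $M(0)=\mathrm{Id}$; it is a soliton solution if $f\equiv1$. Trivial solutions are the curves of constant curvature (parabolas, ellipses, hyperbolas). The curves $X$ are taken on their maximal interval of definition $I=(\omega_-,\omega_+)$ as solutions of $k=c+\langle T,v\rangle$; the "ends" of $X$ are $s\to\omega_-$ and $s\to\omega_+$. "2-parameter family" means that, for fixed $v$ and $c$, the solutions are determined by the initial values $\langle X(0),v\rangle,\langle T(0),v\rangle,\langle Y(0),v\rangle$, which are subject to the single relation $2\langle X(0),v\rangle\langle Y(0),v\rangle+\langle T(0),v\rangle^2=\langle v,v\rangle$. The curve $-Y$ is considered on the set where $k\ne0$ (where it is a spacelike curve, of curvature $1/k$); its connected components correspond to the components of $I\setminus\{k=0\}$, each being a self-similar solution to the ICF. *)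

theory Defs
  imports "HOL-Analysis.Analysis" "HOL-Library.Disjoint_Sets"
begin

definition mink :: "real^3 \<Rightarrow> real^3 \<Rightarrow> real" where
  "mink u w = - (u$1 * w$1) + u$2 * w$2 + u$3 * w$3"

definition timelike :: "real^3 \<Rightarrow> bool" where
  "timelike v \<longleftrightarrow> mink v v < 0"

definition lightlike :: "real^3 \<Rightarrow> bool" where
  "lightlike v \<longleftrightarrow> v \<noteq> 0 \<and> mink v v = 0"

definition spacelike :: "real^3 \<Rightarrow> bool" where
  "spacelike v \<longleftrightarrow> mink v v > 0"

definition light_cone :: "(real^3) set" where
  "light_cone = {p. p \<noteq> 0 \<and> mink p p = 0}"

definition future_cone :: "(real^3) set" where
  "future_cone = {p \<in> light_cone. p$1 > 0}"

definition cone_isometry :: "real^3^3 \<Rightarrow> bool" where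
  "cone_isometry M \<longleftrightarrow>
     (\<forall>u w. mink (M *v u) (M *v w) = mink u w) \<and> (*v) M ` future_cone = future_cone"

text \<open>This notion of smoothness (all iterated directional derivatives are Frechet differentiable) is only used
  on open sets.\<close>

primrec higher_differentiable_on ::
    "'a::real_normed_vector set \<Rightarrow> ('a \<Rightarrow> 'b::real_normed_vector) \<Rightarrow> nat \<Rightarrow> bool" where
  "higher_differentiable_on S f 0 \<longleftrightarrow> continuous_on S f"
| "higher_differentiable_on S f (Suc n) \<longleftrightarrow>
     (\<forall>x\<in>S. f differentiable (at x)) \<and>
     (\<forall>h. higher_differentiable_on S (\<lambda>x. frechet_derivative f (at x) h) n)"

definition smooth_on :: "'a::real_normed_vector set \<Rightarrow> ('a \<Rightarrow> 'b::real_normed_vector) \<Rightarrow> bool" where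
  "smooth_on S f \<longleftrightarrow> (\<forall>n. higher_differentiable_on S f n)"

definition open_interval :: "real set \<Rightarrow> bool" where
  "open_interval I \<longleftrightarrow> open I \<and> is_interval I \<and> I \<noteq> {}"

definition velocity :: "(real \<Rightarrow> real^3) \<Rightarrow> real \<Rightarrow> real^3" where
  "velocity X s = vector_derivative X (at s)"

definition spacelike_curve :: "real set \<Rightarrow> (real \<Rightarrow> real^3) \<Rightarrow> bool" where
  "spacelike_curve I X \<longleftrightarrow> open_interval I \<and> smooth_on I X \<and>
     (\<forall>s\<in>I. X s \<in> future_cone \<and> spacelike (velocity X s))"

definition arc_length_curve :: "real set \<Rightarrow> (real \<Rightarrow> real^3) \<Rightarrow> bool" where
  "arc_length_curve I X \<longleftrightarrow> spacelike_curve I X \<and>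
     (\<forall>s\<in>I. mink (velocity X s) (velocity X s) = 1)"

text \<open>For an arbitrary parameter \<open>s\<close>, differentiation with respect to arc length is
  \<open>(1 / speed) d/ds\<close>. The frame and the curvature below are the ones
  of the arc-length reparametrization, evaluated at the parameter \<open>s\<close>.\<close>

definition speed :: "(real \<Rightarrow> real^3) \<Rightarrow> real \<Rightarrow> real" where
  "speed X s = sqrt (mink (velocity X s) (velocity X s))"

definition arc_derivative :: "(real \<Rightarrow> real^3) \<Rightarrow> (real \<Rightarrow> real^3) \<Rightarrow> real \<Rightarrow> real^3" where
  "arc_derivative X F s = (1 / speed X s) *\<^sub>R vector_derivative F (at s)"

definition tangent :: "(real \<Rightarrow> real^3) \<Rightarrow> real \<Rightarrow> real^3" where
  "tangent X = arc_derivative X X"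

definition associated :: "(real \<Rightarrow> real^3) \<Rightarrow> real \<Rightarrow> real^3" where
  "associated X s = (THE Y. lightlike Y \<and> mink (tangent X s) Y = 0 \<and> mink (X s) Y = 1)"

definition curvature :: "(real \<Rightarrow> real^3) \<Rightarrow> real \<Rightarrow> real" where
  "curvature X s = (THE k. arc_derivative X (tangent X) s = k *\<^sub>R X s - associated X s)"

definition trivial_curve :: "real set \<Rightarrow> (real \<Rightarrow> real^3) \<Rightarrow> bool" where
  "trivial_curve I X \<longleftrightarrow> (\<exists>a. \<forall>s\<in>I. curvature X s = a)"

text \<open>A family is written \<open>F t s\<close>, with \<open>t \<in> J\<close> the time and \<open>s \<in> I\<close> the curve parameter.\<close>

definition curve_family :: "real set \<Rightarrow> real set \<Rightarrow> (real \<Rightarrow> real \<Rightarrow> real^3) \<Rightarrow> bool" where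
  "curve_family I J F \<longleftrightarrow> open_interval J \<and> 0 \<in> J \<and>
     smooth_on (I \<times> J) (\<lambda>(s, t). F t s) \<and> (\<forall>t\<in>J. spacelike_curve I (F t))"

definition CF_solution ::
    "real set \<Rightarrow> real set \<Rightarrow> (real \<Rightarrow> real^3) \<Rightarrow> (real \<Rightarrow> real \<Rightarrow> real^3) \<Rightarrow> bool" where
  "CF_solution I J X F \<longleftrightarrow> curve_family I J F \<and> (\<forall>s\<in>I. F 0 s = X s) \<and>
     (\<forall>t\<in>J. \<forall>s\<in>I.
        mink (vector_derivative (\<lambda>t. F t s) (at t)) (associated (F t) s) = curvature (F t) s)"

definition ICF_solution ::
    "real set \<Rightarrow> real set \<Rightarrow> (real \<Rightarrow> real^3) \<Rightarrow> (real \<Rightarrow> real \<Rightarrow> real^3) \<Rightarrow> bool" where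
  "ICF_solution I J X F \<longleftrightarrow> curve_family I J F \<and> (\<forall>s\<in>I. F 0 s = X s) \<and>
     (\<forall>t\<in>J. \<forall>s\<in>I. curvature (F t) s \<noteq> 0 \<and>
        mink (vector_derivative (\<lambda>t. F t s) (at t)) (associated (F t) s) = - 1 / curvature (F t) s)"

definition similarity_data :: "real set \<Rightarrow> (real \<Rightarrow> real) \<Rightarrow> (real \<Rightarrow> real^3^3) \<Rightarrow> bool" where
  "similarity_data J f M \<longleftrightarrow> smooth_on J f \<and> smooth_on J M \<and> f 0 = 1 \<and> M 0 = mat 1 \<and>
     (\<forall>t\<in>J. f t > 0 \<and> cone_isometry (M t))"

definition self_similar_CF :: "real set \<Rightarrow> (real \<Rightarrow> real^3) \<Rightarrow> bool" where
  "self_similar_CF I X \<longleftrightarrow> (\<exists>J f M. similarity_data J f M \<and>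
     CF_solution I J X (\<lambda>t s. f t *\<^sub>R (M t *v X s)))"

definition soliton_CF :: "real set \<Rightarrow> (real \<Rightarrow> real^3) \<Rightarrow> bool" where
  "soliton_CF I X \<longleftrightarrow> (\<exists>J f M. similarity_data J f M \<and> (\<forall>t\<in>J. f t = 1) \<and>
     CF_solution I J X (\<lambda>t s. f t *\<^sub>R (M t *v X s)))"

definition self_similar_ICF :: "real set \<Rightarrow> (real \<Rightarrow> real^3) \<Rightarrow> bool" where
  "self_similar_ICF I X \<longleftrightarrow> (\<exists>J f M. similarity_data J f M \<and>
     ICF_solution I J X (\<lambda>t s. f t *\<^sub>R (M t *v X s)))"

definition solves :: "real^3 \<Rightarrow> real \<Rightarrow> real set \<Rightarrow> (real \<Rightarrow> real^3) \<Rightarrow> bool" where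
  "solves v c I X \<longleftrightarrow> arc_length_curve I X \<and>
     (\<forall>s\<in>I. curvature X s = c + mink (tangent X s) v)"

text \<open>The domain of a solution is \<open>einterval \<alpha> \<omega>\<close>, i.e. the open interval of reals strictly between
  the possibly infinite ends \<open>\<alpha>\<close> and \<open>\<omega>\<close>. The values of \<open>X\<close> outside of it are irrelevant.\<close>

definition maximal_solution :: "real^3 \<Rightarrow> real \<Rightarrow> ereal \<Rightarrow> ereal \<Rightarrow> (real \<Rightarrow> real^3) \<Rightarrow> bool" where
  "maximal_solution v c \<alpha> \<omega> X \<longleftrightarrow> \<alpha> < 0 \<and> 0 < \<omega> \<and> solves v c (einterval \<alpha> \<omega>) X \<and>
     (\<forall>I X'. solves v c I X' \<and> einterval \<alpha> \<omega> \<subseteq> I \<and> (\<forall>s\<in>einterval \<alpha> \<omega>. X' s = X s)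
        \<longrightarrow> I = einterval \<alpha> \<omega>)"

definition nontrivial_solution :: "real^3 \<Rightarrow> real \<Rightarrow> ereal \<Rightarrow> ereal \<Rightarrow> (real \<Rightarrow> real^3) \<Rightarrow> bool" where
  "nontrivial_solution v c \<alpha> \<omega> X \<longleftrightarrow>
     maximal_solution v c \<alpha> \<omega> X \<and> \<not> trivial_curve (einterval \<alpha> \<omega>) X"

definition initial_values :: "real^3 \<Rightarrow> (real \<Rightarrow> real^3) \<Rightarrow> real \<times> real \<times> real" where
  "initial_values v X = (mink (X 0) v, mink (tangent X 0) v, mink (associated X 0) v)"

text \<open>The parameters of the family. The relation between them is the equation. The second condition
  only selects components of the surface that it describes, when \<open>v\<close> is not spacelike:
  \<open>X\<close> takes values in the future cone, which makes \<open>Y - X\<close> a past-directed timelike vector,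
  hence \<open>\<langle>Y - X, v\<rangle>\<close> has the sign of the first coordinate of \<open>v\<close> for such \<open>v\<close>.\<close>

definition initial_surface :: "real^3 \<Rightarrow> (real \<times> real \<times> real) set" where
  "initial_surface v = {(x, \<tau>, y). 2 * x * y + \<tau>\<^sup>2 = mink v v \<and>
     (\<not> spacelike v \<longrightarrow> (y - x) * v$1 > 0)}"

definition solution_class :: "(real^3 \<Rightarrow> bool) \<Rightarrow> real \<Rightarrow> (ereal \<times> ereal \<times> (real \<Rightarrow> real^3)) set" where
  "solution_class P c = {(\<alpha>, \<omega>, X). \<exists>v. v \<noteq> 0 \<and> P v \<and> nontrivial_solution v c \<alpha> \<omega> X}"

text \<open>Filters \<open>at_right \<alpha>\<close> and \<open>at_left \<omega>\<close> on \<open>ereal\<close>, composed with \<open>real_of_ereal\<close>,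
  cover finite and infinite ends.\<close>

definition end_behaviour :: "real \<Rightarrow> (real \<Rightarrow> real) \<Rightarrow> ereal filter \<Rightarrow> bool" where
  "end_behaviour c k F \<longleftrightarrow> \<not> Bfun (k \<circ> real_of_ereal) F \<or>
     ((k \<circ> real_of_ereal) \<longlongrightarrow> c) F \<or> ((k \<circ> real_of_ereal) \<longlongrightarrow> 0) F"

end

theory Submission
  imports Defs
begin

text \<open>In the frame \<open>X, T, Y\<close> of a curve satisfying \<open>k = c + \<langle>T, v\<rangle>\<close>, the frame equations form an autonomous ODE with
  quadratic right-hand side, and the coordinates \<open>x, \<tau>, y\<close> of \<open>v\<close> satisfy \<open>x' = \<tau>\<close>, \<open>\<tau>' = k x - y\<close>, \<open>y' = - k \<tau>\<close> with
  the first integral \<open>2 x y + \<tau>\<^sup>2 = \<langle>v, v\<rangle>\<close>. Two frames with the same coordinates of \<open>v\<close> differ by an isometry fixing \<open>v\<close>.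
  Rotating around \<open>v\<close> by \<open>exp (g t A)\<close>, where \<open>A\<close> is the Lorentzian cross product with \<open>v\<close>, moves \<open>X\<close> with
  normal velocity \<open>\<langle>A X, Y\<rangle> = \<tau> = k - c\<close>, and scaling by \<open>f t = sqrt (1 + 2 c t)\<close> supplies the remaining \<open>c\<close>; the
  same rotation with \<open>1 / f\<close> works for \<open>- Y\<close>. At a zero of \<open>k\<close> one has \<open>k' = - y \<noteq> 0\<close>, and \<open>y + c x\<close>, whose derivative is
  \<open>- \<tau>\<^sup>2\<close>, excludes three of them. At an infinite end with \<open>k\<close> bounded, either \<open>x\<close> is bounded, and the same monotone
  quantity forces \<open>\<tau> \<longlongrightarrow> 0\<close>, or \<open>\<bar>x\<bar>\<close> gets large and forces \<open>k \<longlongrightarrow> 0\<close>; at a finite end a bounded \<open>k\<close>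
  would allow the solution to be continued.\<close>

subsection \<open>Smooth functions\<close>

text \<open>The unknown of the analysis is the whole frame, not the curve: \<open>associated\<close>
  and \<open>curvature\<close> are given by descriptions, which say nothing about differentiability,
  whereas a solution of the frame equation with the right Gram matrix displays them explicitly.
  Uniqueness, persistence of the Gram relations and invariance of the two families of constant
  curvature then have one shape: some error quantities satisfy a linear homogeneous estimate, vanish
  at one point, and so vanish everywhere by Gronwall's inequality.

  Bounded curvature excludes a finite end because the frame equation is linear in the frame once
  \<open>k\<close> is regarded as a given coefficient, and because the short existence time depends
  only on a bound for the initial value.

  The cross product with \<open>v\<close> gives the normal velocity \<open>k - c\<close> only up to
  the orientation of the frame. That orientation is the sign of a determinant which is constant
  along the curve, so one choice of sign for \<open>A\<close> serves the whole curve.\<close>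

lemma higher_differentiable_on_cong:
  assumes "open S" "\<And>x. x \<in> S \<Longrightarrow> f x = g x" "higher_differentiable_on S f n"
  shows "higher_differentiable_on S g n"
  using assms(2,3)
proof (induction n arbitrary: f g)
  case 0
  then show ?case by (simp cong: continuous_on_cong)
next
  case (Suc n)
  have fr: "frechet_derivative f (at x) = frechet_derivative g (at x)" if "x \<in> S" for x
    using Suc.prems that assms(1) by (intro frechet_derivative_transform_within_open[of f x S]) auto
  have "g differentiable at x" if "x \<in> S" for x
  proof -
    from Suc.prems(2) that obtain D where "(f has_derivative D) (at x)"
      by (auto simp: differentiable_def)
    then have "(g has_derivative D) (at x)"
      by (rule has_derivative_transform_within_open[OF _ assms(1) that]) (rule Suc.prems(1))
    then show ?thesis by (auto simp: differentiable_def)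
  qed
  moreover have "higher_differentiable_on S (\<lambda>x. frechet_derivative g (at x) h) n" for h
    by (rule Suc.IH[of "\<lambda>x. frechet_derivative f (at x) h"]) (use Suc.prems fr in auto)
  ultimately show ?case by simp
qed

text \<open>Lets a proof use any explicitly known derivative \<open>D\<close> in place of the choice
  \<open>frechet_derivative\<close>; uniqueness of derivatives makes the two equal on
  \<open>S\<close>.\<close>

lemma higher_differentiable_on_SucI:
  assumes "open S" "\<And>x. x \<in> S \<Longrightarrow> (f has_derivative D x) (at x)"
    "\<And>h. higher_differentiable_on S (\<lambda>x. D x h) n"
  shows "higher_differentiable_on S f (Suc n)"
proof -
  have "higher_differentiable_on S (\<lambda>x. frechet_derivative f (at x) h) n" for h
    by (rule higher_differentiable_on_cong[OF assms(1) _ assms(3)[of h]])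
      (use assms(2) frechet_derivative_at in metis)
  then show ?thesis
    using assms(2) by (auto simp: differentiable_def)
qed

lemma higher_differentiable_on_SucD:
  "higher_differentiable_on S f (Suc n) \<Longrightarrow> higher_differentiable_on S f n"
proof (induction n arbitrary: f)
  case 0
  then show ?case
    by (auto intro!: continuous_at_imp_continuous_on differentiable_imp_continuous_within)
next
  case (Suc n)
  have "\<forall>x\<in>S. f differentiable (at x)"
    "higher_differentiable_on S (\<lambda>x. frechet_derivative f (at x) h) (Suc n)" for h
    using Suc.prems unfolding higher_differentiable_on.simps(2)[of S f "Suc n"] by blast+
  then show ?case
    unfolding higher_differentiable_on.simps(2)[of S f n] using Suc.IH by blast
qed

lemma higher_differentiable_on_has_derivative:
  "higher_differentiable_on S f (Suc n) \<Longrightarrow> x \<in> S \<Longrightarrow>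
    (f has_derivative frechet_derivative f (at x)) (at x)"
  by (simp add: frechet_derivative_works[symmetric])

lemma higher_differentiable_on_const [simp]: "open S \<Longrightarrow> higher_differentiable_on S (\<lambda>_. a) n"
proof (induction n arbitrary: a)
  case (Suc n)
  then show ?case by (intro higher_differentiable_on_SucI[where D = "\<lambda>_ _. 0"]) auto
qed auto

lemma higher_differentiable_on_add:
  assumes "open S" "higher_differentiable_on S f n" "higher_differentiable_on S g n"
  shows "higher_differentiable_on S (\<lambda>x. f x + g x) n"
  using assms(2,3)
proof (induction n arbitrary: f g)
  case 0
  then show ?case by (auto intro: continuous_on_add)
next
  case (Suc n)
  note d = Suc.prems[THEN higher_differentiable_on_has_derivative]
  show ?case
    by (rule higher_differentiable_on_SucI[OF assms(1) has_derivative_add[OF d]])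
      (use Suc in auto)
qed

lemma higher_differentiable_on_linear:
  assumes "open S" "bounded_linear L" "higher_differentiable_on S f n"
  shows "higher_differentiable_on S (\<lambda>x. L (f x)) n"
  using assms(3)
proof (induction n arbitrary: f)
  case 0
  then show ?case using assms(2) by (auto intro: bounded_linear.continuous_on)
next
  case (Suc n)
  note d = Suc.prems[THEN higher_differentiable_on_has_derivative]
  show ?case
    by (rule higher_differentiable_on_SucI[OF assms(1) bounded_linear.has_derivative[OF assms(2) d]])
      (use Suc in auto)
qed

lemma higher_differentiable_on_bilinear:
  assumes "open S" "bounded_bilinear B" "higher_differentiable_on S f n" "higher_differentiable_on S g n"
  shows "higher_differentiable_on S (\<lambda>x. B (f x) (g x)) n"
  using assms(3,4)
proof (induction n arbitrary: f g)
  case 0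
  then show ?case using assms(2) by (auto intro: bounded_bilinear.continuous_on)
next
  case (Suc n)
  note d = Suc.prems[THEN higher_differentiable_on_has_derivative]
  note D = Suc.prems[THEN higher_differentiable_on_SucD]
  show ?case
    by (rule higher_differentiable_on_SucI[OF assms(1) bounded_bilinear.FDERIV[OF assms(2) d]])
      (use Suc D in \<open>auto intro!: higher_differentiable_on_add[OF assms(1)]\<close>)
qed

text \<open>Only linear inner maps are needed: a similarity family is a polynomial in functions of
  \<open>s\<close> alone and of \<open>t\<close> alone, so composition with the two projections of
  \<open>I \<times> J\<close> replaces the general chain rule.\<close>

lemma higher_differentiable_on_compose_linear:
  assumes "open S" "open S'" "bounded_linear L" "L ` S' \<subseteq> S" "higher_differentiable_on S f n"
  shows "higher_differentiable_on S' (\<lambda>x. f (L x)) n"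
  using assms(5)
proof (induction n arbitrary: f)
  case 0
  have "continuous_on S' L"
    by (simp add: assms(3) linear_continuous_on)
  with 0 show ?case using assms(4) by (auto intro: continuous_on_compose2)
next
  case (Suc n)
  have d: "((\<lambda>x. f (L x)) has_derivative (\<lambda>h. frechet_derivative f (at (L x)) (L h))) (at x)" if "x \<in> S'" for x
    using has_derivative_compose[OF bounded_linear_imp_has_derivative[OF assms(3)]
       higher_differentiable_on_has_derivative[OF Suc.prems]] that assms(4) by blast
  show ?case
    by (rule higher_differentiable_on_SucI[OF assms(2) d]) (use Suc in auto)
qed

lemma higher_differentiable_on_subset:
  "higher_differentiable_on S f n \<Longrightarrow> S' \<subseteq> S \<Longrightarrow> higher_differentiable_on S' f n"
  by (induction n arbitrary: f) (auto intro: continuous_on_subset)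

lemma smooth_on_add: "open S \<Longrightarrow> smooth_on S f \<Longrightarrow> smooth_on S g \<Longrightarrow> smooth_on S (\<lambda>x. f x + g x)"
  by (auto simp: smooth_on_def higher_differentiable_on_add)

lemma smooth_on_linear: "open S \<Longrightarrow> bounded_linear L \<Longrightarrow> smooth_on S f \<Longrightarrow> smooth_on S (\<lambda>x. L (f x))"
  by (auto simp: smooth_on_def higher_differentiable_on_linear)

lemma smooth_on_scaleR:
  "open S \<Longrightarrow> smooth_on S f \<Longrightarrow> smooth_on S g \<Longrightarrow> smooth_on S (\<lambda>x. f x *\<^sub>R g x)"
  unfolding smooth_on_def
  by (auto intro: higher_differentiable_on_bilinear[OF _ bounded_bilinear_scaleR])

lemma smooth_on_const: "open S \<Longrightarrow> smooth_on S (\<lambda>_. a)"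
  by (auto simp: smooth_on_def)

lemma smooth_on_compose_linear:
  "open S \<Longrightarrow> open S' \<Longrightarrow> bounded_linear L \<Longrightarrow> L ` S' \<subseteq> S \<Longrightarrow> smooth_on S f \<Longrightarrow>
    smooth_on S' (\<lambda>x. f (L x))"
  unfolding smooth_on_def by (blast intro: higher_differentiable_on_compose_linear)

lemma smooth_on_subset: "smooth_on S f \<Longrightarrow> S' \<subseteq> S \<Longrightarrow> smooth_on S' f"
  by (auto simp: smooth_on_def intro: higher_differentiable_on_subset)

lemma smooth_on_cong:
  "open S \<Longrightarrow> (\<And>x. x \<in> S \<Longrightarrow> f x = g x) \<Longrightarrow> smooth_on S f \<Longrightarrow> smooth_on S g"
  by (auto simp: smooth_on_def intro: higher_differentiable_on_cong)

lemma higher_differentiable_on_vector_derivativeI: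
  fixes z :: "real \<Rightarrow> 'a::real_normed_vector"
  assumes "open I" "\<And>s. s \<in> I \<Longrightarrow> (z has_vector_derivative w s) (at s)" "higher_differentiable_on I w n"
  shows "higher_differentiable_on I z (Suc n)"
proof (rule higher_differentiable_on_SucI[OF assms(1)])
  show "(z has_derivative (\<lambda>h. h *\<^sub>R w s)) (at s)" if "s \<in> I" for s
    using assms(2)[OF that] by (simp add: has_vector_derivative_def)
  show "higher_differentiable_on I (\<lambda>s. h *\<^sub>R w s) n" for h
    by (rule higher_differentiable_on_linear[OF assms(1) bounded_linear_scaleR_right assms(3)])
qed

text \<open>Regularity for differential equations: each turn of the induction gains one derivative
  when the right-hand side \<open>w\<close> is as regular as \<open>z\<close> itself.\<close>

lemma smooth_on_bootstrap:
  fixes z :: "real \<Rightarrow> 'a::real_normed_vector"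
  assumes "open I" "\<And>s. s \<in> I \<Longrightarrow> (z has_vector_derivative w s) (at s)"
    and "\<And>n. higher_differentiable_on I z n \<Longrightarrow> higher_differentiable_on I w n"
  shows "smooth_on I z"
  unfolding smooth_on_def
proof
  fix n show "higher_differentiable_on I z n"
  proof (induction n)
    case 0
    then show ?case
      using assms(2) by (auto intro!: continuous_at_imp_continuous_on dest: has_vector_derivative_continuous)
  next
    case (Suc n)
    then show ?case
      using assms higher_differentiable_on_vector_derivativeI by blast
  qed
qed

lemma smooth_on_vector_derivative:
  fixes z :: "real \<Rightarrow> 'a::real_normed_vector"
  assumes "open I" "smooth_on I z"
  shows "\<And>s. s \<in> I \<Longrightarrow> (z has_vector_derivative vector_derivative z (at s)) (at s)"
    and "smooth_on I (\<lambda>s. vector_derivative z (at s))"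
proof -
  have d: "z differentiable at s" if "s \<in> I" for s
    using assms(2)[unfolded smooth_on_def, rule_format, of "Suc 0"] that by simp
  show *: "(z has_vector_derivative vector_derivative z (at s)) (at s)" if "s \<in> I" for s
    using d[OF that] by (simp add: vector_derivative_works)
  have "frechet_derivative z (at s) 1 = vector_derivative z (at s)" if "s \<in> I" for s
    using frechet_derivative_at[OF *[OF that, unfolded has_vector_derivative_def], symmetric] by simp
  moreover have "smooth_on I (\<lambda>s. frechet_derivative z (at s) 1)"
    unfolding smooth_on_def
  proof
    show "higher_differentiable_on I (\<lambda>s. frechet_derivative z (at s) 1) n" for n
      using assms(2)[unfolded smooth_on_def, rule_format, of "Suc n"] by simp
  qed
  ultimately show "smooth_on I (\<lambda>s. vector_derivative z (at s))"
    by (rule smooth_on_cong[OF assms(1)])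
qed

lemma higher_differentiable_on_Pair:
  assumes "open S" "higher_differentiable_on S f n" "higher_differentiable_on S g n"
  shows "higher_differentiable_on S (\<lambda>x. (f x, g x)) n"
proof -
  have "higher_differentiable_on S (\<lambda>x. (f x, 0) + (0, g x)) n"
    by (intro higher_differentiable_on_add assms(1)
        higher_differentiable_on_linear[OF assms(1) _ assms(2), of "\<lambda>u. (u, 0)"]
        higher_differentiable_on_linear[OF assms(1) _ assms(3), of "\<lambda>u. (0, u)"]
        bounded_linear_Pair bounded_linear_ident bounded_linear_zero)
  then show ?thesis by simp
qed

lemma smooth_on_antiderivative:
  fixes z :: "real \<Rightarrow> 'a::real_normed_vector"
  assumes "open I" "\<And>s. s \<in> I \<Longrightarrow> (z has_vector_derivative w s) (at s)" "smooth_on I w"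
  shows "smooth_on I z"
  using assms by (intro smooth_on_bootstrap[where w = w]) (auto simp: smooth_on_def)

subsection \<open>Ordinary differential equations with quadratic growth\<close>

lemma gronwall_forward:
  fixes z :: "real \<Rightarrow> 'a::real_inner"
  assumes "a \<le> b" "\<And>s. s \<in> {a..b} \<Longrightarrow> (z has_vector_derivative w s) (at s)"
    "\<And>s. s \<in> {a..b} \<Longrightarrow> norm (w s) \<le> L * norm (z s)"
  shows "norm (z b) \<le> exp (L * (b - a)) * norm (z a)"
proof -
  \<comment> \<open>The squared norm is differentiable also where \<open>z\<close> vanishes; the
    exponential weight turns the growth bound into monotonicity.\<close>
  define g where "g s = (z s \<bullet> z s) * exp (- 2 * L * s)" for s
  define g' where "g' s = (2 * (z s \<bullet> w s) - 2 * L * (z s \<bullet> z s)) * exp (- 2 * L * s)" for s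
  have "(g has_real_derivative g' s) (at s)" if "s \<in> {a..b}" for s
  proof -
    have "((\<lambda>s. z s \<bullet> z s) has_real_derivative 2 * (z s \<bullet> w s)) (at s)"
      using bounded_bilinear.has_vector_derivative[OF bounded_bilinear_inner assms(2)[OF that] assms(2)[OF that]]
      by (simp add: has_real_derivative_iff_has_vector_derivative inner_commute)
    then show ?thesis
      unfolding g_def g'_def by (auto intro!: derivative_eq_intros simp: algebra_simps)
  qed
  moreover have "g' s \<le> 0" if "s \<in> {a..b}" for s
  proof -
    have "z s \<bullet> w s \<le> norm (z s) * (L * norm (z s))"
      using assms(3)[OF that] norm_cauchy_schwarz[of "z s" "w s"]
      by (meson mult_left_mono norm_ge_zero order_trans)
    then show ?thesis
      by (simp add: g'_def mult_le_0_iff dot_square_norm power2_eq_square algebra_simps)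
  qed
  ultimately have "g b \<le> g a"
    by (intro DERIV_nonpos_imp_nonincreasing[OF assms(1)]) (meson atLeastAtMost_iff)
  then have "g b * exp (2 * L * b) \<le> g a * exp (2 * L * b)"
    by (intro mult_right_mono) auto
  then have "(z b \<bullet> z b) \<le> (z a \<bullet> z a) * exp (2 * L * b - 2 * L * a)"
    by (simp add: g_def mult.assoc exp_add[symmetric])
  also have "\<dots> = (exp (L * (b - a)) * norm (z a))\<^sup>2"
    by (simp add: power_mult_distrib dot_square_norm exp_double[symmetric] algebra_simps)
  finally show ?thesis
    unfolding dot_square_norm by (rule power2_le_imp_le) auto
qed

lemma has_vector_derivative_mirror:
  assumes "(z has_vector_derivative w) (at (- s))"
  shows "((\<lambda>s. z (- s)) has_vector_derivative - w) (at s)"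
proof -
  have "(uminus has_vector_derivative - 1) (at s)"
    by (auto intro!: derivative_eq_intros simp: has_real_derivative_iff_has_vector_derivative[symmetric])
  from vector_diff_chain_at[OF this assms] show ?thesis by (simp add: o_def)
qed

lemma gronwall:
  fixes z :: "real \<Rightarrow> 'a::real_inner"
  assumes "\<And>s. s \<in> closed_segment a b \<Longrightarrow> (z has_vector_derivative w s) (at s)"
    "\<And>s. s \<in> closed_segment a b \<Longrightarrow> norm (w s) \<le> L * norm (z s)"
  shows "norm (z b) \<le> exp (L * \<bar>b - a\<bar>) * norm (z a)"
proof (cases "a \<le> b")
  case True
  then show ?thesis
    using gronwall_forward[of a b z w L] assms by (simp add: closed_segment_eq_real_ivl)
next
  case False
  have "norm (z (- (- b))) \<le> exp (L * (- b - - a)) * norm (z (- (- a)))"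
  proof (rule gronwall_forward[of "- a" "- b" "\<lambda>s. z (- s)" "\<lambda>s. - w (- s)" L])
    show "((\<lambda>s. z (- s)) has_vector_derivative - w (- s)) (at s)" if "s \<in> {- a..- b}" for s
      using that False by (intro has_vector_derivative_mirror assms(1)) (auto simp: closed_segment_eq_real_ivl)
  qed (use assms(2) False in \<open>auto simp: closed_segment_eq_real_ivl\<close>)
  with False show ?thesis by simp
qed

text \<open>\<open>L\<close> is only continuous, so it is first bounded on the compact segment
  between \<open>a\<close> and \<open>b\<close>; the value 0 at \<open>a\<close> then absorbs
  whatever bound is found.\<close>

lemma gronwall_zero:
  fixes z :: "real \<Rightarrow> 'a::real_inner"
  assumes I: "is_interval I" "a \<in> I" "b \<in> I" "continuous_on I L"
    and z: "\<And>s. s \<in> I \<Longrightarrow> (z has_vector_derivative w s) (at s)"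
    "\<And>s. s \<in> I \<Longrightarrow> norm (w s) \<le> L s * norm (z s)" "z a = 0"
  shows "z b = 0"
proof -
  have sub: "closed_segment a b \<subseteq> I"
    using I by (simp add: closed_segment_subset is_interval_convex)
  have "compact (L ` closed_segment a b)"
    using continuous_on_subset[OF I(4) sub] by (intro compact_continuous_image) auto
  then obtain K where K: "\<And>s. s \<in> closed_segment a b \<Longrightarrow> L s \<le> K"
    by (meson bounded_imp_bdd_above bdd_above.unfold compact_imp_bounded imageI)
  have "norm (z b) \<le> exp (K * \<bar>b - a\<bar>) * norm (z a)"
  proof (rule gronwall)
    fix s assume s: "s \<in> closed_segment a b"
    then have "s \<in> I" using sub by blast
    then show "(z has_vector_derivative w s) (at s)" "norm (w s) \<le> K * norm (z s)"
      using z(1,2)[of s] order_trans[OF _ mult_right_mono[OF K[OF s] norm_ge_zero]] by blast+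
  qed
  with z(3) show ?thesis by simp
qed

section \<open>Autonomous equations: uniqueness, short-time existence, the maximal flow\<close>

definition ode_solution :: "('a::real_normed_vector \<Rightarrow> 'a) \<Rightarrow> real set \<Rightarrow> (real \<Rightarrow> 'a) \<Rightarrow> bool" where
  "ode_solution f I z \<longleftrightarrow> open_interval I \<and> (\<forall>s\<in>I. (z has_vector_derivative f (z s)) (at s))"

lemma ode_solution_continuous_on: "ode_solution f I z \<Longrightarrow> continuous_on I z"
  unfolding ode_solution_def
  by (auto intro!: continuous_at_imp_continuous_on dest: has_vector_derivative_continuous)

lemma ode_solution_shift:
  assumes "ode_solution f I z"
  shows "ode_solution f ((\<lambda>s. s + a) ` I) (\<lambda>s. z (s - a))"
  unfolding ode_solution_def
proof (intro conjI ballI)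
  have I: "open I" "is_interval I" "I \<noteq> {}"
    using assms by (auto simp: ode_solution_def open_interval_def)
  have "(\<lambda>s. s + a) ` I = (+) a ` I" by (auto simp: add.commute)
  then show "open_interval ((\<lambda>s. s + a) ` I)"
    using I by (auto simp: open_interval_def open_translation)
  fix s assume "s \<in> (\<lambda>s. s + a) ` I"
  then have "s - a \<in> I" by auto
  then have "(z has_vector_derivative f (z (s - a))) (at (s - a))"
    using assms by (auto simp: ode_solution_def)
  moreover have "((\<lambda>s. s - a) has_vector_derivative 1) (at s)"
    by (auto intro!: derivative_eq_intros simp: has_real_derivative_iff_has_vector_derivative[symmetric])
  ultimately show "((\<lambda>s. z (s - a)) has_vector_derivative f (z (s - a))) (at s)"
    using vector_diff_chain_at[of "\<lambda>s. s - a" 1 s z "f (z (s - a))"] by (simp add: o_def)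
qed

text \<open>The growth condition is that of a polynomial field of degree two: Lipschitz on every
  ball, with a constant controlled by the radius.\<close>

locale quadratic_ode =
  fixes f :: "'a::euclidean_space \<Rightarrow> 'a" and C :: real
  assumes lipschitz: "\<And>u w. norm (f u - f w) \<le> C * (1 + norm u + norm w) * norm (u - w)"
begin

lemma C_nonneg: "0 \<le> C"
proof -
  obtain b :: 'a where "b \<in> Basis" using nonempty_Basis by blast
  then have "norm b = 1" by simp
  then have "norm (f b - f 0) \<le> C * 2"
    using lipschitz[of b 0] by simp
  with norm_ge_zero[of "f b - f 0"] have "0 \<le> C * 2"
    by (rule order_trans)
  then show ?thesis by simp
qed

lemma continuous_on_f [continuous_intros]:
  assumes "continuous_on S g"
  shows "continuous_on S (\<lambda>x. f (g x))"
proof -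
  have "isCont f u" for u
  proof -
    have "((\<lambda>w. C * (1 + norm w + norm u) * norm (w - u)) \<longlongrightarrow> C * (1 + norm u + norm u) * norm (u - u)) (at u)"
      by (intro tendsto_intros)
    then have lim: "((\<lambda>w. C * (1 + norm w + norm u) * norm (w - u)) \<longlongrightarrow> 0) (at u)"
      by simp
    have "\<forall>\<^sub>F w in at u. norm (f w - f u) \<le> C * (1 + norm w + norm u) * norm (w - u)"
      by (rule always_eventually) (intro allI lipschitz)
    then have "((\<lambda>w. f w - f u) \<longlongrightarrow> 0) (at u)"
      by (rule Lim_null_comparison[OF _ lim])
    then show ?thesis
      by (simp add: isCont_def LIM_zero_iff)
  qed
  then have "continuous_on UNIV f" by (simp add: continuous_at_imp_continuous_on)
  then show ?thesis using assms by (rule continuous_on_compose2) auto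
qed

lemma unique:
  assumes "ode_solution f I z" "ode_solution f I' z'" "a \<in> I \<inter> I'" "z a = z' a" "b \<in> I \<inter> I'"
  shows "z b = z' b"
proof -
  have "z b - z' b = 0"
  proof (rule gronwall_zero)
    show "is_interval (I \<inter> I')"
      using assms by (auto simp: ode_solution_def open_interval_def intro: is_interval_Int)
    show "((\<lambda>s. z s - z' s) has_vector_derivative f (z s) - f (z' s)) (at s)" if "s \<in> I \<inter> I'" for s
      using assms that by (auto simp: ode_solution_def intro: has_vector_derivative_diff)
    show "continuous_on (I \<inter> I') (\<lambda>s. C * (1 + norm (z s) + norm (z' s)))"
      using assms(1,2)[THEN ode_solution_continuous_on]
      by (intro continuous_intros) (auto intro: continuous_on_subset)
    show "norm (f (z s) - f (z' s)) \<le> C * (1 + norm (z s) + norm (z' s)) * norm (z s - z' s)" for s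
      by (rule lipschitz)
  qed (use assms(3-5) in auto)
  then show ?thesis by simp
qed

text \<open>Picard's theorem is applied to the composition of the field with the projection to a ball, which is
  globally Lipschitz; for short times its solution does not leave the ball.\<close>

lemma local_existence:
  "\<exists>h>0. \<forall>z0. norm z0 \<le> R \<longrightarrow> (\<exists>z. ode_solution f {- h<..<h} z \<and> z 0 = z0)"
proof -
  define r where "r = \<bar>R\<bar> + 1"
  define p where "p = closest_point (cball (0::'a) r)"
  have r: "r > 0" by (simp add: r_def)
  have p_in: "norm (p u) \<le> r" for u
    using closest_point_in_set[of "cball (0::'a) r" u] r by (auto simp: p_def)
  have p_lip: "norm (p u - p w) \<le> norm (u - w)" for u w
    using closest_point_lipschitz[of "cball (0::'a) r" u w] r by (simp add: p_def dist_norm)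
  have p_id: "p u = u" if "norm u \<le> r" for u
    using that by (simp add: p_def closest_point_self)
  define L where "L = C * (1 + r + r)"
  have L: "L \<ge> 0" using C_nonneg r by (simp add: L_def)
  have fp_lip: "norm (f (p u) - f (p w)) \<le> L * norm (u - w)" for u w
  proof -
    have "norm (f (p u) - f (p w)) \<le> C * (1 + norm (p u) + norm (p w)) * norm (p u - p w)"
      by (rule lipschitz)
    also have "\<dots> \<le> L * norm (u - w)"
      unfolding L_def using C_nonneg p_in p_lip r
      by (intro mult_mono mult_left_mono add_mono) auto
    finally show ?thesis .
  qed
  have fp_cont: "continuous_on S (\<lambda>s. f (p (g s)))" if "continuous_on S g" for S and g :: "real \<Rightarrow> 'a"
    unfolding p_def using r that
    by (intro continuous_intros continuous_on_compose2[OF continuous_on_closest_point[of "cball 0 r" UNIV]]) auto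
  define B where "B = norm (f 0) + L * r"
  have fp_bd: "norm (f (p u)) \<le> B" for u
  proof -
    have "norm (f (p u) - f (p 0)) \<le> L * norm (p u - 0)"
      using fp_lip[of "p u" 0] p_id p_in by auto
    also have "\<dots> \<le> L * r" using p_in L by (intro mult_left_mono) auto
    finally show ?thesis
      using norm_triangle_ineq2[of "f (p u)" "f (p 0)"] p_id[of 0] r by (simp add: B_def)
  qed
  have B: "B \<ge> 0" using L r by (simp add: B_def)
  \<comment> \<open>Two smallness conditions meet here: \<open>4 * h * L \<le> 1 / 2\<close> makes
    the integral operator a contraction, and \<open>h * B \<le> 1\<close> keeps the solution within
    distance 1 of \<open>z0\<close>, the margin between \<open>\<bar>R\<bar>\<close> and
    \<open>r\<close>.\<close>
  define h where "h = 1 / (8 * (L + B + 1))"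
  have h: "h > 0" using L B by (simp add: h_def)
  have hL: "4 * h * L \<le> 1 / 2" and hB: "h * B \<le> 1"
    using L B by (auto simp: h_def divide_simps)
  \<comment> \<open>Time is clamped to \<open>[- h, h]\<close> so that the operator acts on bounded
    continuous functions on the whole line, a complete space.\<close>
  define cl where "cl s = max (- h) (min h s)" for s :: real
  have cl_cont: "continuous_on S cl" for S
    unfolding cl_def by (intro continuous_intros)
  have cl_in: "cl s \<in> {- h..h}" for s
    using h by (auto simp: cl_def)
  have cl_id: "cl s = s" if "s \<in> {- h..h}" for s
    using that by (auto simp: cl_def)
  have "\<exists>z. ode_solution f {- h<..<h} z \<and> z 0 = z0" if z0: "norm z0 \<le> R" for z0
  proof -
    \<comment> \<open>Integration starts at \<open>- h\<close> because an integral over a reversed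
      interval is 0; subtracting \<open>F \<phi> 0\<close> in \<open>G\<close> moves the base point
      to time 0.\<close>
    define F where "F \<phi> s = integral {- h..s} (\<lambda>u. f (p (apply_bcontfun \<phi> u)))" for \<phi> :: "real \<Rightarrow>\<^sub>C 'a" and s
    have int: "(\<lambda>u. f (p (apply_bcontfun \<phi> u))) integrable_on {a..b}" for \<phi> :: "real \<Rightarrow>\<^sub>C 'a" and a b
      by (intro integrable_continuous_real fp_cont) (auto intro: continuous_on_subset continuous_on_apply_bcontfun)
    define G where "G \<phi> s = z0 + F \<phi> (cl s) - F \<phi> 0" for \<phi> s
    have F_der: "(F \<phi> has_vector_derivative f (p (apply_bcontfun \<phi> s))) (at s within {- h..h})"
      if "s \<in> {- h..h}" for \<phi> s
      unfolding F_def
      by (rule integral_has_vector_derivative[OF fp_cont that]) (auto intro: continuous_on_subset continuous_on_apply_bcontfun)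
    have F_cont: "continuous_on {- h..h} (F \<phi>)" for \<phi>
      using F_der has_vector_derivative_continuous
      unfolding continuous_on_eq_continuous_within by blast
    have G_cont: "continuous_on UNIV (G \<phi>)" for \<phi>
      unfolding G_def by (intro continuous_intros continuous_on_compose2[OF F_cont cl_cont]) (use cl_in in auto)
    have G_bc: "G \<phi> \<in> bcontfun" for \<phi>
    proof -
      have "bounded (F \<phi> ` {- h..h})"
        by (intro compact_imp_bounded compact_continuous_image F_cont) auto
      then obtain K where "\<forall>u\<in>F \<phi> ` {- h..h}. norm u \<le> K"
        unfolding bounded_iff by blast
      then have K: "\<And>s. s \<in> {- h..h} \<Longrightarrow> norm (F \<phi> s) \<le> K"
        by blast
      have "norm (G \<phi> s) \<le> norm z0 + K + K" for s
        unfolding G_def using K[OF cl_in[of s]] K[of 0] h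
        by (intro norm_triangle_le_diff norm_triangle_le add_mono) auto
      then show ?thesis
        using G_cont by (auto simp: bcontfun_def bounded_iff)
    qed
    define P where "P \<phi> = Bcontfun (G \<phi>)" for \<phi>
    have P_app: "apply_bcontfun (P \<phi>) = G \<phi>" for \<phi>
      by (simp add: P_def Bcontfun_inverse G_bc)
    have F_lip: "norm (F \<phi> s - F \<psi> s) \<le> 2 * h * L * dist \<phi> \<psi>" if "s \<in> {- h..h}" for \<phi> \<psi> s
    proof -
      have "norm (F \<phi> s - F \<psi> s) = norm (integral {- h..s} (\<lambda>u. f (p (apply_bcontfun \<phi> u)) - f (p (apply_bcontfun \<psi> u))))"
        unfolding F_def by (subst Henstock_Kurzweil_Integration.integral_diff[OF int int]) simp
      also have "\<dots> \<le> L * dist \<phi> \<psi> * (s - - h)"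
      proof (rule integral_bound)
        show "continuous_on {- h..s} (\<lambda>u. f (p (apply_bcontfun \<phi> u)) - f (p (apply_bcontfun \<psi> u)))"
          by (intro continuous_intros fp_cont) (auto intro: continuous_on_subset continuous_on_apply_bcontfun)
        fix u
        show "norm (f (p (apply_bcontfun \<phi> u)) - f (p (apply_bcontfun \<psi> u))) \<le> L * dist \<phi> \<psi>"
          using fp_lip[of "apply_bcontfun \<phi> u" "apply_bcontfun \<psi> u"] dist_bounded[of \<phi> u \<psi>] L
          by (metis dist_norm mult_left_mono order_trans)
      qed (use that in auto)
      also have "\<dots> \<le> L * dist \<phi> \<psi> * (2 * h)"
        using that L by (intro mult_left_mono) auto
      finally show ?thesis by (simp add: algebra_simps)
    qed
    have "dist (P \<phi>) (P \<psi>) \<le> 1 / 2 * dist \<phi> \<psi>" for \<phi> \<psi>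
    proof (rule dist_bound)
      fix s
      have "norm (G \<phi> s - G \<psi> s) = norm ((F \<phi> (cl s) - F \<psi> (cl s)) - (F \<phi> 0 - F \<psi> 0))"
        by (simp add: G_def algebra_simps)
      also have "\<dots> \<le> 2 * h * L * dist \<phi> \<psi> + 2 * h * L * dist \<phi> \<psi>"
        using F_lip[where s = "cl s" and \<phi> = \<phi> and \<psi> = \<psi>] F_lip[where s = 0 and \<phi> = \<phi> and \<psi> = \<psi>] cl_in h
        by (intro order_trans[OF norm_triangle_ineq4 add_mono]) auto
      also have "\<dots> = 4 * h * L * dist \<phi> \<psi>" by simp
      also have "\<dots> \<le> 1 / 2 * dist \<phi> \<psi>"
        using hL by (intro mult_right_mono) auto
      finally show "dist (apply_bcontfun (P \<phi>) s) (apply_bcontfun (P \<psi>) s) \<le> 1 / 2 * dist \<phi> \<psi>"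
        by (simp add: P_app dist_norm)
    qed
    then have "\<exists>!\<phi>. P \<phi> = \<phi>"
      using banach_fix_type[of "1/2" P] by auto
    then obtain \<phi> where \<phi>: "P \<phi> = \<phi>" by blast
    define z where "z = apply_bcontfun \<phi>"
    have z_G: "z s = G \<phi> s" for s
      by (metis P_app \<phi> z_def)
    have z_eq: "z s = z0 + F \<phi> s - F \<phi> 0" if "s \<in> {- h..h}" for s
      using that by (simp add: z_G G_def cl_id)
    have zd: "(z has_vector_derivative f (p (z s))) (at s within {- h..h})" if "s \<in> {- h..h}" for s
    proof (rule has_vector_derivative_transform[OF that])
      show "((\<lambda>s. z0 + F \<phi> s - F \<phi> 0) has_vector_derivative f (p (z s))) (at s within {- h..h})"
        using F_der[OF that, of \<phi>] unfolding z_def by (auto intro!: derivative_eq_intros)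
    qed (simp add: z_eq)
    have z_0: "z 0 = z0" using h by (simp add: z_eq)
    have "norm (z s) \<le> r" if "s \<in> {- h..h}" for s
    proof -
      have "norm (z s - z 0) \<le> B * norm (s - 0)"
      proof (rule differentiable_bound[of "{- h..h}" z "\<lambda>s k. k *\<^sub>R f (p (z s))"])
        show "onorm (\<lambda>k. k *\<^sub>R f (p (z s))) \<le> B" for s
          using fp_bd by (intro onorm_le) (simp add: mult.commute[of B] mult_left_mono)
      qed (use that h zd in \<open>auto simp: has_vector_derivative_def\<close>)
      also have "\<dots> \<le> B * h" using that B by (intro mult_left_mono) auto
      finally show ?thesis
        using hB z0 norm_triangle_ineq2[of "z s" "z 0"] by (simp add: z_0 r_def mult.commute)
    qed
    then have "(z has_vector_derivative f (z s)) (at s)" if "s \<in> {- h<..<h}" for s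
      using zd[of s] that at_within_Icc_at[of "- h" s h] p_id[of "z s"] by simp
    then have "ode_solution f {- h<..<h} z"
      using h by (simp add: ode_solution_def open_interval_def is_interval_oo)
    with z_0 show ?thesis by blast
  qed
  with h show ?thesis by blast
qed

definition domain :: "'a \<Rightarrow> real set" where
  "domain z0 = \<Union>{I. 0 \<in> I \<and> (\<exists>z. ode_solution f I z \<and> z 0 = z0)}"

text \<open>A choice among the values at \<open>s\<close> of all solutions through
  \<open>z0\<close>; by \<open>unique\<close> they agree, and outside \<open>domain z0\<close> the
  value carries no information.\<close>

definition flow :: "'a \<Rightarrow> real \<Rightarrow> 'a" where
  "flow z0 s = (SOME u. \<exists>I z. 0 \<in> I \<and> s \<in> I \<and> ode_solution f I z \<and> z 0 = z0 \<and> z s = u)"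

lemma flow_eq:
  assumes "ode_solution f I z" "0 \<in> I" "s \<in> I"
  shows "s \<in> domain (z 0)" "flow (z 0) s = z s"
proof -
  show "s \<in> domain (z 0)" using assms by (auto simp: domain_def)
  show "flow (z 0) s = z s"
    unfolding flow_def using assms unique by (intro some_equality) blast+
qed

lemma zero_in_domain: "0 \<in> domain z0"
proof -
  obtain h z where "h > 0" "ode_solution f {- h<..<h} z" "z 0 = z0"
    using local_existence[of "norm z0"] by blast
  then show ?thesis using flow_eq(1)[of "{- h<..<h}" z 0] by auto
qed

lemma ode_solution_flow: "ode_solution f (domain z0) (flow z0)"
  unfolding ode_solution_def
proof (intro conjI ballI)
  define \<I> where "\<I> = {I. 0 \<in> I \<and> (\<exists>z. ode_solution f I z \<and> z 0 = z0)}"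
  have D: "domain z0 = \<Union>\<I>" by (simp add: domain_def \<I>_def)
  have "open (domain z0)"
    unfolding D by (rule open_Union) (auto simp: \<I>_def ode_solution_def open_interval_def)
  moreover have "connected (\<Union>\<I>)"
    by (rule connected_Union)
      (auto simp: \<I>_def ode_solution_def open_interval_def is_interval_connected_1)
  ultimately show "open_interval (domain z0)"
    using zero_in_domain[of z0] unfolding open_interval_def is_interval_connected_1 D by blast
  fix s assume "s \<in> domain z0"
  then obtain I z where I: "0 \<in> I" "s \<in> I" "ode_solution f I z" "z 0 = z0"
    by (auto simp: domain_def)
  then have d: "(z has_vector_derivative f (z s)) (at s)" "open I"
    by (auto simp: ode_solution_def open_interval_def)
  have "(flow z0 has_vector_derivative f (z s)) (at s)"
    by (rule has_vector_derivative_transform_within_open[OF d I(2)]) (use I flow_eq(2) in auto)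
  then show "(flow z0 has_vector_derivative f (flow z0 s)) (at s)"
    using flow_eq(2)[OF I(3,1,2)] I by simp
qed

lemma flow_0: "flow z0 0 = z0"
proof -
  obtain h z where "h > 0" "ode_solution f {- h<..<h} z" "z 0 = z0"
    using local_existence[of "norm z0"] by blast
  then show ?thesis using flow_eq(2)[of "{- h<..<h}" z 0] by auto
qed

lemma glue:
  assumes "ode_solution f I z" "ode_solution f I' z'" "a \<in> I \<inter> I'" "z a = z' a"
  shows "ode_solution f (I \<union> I') (\<lambda>s. if s \<in> I then z s else z' s)" (is "ode_solution f _ ?z")
  unfolding ode_solution_def
proof (intro conjI ballI)
  have I: "open I" "is_interval I" "open I'" "is_interval I'"
    using assms by (auto simp: ode_solution_def open_interval_def)
  then have "connected (I \<union> I')"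
    using assms(3) by (intro connected_Un) (auto simp: is_interval_connected_1)
  with I assms(3) show "open_interval (I \<union> I')"
    by (auto simp: open_interval_def is_interval_connected_1)
  have eq: "?z s = z' s" if "s \<in> I'" for s
    using unique[OF assms(1-4), of s] that by auto
  fix s assume "s \<in> I \<union> I'"
  then show "(?z has_vector_derivative f (?z s)) (at s)"
  proof
    assume s: "s \<in> I"
    then have "(z has_vector_derivative f (z s)) (at s)" using assms by (auto simp: ode_solution_def)
    then show ?thesis using s
      by (auto intro: has_vector_derivative_transform_within_open[OF _ I(1)])
  next
    assume s: "s \<in> I'"
    then have "(z' has_vector_derivative f (z' s)) (at s)" using assms by (auto simp: ode_solution_def)
    then have "(?z has_vector_derivative f (z' s)) (at s)"
      by (rule has_vector_derivative_transform_within_open[OF _ I(3) s]) (use eq in auto)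
    then show ?thesis by (simp only: eq[OF s])
  qed
qed

text \<open>The existence time \<open>h\<close> depends only on the bound \<open>R\<close>, so
  restarting the equation at a point closer to \<open>b\<close> than \<open>h\<close> carries the
  solution past \<open>b\<close>. The segment notation treats right and left ends at once.\<close>

lemma bounded_solution_extends:
  assumes z: "ode_solution f I z" and I: "closed_segment s0 b - {b} \<subseteq> I" "s0 \<noteq> b"
    and bd: "\<And>s. s \<in> closed_segment s0 b - {b} \<Longrightarrow> norm (z s) \<le> R"
  shows "\<exists>I' z'. ode_solution f I' z' \<and> insert b I \<subseteq> I' \<and> (\<forall>s\<in>I. z' s = z s)"
proof -
  obtain h where h: "h > 0" "\<And>z0. norm z0 \<le> R \<Longrightarrow> \<exists>z. ode_solution f {- h<..<h} z \<and> z 0 = z0"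
    using local_existence by blast
  \<comment> \<open>The factor 2 puts the restarting point \<open>a\<close> within
    \<open>h / 2\<close> of \<open>b\<close>; the cap at 1 keeps it on the segment.\<close>
  define t where "t = min 1 (h / (2 * \<bar>s0 - b\<bar>))"
  define a where "a = b + t * (s0 - b)"
  have t: "0 < t" "t \<le> 1" using h I(2) by (auto simp: t_def)
  have "a = (1 - t) * b + t * s0" by (simp add: a_def algebra_simps)
  with t have "a \<in> closed_segment b s0" by (auto simp: closed_segment_def)
  with t I(2) have a: "a \<in> closed_segment s0 b - {b}"
    by (auto simp: closed_segment_commute a_def)
  have "t \<le> h / (2 * \<bar>s0 - b\<bar>)" by (simp add: t_def)
  then have "t * \<bar>s0 - b\<bar> \<le> h / 2" using I(2) by (simp add: field_simps)
  then have ab: "\<bar>b - a\<bar> < h" using h t by (simp add: a_def abs_mult)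
  obtain y where y: "ode_solution f {- h<..<h} y" "y 0 = z a"
    using h(2)[OF bd[OF a]] by blast
  define I' where "I' = (\<lambda>s. s + a) ` {- h<..<h}"
  have "ode_solution f I' (\<lambda>s. y (s - a))"
    unfolding I'_def by (rule ode_solution_shift[OF y(1)])
  moreover have "a \<in> I'" using h by (auto simp: I'_def image_iff)
  moreover have "b \<in> I'"
    using ab unfolding I'_def by (intro image_eqI[of _ _ "b - a"]) auto
  moreover have "a \<in> I" using a I(1) by blast
  ultimately have "ode_solution f (I \<union> I') (\<lambda>s. if s \<in> I then z s else y (s - a))"
    using glue[OF z, of I' "\<lambda>s. y (s - a)" a] y(2) by simp
  with \<open>b \<in> I'\<close> show ?thesis
    by (intro exI[of _ "I \<union> I'"] exI[of _ "\<lambda>s. if s \<in> I then z s else y (s - a)"]) simp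
qed

end

subsection \<open>The Minkowski product and null frames\<close>

lemma bounded_bilinear_mink: "bounded_bilinear mink"
proof -
  define g :: "real^3 \<Rightarrow> real^3" where "g u = (\<chi> i. if i = 1 then - u$1 else u$i)" for u
  have "bounded_linear g"
    by (intro linear_conv_bounded_linear[THEN iffD1] linearI) (auto simp: g_def vec_eq_iff)
  then have "bounded_bilinear (\<lambda>u w. g u \<bullet> w)"
    by (rule bounded_bilinear.comp1[OF bounded_bilinear_inner])
  moreover have "(\<lambda>u w. g u \<bullet> w) = mink"
    by (auto simp: fun_eq_iff mink_def g_def inner_vec_def sum_3)
  ultimately show ?thesis by simp
qed

lemmas mink_add_left = bounded_bilinear.add_left[OF bounded_bilinear_mink]
  and mink_add_right = bounded_bilinear.add_right[OF bounded_bilinear_mink]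
  and mink_diff_left = bounded_bilinear.diff_left[OF bounded_bilinear_mink]
  and mink_diff_right = bounded_bilinear.diff_right[OF bounded_bilinear_mink]
  and mink_minus_left = bounded_bilinear.minus_left[OF bounded_bilinear_mink]
  and mink_minus_right = bounded_bilinear.minus_right[OF bounded_bilinear_mink]
  and mink_zero_left = bounded_bilinear.zero_left[OF bounded_bilinear_mink]
  and mink_zero_right = bounded_bilinear.zero_right[OF bounded_bilinear_mink]

lemma mink_scaleR_left: "mink (a *\<^sub>R u) w = a * mink u w"
  by (simp add: mink_def algebra_simps)

lemma mink_scaleR_right: "mink u (a *\<^sub>R w) = a * mink u w"
  by (simp add: mink_def algebra_simps)

lemmas mink_simps = mink_add_left mink_add_right mink_diff_left mink_diff_right mink_minus_left
  mink_minus_right mink_zero_left mink_zero_right mink_scaleR_left mink_scaleR_right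

lemma mink_commute: "mink u w = mink w u"
  by (simp add: mink_def algebra_simps)

lemma has_real_derivative_mink:
  assumes "(u has_vector_derivative u') (at s)" "(w has_vector_derivative w') (at s)"
  shows "((\<lambda>s. mink (u s) (w s)) has_real_derivative mink (u s) w' + mink u' (w s)) (at s)"
  using bounded_bilinear.has_vector_derivative[OF bounded_bilinear_mink assms]
  by (simp add: has_real_derivative_iff_has_vector_derivative)

text \<open>The sign says that \<open>u\<close> and \<open>e\<close> have the same time orientation iff their product is negative.\<close>

lemma mink_causal_timelike:
  assumes "mink e e < 0" "u \<noteq> 0" "mink u u \<le> 0"
  shows "mink u e * (u$1 * e$1) < 0"
proof -
  define d where "d = u$2 * e$2 + u$3 * e$3"
  have u: "(u$2)\<^sup>2 + (u$3)\<^sup>2 \<le> (u$1)\<^sup>2" and e: "(e$2)\<^sup>2 + (e$3)\<^sup>2 < (e$1)\<^sup>2"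
    using assms by (auto simp: mink_def power2_eq_square)
  have "u$1 \<noteq> 0"
  proof
    assume "u$1 = 0"
    with u have "u$2 = 0 \<and> u$3 = 0"
      by (metis power_zero_numeral sum_power2_le_zero_iff)
    with \<open>u$1 = 0\<close> assms(2) show False by (auto simp: vec_eq_iff forall_3)
  qed
  have "d\<^sup>2 \<le> ((u$2)\<^sup>2 + (u$3)\<^sup>2) * ((e$2)\<^sup>2 + (e$3)\<^sup>2)"
  proof -
    have "((u$2)\<^sup>2 + (u$3)\<^sup>2) * ((e$2)\<^sup>2 + (e$3)\<^sup>2) - d\<^sup>2 = (u$2 * e$3 - u$3 * e$2)\<^sup>2"
      by (simp add: d_def power2_eq_square algebra_simps)
    then show ?thesis by (smt (verit) zero_le_power2)
  qed
  also have "\<dots> \<le> (u$1)\<^sup>2 * ((e$2)\<^sup>2 + (e$3)\<^sup>2)"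
    using u by (intro mult_right_mono) auto
  also have "\<dots> < (u$1)\<^sup>2 * (e$1)\<^sup>2"
    using e \<open>u$1 \<noteq> 0\<close> by (intro mult_strict_left_mono) auto
  finally have "\<bar>d\<bar> < \<bar>u$1 * e$1\<bar>"
    by (metis abs_le_square_iff linorder_not_less power_mult_distrib)
  then have "d * (u$1 * e$1) < (u$1 * e$1) * (u$1 * e$1)"
  proof -
    have "d * (u$1 * e$1) \<le> \<bar>d\<bar> * \<bar>u$1 * e$1\<bar>"
      by (metis abs_ge_self abs_mult)
    also have "\<dots> < \<bar>u$1 * e$1\<bar> * \<bar>u$1 * e$1\<bar>"
      using \<open>\<bar>d\<bar> < _\<close> by (intro mult_strict_right_mono) auto
    finally show ?thesis by simp
  qed
  then show ?thesis
    by (simp add: mink_def d_def algebra_simps)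
qed

text \<open>The Gram matrix of the frame \<open>X, T, Y\<close> of a spacelike curve on the light cone.\<close>

definition null_frame :: "real^3 \<Rightarrow> real^3 \<Rightarrow> real^3 \<Rightarrow> bool" where
  "null_frame X T Y \<longleftrightarrow> mink X X = 0 \<and> mink X T = 0 \<and> mink T T = 1 \<and> mink X Y = 1 \<and>
     mink T Y = 0 \<and> mink Y Y = 0 \<and> X$1 > 0"

lemma null_frame_mink:
  assumes "null_frame X T Y"
  shows "mink X X = 0" "mink X T = 0" "mink T X = 0" "mink T T = 1" "mink X Y = 1" "mink Y X = 1"
    "mink T Y = 0" "mink Y T = 0" "mink Y Y = 0" "X$1 > 0"
  using assms mink_commute unfolding null_frame_def by auto

lemma null_frame_future_cone: "null_frame X T Y \<Longrightarrow> X \<in> future_cone"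
  by (auto simp: null_frame_def future_cone_def light_cone_def)

text \<open>\<open>X\<close> and \<open>Y\<close> are null with product 1, so each is dual to the
  other: the coefficient of \<open>X\<close> is the product with \<open>Y\<close>. The products
  recover the coefficients, which makes \<open>L\<close> injective, and equal dimensions make it
  surjective.\<close>

lemma null_frame_expand:
  assumes "null_frame X T Y"
  shows "u = mink u Y *\<^sub>R X + mink u T *\<^sub>R T + mink u X *\<^sub>R Y"
proof -
  note m = null_frame_mink[OF assms]
  define L :: "real^3 \<Rightarrow> real^3" where "L a = a$1 *\<^sub>R X + a$2 *\<^sub>R T + a$3 *\<^sub>R Y" for a
  have "linear L"
    by (auto simp: L_def linear_iff algebra_simps)
  have coord: "mink (L a) Y = a$1" "mink (L a) T = a$2" "mink (L a) X = a$3" for a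
    by (simp_all add: L_def mink_simps m)
  have "inj L"
  proof (rule injI)
    fix a b assume "L a = L b"
    then have "a$1 = b$1" "a$2 = b$2" "a$3 = b$3" using coord by metis+
    then show "a = b" by (simp add: vec_eq_iff forall_3)
  qed
  with \<open>linear L\<close> have "surj L"
    using linear_injective_imp_surjective by blast
  then obtain a where "u = L a" by blast
  then show ?thesis using coord L_def by metis
qed

lemma null_frame_mink_expand:
  assumes "null_frame X T Y"
  shows "mink u w = mink u Y * mink w X + mink u T * mink w T + mink u X * mink w Y"
proof -
  have "mink u w = mink u (mink w Y *\<^sub>R X + mink w T *\<^sub>R T + mink w X *\<^sub>R Y)"
    using null_frame_expand[OF assms, of w] by simp
  then show ?thesis by (simp add: mink_simps algebra_simps)
qed

lemma null_frame_invariant: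
  assumes "null_frame X T Y"
  shows "2 * mink X v * mink Y v + (mink T v)\<^sup>2 = mink v v"
  using null_frame_mink_expand[OF assms, of v v]
  by (simp add: mink_commute[of v X] mink_commute[of v T] mink_commute[of v Y] power2_eq_square)

text \<open>The products with \<open>T\<close> and \<open>X\<close> leave only \<open>Y\<close> plus
  a multiple of \<open>X\<close>; nullity kills the multiple.\<close>

lemma null_frame_unique:
  assumes "null_frame X T Y" "mink Y' Y' = 0" "mink T Y' = 0" "mink X Y' = 1"
  shows "Y' = Y"
proof -
  have *: "Y' = mink Y' Y *\<^sub>R X + Y"
    using null_frame_expand[OF assms(1), of Y'] assms(3,4) by (simp add: mink_commute)
  have "mink Y' Y' = 2 * mink Y' Y"
    by (subst (1 2) *) (simp add: mink_simps null_frame_mink[OF assms(1)])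
  then show ?thesis using * assms(2) by simp
qed

lemma null_frame_exists:
  assumes "X \<in> future_cone" "mink X T = 0" "mink T T = 1"
  shows "\<exists>Y. null_frame X T Y"
proof -
  have X: "mink X X = 0" "X$1 > 0" using assms(1) by (auto simp: future_cone_def light_cone_def)
  \<comment> \<open>Reflecting \<open>X\<close> in time gives a null vector transversal to
    \<open>X\<close>; \<open>\<alpha>\<close> normalises its product with \<open>X\<close>, and the
    multiples of \<open>T\<close> and \<open>X\<close> then restore orthogonality to
    \<open>T\<close> and nullity.\<close>
  define n :: "real^3" where "n = vector [- (X$1), X$2, X$3]"
  have n: "mink n n = 0" "mink X n = 2 * (X$1)\<^sup>2"
    using X(1) by (auto simp: n_def mink_def vector_3 power2_eq_square)
  define \<alpha> where "\<alpha> = 1 / (2 * (X$1)\<^sup>2)"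
  define \<beta> where "\<beta> = - \<alpha> * mink T n"
  define \<gamma> where "\<gamma> = \<beta>\<^sup>2 / 2"
  define Y where "Y = \<alpha> *\<^sub>R n + \<beta> *\<^sub>R T + \<gamma> *\<^sub>R X"
  have "\<alpha> * (2 * (X$1)\<^sup>2) = 1" using X(2) by (simp add: \<alpha>_def)
  then have an: "\<alpha> * mink X n = 1" using n by simp
  have Tn: "\<alpha> * mink T n = - \<beta>" by (simp add: \<beta>_def)
  have "mink X Y = 1"
    by (simp add: Y_def mink_simps assms(2) X an)
  moreover have "mink T Y = 0"
    using assms(2,3) by (simp add: Y_def mink_simps mink_commute[of T X] Tn)
  moreover have "mink Y Y = 0"
  proof -
    have "mink Y Y = 2 * \<beta> * (\<alpha> * mink T n) + \<beta>\<^sup>2 + 2 * \<gamma> * (\<alpha> * mink X n)"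
      by (simp add: Y_def mink_simps n(1) X(1) assms mink_commute[of n T] mink_commute[of n X] mink_commute[of T X]
          power2_eq_square algebra_simps)
    then show ?thesis unfolding Tn an by (simp add: \<gamma>_def power2_eq_square)
  qed
  ultimately have "null_frame X T Y"
    using X assms by (simp add: null_frame_def)
  then show ?thesis ..
qed

text \<open>\<open>X - Y\<close> has square -2, which makes it the test vector for the time
  orientation of whatever is expressed in the frame.\<close>

lemma null_frame_timelike:
  assumes "null_frame X T Y"
  shows "mink (X - Y) (X - Y) < 0" "(X - Y)$1 > 0"
proof -
  note m = null_frame_mink[OF assms]
  show *: "mink (X - Y) (X - Y) < 0" by (simp add: mink_simps m)
  have "mink X (X - Y) * (X$1 * (X - Y)$1) < 0"
    by (rule mink_causal_timelike[OF *]) (use m in auto)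
  then have "X$1 * (X - Y)$1 > 0" by (simp add: mink_simps m)
  then show "(X - Y)$1 > 0" using m by (simp add: zero_less_mult_iff)
qed

text \<open>Exchanging the two null directions is the duality between a curve and
  \<open>- Y\<close>; the signs are forced because \<open>Y\<close> points to the past.\<close>

lemma null_frame_flip:
  assumes "null_frame X T Y"
  shows "null_frame (- Y) T (- X)"
proof -
  note m = null_frame_mink[OF assms]
  have "Y \<noteq> 0" using m(5) by (auto simp: mink_simps)
  then have "mink Y (X - Y) * (Y$1 * (X - Y)$1) < 0"
    using m by (intro mink_causal_timelike null_frame_timelike[OF assms]) auto
  then have "Y$1 < 0"
    using null_frame_timelike(2)[OF assms] by (simp add: mink_simps m mult_less_0_iff)
  then show ?thesis by (simp add: null_frame_def mink_simps m)
qed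

lemma null_frame_scaleR:
  assumes "null_frame X T Y" "a > 0"
  shows "null_frame (a *\<^sub>R X) T ((1 / a) *\<^sub>R Y)"
  using assms by (simp add: null_frame_def mink_simps)

lemma null_frame_uminus: "null_frame X T Y \<Longrightarrow> null_frame X (- T) Y"
  by (simp add: null_frame_def mink_simps)

subsection \<open>The frame equations\<close>

text \<open>Evaluates the descriptions in the definitions of frame and curvature for a curve whose
  frame is already known. \<open>a\<close> is the speed, hence positive: it is 1 for arc length, and
  a general \<open>a\<close> serves the scaled curves and \<open>- Y\<close>.\<close>

lemma frame_of_curve:
  assumes "open S"
    and Z: "\<And>s. s \<in> S \<Longrightarrow> (Z has_vector_derivative a s *\<^sub>R U s) (at s)"
    and U: "\<And>s. s \<in> S \<Longrightarrow> (U has_vector_derivative a s *\<^sub>R (\<kappa> s *\<^sub>R Z s - W s)) (at s)"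
    and fr: "\<And>s. s \<in> S \<Longrightarrow> null_frame (Z s) (U s) (W s)" "\<And>s. s \<in> S \<Longrightarrow> a s > 0"
    and s: "s \<in> S"
  shows "velocity Z s = a s *\<^sub>R U s" "tangent Z s = U s" "associated Z s = W s" "curvature Z s = \<kappa> s"
    "spacelike (velocity Z s)"
proof -
  have vel: "velocity Z s = a s *\<^sub>R U s" if "s \<in> S" for s
    unfolding velocity_def by (rule vector_derivative_at[OF Z[OF that]])
  have sp: "speed Z s = a s" if "s \<in> S" for s
    using fr[OF that] by (simp add: speed_def vel[OF that] mink_simps null_frame_mink(4) real_sqrt_mult[symmetric])
  have tan: "tangent Z s = U s" if "s \<in> S" for s
    using fr(2)[OF that] vel[OF that] by (simp add: tangent_def arc_derivative_def sp[OF that] velocity_def)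
  note m = null_frame_mink[OF fr(1)[OF s]]
  have W: "associated Z s = W s"
    unfolding associated_def tan[OF s]
  proof (rule the_equality)
    have "W s \<noteq> 0" using m(5) by (auto simp: mink_simps)
    then show "lightlike (W s) \<and> mink (U s) (W s) = 0 \<and> mink (Z s) (W s) = 1"
      using m by (simp add: lightlike_def)
  qed (use null_frame_unique[OF fr(1)[OF s]] in \<open>auto simp: lightlike_def\<close>)
  have "(tangent Z has_vector_derivative a s *\<^sub>R (\<kappa> s *\<^sub>R Z s - W s)) (at s)"
    by (rule has_vector_derivative_transform_within_open[OF U[OF s] assms(1) s]) (simp add: tan)
  then have "arc_derivative Z (tangent Z) s = \<kappa> s *\<^sub>R Z s - W s"
    using fr(2)[OF s] by (simp add: arc_derivative_def sp[OF s] vector_derivative_at)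
  moreover have "Z s \<noteq> 0" using m(5) by (auto simp: mink_simps)
  ultimately show "curvature Z s = \<kappa> s"
    unfolding curvature_def W by (intro the_equality) auto
  show "velocity Z s = a s *\<^sub>R U s" "tangent Z s = U s" "associated Z s = W s"
    using vel[OF s] tan[OF s] W by auto
  show "spacelike (velocity Z s)"
    using fr(2)[OF s] by (simp add: spacelike_def vel[OF s] mink_simps m)
qed

text \<open>The equations \<open>X' = T\<close>, \<open>T' = k X - Y\<close>, \<open>Y' = - k T\<close>, closed up by \<open>k = c + \<langle>T, v\<rangle>\<close>.\<close>

definition frame_field :: "real^3 \<Rightarrow> real \<Rightarrow> (real^3) \<times> (real^3) \<times> (real^3) \<Rightarrow> (real^3) \<times> (real^3) \<times> (real^3)" where
  "frame_field v c = (\<lambda>(X, T, Y). (T, (c + mink T v) *\<^sub>R X - Y, - (c + mink T v) *\<^sub>R T))"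

lemma frame_ode_iff:
  "ode_solution (frame_field v c) I (\<lambda>s. (X s, T s, Y s)) \<longleftrightarrow> open_interval I \<and>
    (\<forall>s\<in>I. (X has_vector_derivative T s) (at s) \<and>
      (T has_vector_derivative (c + mink (T s) v) *\<^sub>R X s - Y s) (at s) \<and>
      (Y has_vector_derivative - (c + mink (T s) v) *\<^sub>R T s) (at s))"
proof -
  have pair: "((\<lambda>s. (f s, g s)) has_vector_derivative (f', g')) (at s) \<longleftrightarrow>
      (f has_vector_derivative f') (at s) \<and> (g has_vector_derivative g') (at s)"
    for f :: "real \<Rightarrow> 'a::real_normed_vector" and g :: "real \<Rightarrow> 'b::real_normed_vector" and f' g' s
    using has_vector_derivative_Pair[of f f' s UNIV g g']
      bounded_linear.has_vector_derivative[OF bounded_linear_fst, of "\<lambda>s. (f s, g s)" "(f', g')" "at s"]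
      bounded_linear.has_vector_derivative[OF bounded_linear_snd, of "\<lambda>s. (f s, g s)" "(f', g')" "at s"]
    by auto
  show ?thesis by (auto simp: ode_solution_def frame_field_def pair)
qed

lemma frame_field_lipschitz:
  "\<exists>C. \<forall>u w. norm (frame_field v c u - frame_field v c w) \<le> C * (1 + norm u + norm w) * norm (u - w)"
proof -
  obtain K where K: "K > 0" "\<And>a. norm (mink a v) \<le> norm a * K"
    using bounded_linear.pos_bounded[OF bounded_bilinear.bounded_linear_left[OF bounded_bilinear_mink, of v]]
    by auto
  \<comment> \<open>The linear terms of the field contribute \<open>2 + 2 * \<bar>c\<bar>\<close>,
    the two products with the linear form \<open>mink _ v\<close> a multiple of \<open>K\<close>,
    generously rounded.\<close>
  define C where "C = 2 + 2 * \<bar>c\<bar> + 4 * K"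
  have "norm (frame_field v c u - frame_field v c w) \<le> C * (1 + norm u + norm w) * norm (u - w)" for u w
  proof -
    obtain X T Y X' T' Y' where u: "u = (X, T, Y)" "w = (X', T', Y')" by (metis prod_cases3)
    define d where "d = norm (u - w)"
    have triple: "norm x \<le> norm (x, y, z)" "norm y \<le> norm (x, y, z)" "norm z \<le> norm (x, y, z)"
      for x y z :: "real^3"
      using norm_fst_le[of x "(y, z)"] norm_snd_le[of "(y, z)" x] norm_fst_le[of y z] norm_snd_le[of z y]
      by linarith+
    have d: "norm (X - X') \<le> d" "norm (T - T') \<le> d" "norm (Y - Y') \<le> d"
      and n: "norm X \<le> norm u" "norm T \<le> norm u" "norm T' \<le> norm w"
      unfolding d_def u diff_Pair by (rule triple)+
    have d0: "d \<ge> 0" by (simp add: d_def)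
    have quad: "norm ((c + mink T v) *\<^sub>R Z - (c + mink T' v) *\<^sub>R Z') \<le> \<bar>c\<bar> * d + K * (norm u + norm w) * d"
      if Z: "norm Z \<le> norm u" "norm (Z - Z') \<le> d" for Z Z' :: "real^3"
    proof -
      have "(c + mink T v) *\<^sub>R Z - (c + mink T' v) *\<^sub>R Z' =
          c *\<^sub>R (Z - Z') + (mink (T - T') v *\<^sub>R Z + mink T' v *\<^sub>R (Z - Z'))"
        by (simp add: mink_simps algebra_simps)
      also have "norm \<dots> \<le> \<bar>c\<bar> * d + (K * d * norm u + K * norm w * d)"
      proof (intro norm_triangle_le add_mono)
        show "norm (c *\<^sub>R (Z - Z')) \<le> \<bar>c\<bar> * d"
          using Z by (simp add: mult_left_mono)
        have "\<bar>mink (T - T') v\<bar> \<le> K * d"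
          using K(2)[of "T - T'"] d(2) K(1)
          by (metis mult.commute mult_left_mono order_trans less_imp_le real_norm_def)
        then show "norm (mink (T - T') v *\<^sub>R Z) \<le> K * d * norm u"
          using Z d0 K(1) by (simp add: mult_mono)
        have "\<bar>mink T' v\<bar> \<le> K * norm w"
          using K(2)[of T'] n(3) K(1)
          by (metis mult.commute mult_left_mono order_trans less_imp_le real_norm_def)
        then show "norm (mink T' v *\<^sub>R (Z - Z')) \<le> K * norm w * d"
          using Z d0 K(1) by (simp add: mult_mono)
      qed
      finally show ?thesis by (simp add: algebra_simps)
    qed
    have sum_le: "norm (a, b - e, - g) \<le> norm a + ((norm b + norm e) + norm g)" for a b e g :: "real^3"
      using norm_Pair_le[of a "(b - e, - g)"] norm_Pair_le[of "b - e" "- g"] norm_triangle_ineq4[of b e]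
      by simp
    have "frame_field v c u - frame_field v c w =
        (T - T', ((c + mink T v) *\<^sub>R X - (c + mink T' v) *\<^sub>R X') - (Y - Y'),
          - ((c + mink T v) *\<^sub>R T - (c + mink T' v) *\<^sub>R T'))"
      by (simp add: frame_field_def u algebra_simps)
    also note sum_le
    also have "norm (T - T') + ((norm ((c + mink T v) *\<^sub>R X - (c + mink T' v) *\<^sub>R X') + norm (Y - Y'))
        + norm ((c + mink T v) *\<^sub>R T - (c + mink T' v) *\<^sub>R T'))
      \<le> d + ((\<bar>c\<bar> * d + K * (norm u + norm w) * d + d)
        + (\<bar>c\<bar> * d + K * (norm u + norm w) * d))"
      using d n by (intro add_mono quad)
    also have "\<dots> = (2 + 2 * \<bar>c\<bar>) * d * 1 + 2 * K * d * (norm u + norm w)"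
      by (simp add: algebra_simps)
    also have "\<dots> \<le> (2 + 2 * \<bar>c\<bar>) * d * (1 + norm u + norm w) + 4 * K * d * (1 + norm u + norm w)"
      using d0 K(1) by (intro add_mono mult_mono) auto
    also have "\<dots> = C * (1 + norm u + norm w) * d"
      by (simp add: C_def algebra_simps)
    finally show ?thesis by (simp add: d_def)
  qed
  then show ?thesis by blast
qed

text \<open>A constant named for each \<open>v\<close> and \<open>c\<close> allows a single
  interpretation of the locale with both as parameters.\<close>

definition frame_constant :: "real^3 \<Rightarrow> real \<Rightarrow> real" where
  "frame_constant v c = (SOME C. \<forall>u w. norm (frame_field v c u - frame_field v c w)
     \<le> C * (1 + norm u + norm w) * norm (u - w))"

interpretation frame: quadratic_ode "frame_field v c" "frame_constant v c" for v c
  using someI_ex[OF frame_field_lipschitz, of v c] by unfold_locales (auto simp: frame_constant_def)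

text \<open>The deviations of the six Gram entries from their target values satisfy a linear
  homogeneous system with coefficients built from \<open>k\<close>, so they stay 0. The sign of the
  first coordinate then persists by connectedness.\<close>

lemma null_frame_preserved:
  assumes ode: "ode_solution (frame_field v c) I (\<lambda>s. (X s, T s, Y s))"
    and "a \<in> I" "null_frame (X a) (T a) (Y a)" "b \<in> I"
  shows "null_frame (X b) (T b) (Y b)"
proof -
  define k where "k s = c + mink (T s) v" for s
  have I: "open I" "is_interval I" using ode by (auto simp: frame_ode_iff open_interval_def)
  have der: "(X has_vector_derivative T s) (at s)"
      "(T has_vector_derivative k s *\<^sub>R X s - Y s) (at s)"
      "(Y has_vector_derivative - k s *\<^sub>R T s) (at s)" if "s \<in> I" for s
    using ode that unfolding frame_ode_iff k_def by blast+
  define z where "z s = (mink (X s) (X s), mink (X s) (T s), mink (T s) (T s) - 1,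
    mink (X s) (Y s) - 1, mink (T s) (Y s), mink (Y s) (Y s))" for s
  \<comment> \<open>The linear system, with \<open>\<kappa>\<close> the current curvature; it is
    homogeneous because the constants 1 in the target values cancel.\<close>
  define G where "G \<kappa> = (\<lambda>(p, q, r, u, w, y). (2 * q, \<kappa> * p + r - u, 2 * \<kappa> * q - 2 * w,
    w - \<kappa> * q, \<kappa> * u - \<kappa> * r - y, - 2 * \<kappa> * w))"
    for \<kappa> :: real and z :: "real \<times> real \<times> real \<times> real \<times> real \<times> real"
  have zd: "(z has_vector_derivative G (k s) (z s)) (at s)" if "s \<in> I" for s
  proof -
    note d = der[OF that]
    note comm = mink_commute[of "T s" "X s"] mink_commute[of "Y s" "X s"] mink_commute[of "Y s" "T s"]
    have "((\<lambda>s. mink (X s) (X s)) has_vector_derivative 2 * mink (X s) (T s)) (at s)"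
      unfolding has_real_derivative_iff_has_vector_derivative[symmetric]
      by (rule DERIV_cong[OF has_real_derivative_mink[OF d(1) d(1)]])
        (simp add: mink_simps comm algebra_simps)
    moreover
    have "((\<lambda>s. mink (X s) (T s)) has_vector_derivative k s * mink (X s) (X s) + (mink (T s) (T s) - 1) - (mink (X s) (Y s) - 1)) (at s)"
      unfolding has_real_derivative_iff_has_vector_derivative[symmetric]
      by (rule DERIV_cong[OF has_real_derivative_mink[OF d(1) d(2)]])
        (simp add: mink_simps comm algebra_simps)
    moreover
    have "((\<lambda>s. mink (T s) (T s) - 1) has_vector_derivative 2 * k s * mink (X s) (T s) - 2 * mink (T s) (Y s)) (at s)"
      unfolding has_real_derivative_iff_has_vector_derivative[symmetric]
      by (rule DERIV_cong[OF DERIV_diff[OF has_real_derivative_mink[OF d(2) d(2)] DERIV_const]])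
        (simp add: mink_simps comm algebra_simps)
    moreover
    have "((\<lambda>s. mink (X s) (Y s) - 1) has_vector_derivative mink (T s) (Y s) - k s * mink (X s) (T s)) (at s)"
      unfolding has_real_derivative_iff_has_vector_derivative[symmetric]
      by (rule DERIV_cong[OF DERIV_diff[OF has_real_derivative_mink[OF d(1) d(3)] DERIV_const]])
        (simp add: mink_simps comm algebra_simps)
    moreover
    have "((\<lambda>s. mink (T s) (Y s)) has_vector_derivative k s * (mink (X s) (Y s) - 1) - k s * (mink (T s) (T s) - 1) - mink (Y s) (Y s)) (at s)"
      unfolding has_real_derivative_iff_has_vector_derivative[symmetric]
      by (rule DERIV_cong[OF has_real_derivative_mink[OF d(2) d(3)]])
        (simp add: mink_simps comm algebra_simps)
    moreover
    have "((\<lambda>s. mink (Y s) (Y s)) has_vector_derivative - 2 * k s * mink (T s) (Y s)) (at s)"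
      unfolding has_real_derivative_iff_has_vector_derivative[symmetric]
      by (rule DERIV_cong[OF has_real_derivative_mink[OF d(3) d(3)]])
        (simp add: mink_simps comm algebra_simps)
    ultimately show ?thesis
      unfolding z_def G_def prod.case by (intro has_vector_derivative_Pair)
  qed
  have Gn: "norm (G \<kappa> z) \<le> (20 + 20 * \<bar>\<kappa>\<bar>) * norm z" for \<kappa> z
  proof -
    obtain p q r u w y where z: "z = (p, q, r, u, w, y)" by (metis prod_cases6)
    have n: "\<bar>p\<bar> \<le> norm z" "\<bar>q\<bar> \<le> norm z" "\<bar>r\<bar> \<le> norm z" "\<bar>u\<bar> \<le> norm z" "\<bar>w\<bar> \<le> norm z" "\<bar>y\<bar> \<le> norm z"
      unfolding z norm_Pair real_norm_def
      by (auto intro!: real_le_rsqrt simp: power2_eq_square)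
    define M where "M = \<bar>\<kappa>\<bar> * norm z"
    have M0: "M \<ge> 0" by (simp add: M_def)
    have m: "\<bar>\<kappa> * p\<bar> \<le> M" "\<bar>\<kappa> * q\<bar> \<le> M" "\<bar>\<kappa> * r\<bar> \<le> M"
      "\<bar>\<kappa> * u\<bar> \<le> M" "\<bar>\<kappa> * w\<bar> \<le> M"
      using n by (auto simp: M_def abs_mult intro!: mult_left_mono)
    have "norm (G \<kappa> z) \<le> \<bar>2 * q\<bar> + (\<bar>\<kappa> * p + r - u\<bar> + (\<bar>2 * \<kappa> * q - 2 * w\<bar>
        + (\<bar>w - \<kappa> * q\<bar> + (\<bar>\<kappa> * u - \<kappa> * r - y\<bar> + \<bar>- 2 * \<kappa> * w\<bar>))))"
      unfolding G_def z prod.case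
      by (intro order_trans[OF norm_Pair_le] add_mono) auto
    also have "\<dots> \<le> 2 * norm z + ((M + 2 * norm z) + ((2 * M + 2 * norm z)
        + ((norm z + M) + ((2 * M + norm z) + 2 * M))))"
    proof (intro add_mono)
      show "\<bar>2 * q\<bar> \<le> 2 * norm z" using n(2) by simp
      show "\<bar>\<kappa> * p + r - u\<bar> \<le> M + 2 * norm z" using m(1) n(3,4) by linarith
      show "\<bar>2 * \<kappa> * q - 2 * w\<bar> \<le> 2 * M + 2 * norm z" using m(2) n(5) by linarith
      show "\<bar>w - \<kappa> * q\<bar> \<le> norm z + M" using m(2) n(5) by linarith
      show "\<bar>\<kappa> * u - \<kappa> * r - y\<bar> \<le> 2 * M + norm z" using m(3,4) n(6) by linarith
      show "\<bar>- 2 * \<kappa> * w\<bar> \<le> 2 * M" using m(5) by linarith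
    qed
    also have "\<dots> \<le> 20 * norm z + 20 * M"
      using M0 norm_ge_zero[of z] by linarith
    finally show ?thesis by (simp add: M_def algebra_simps)
  qed
  have Tc: "continuous_on I T"
    using der(2) by (auto intro!: continuous_at_imp_continuous_on dest: has_vector_derivative_continuous)
  have Xc: "continuous_on I X"
    using der(1) by (auto intro!: continuous_at_imp_continuous_on dest: has_vector_derivative_continuous)
  have kc: "continuous_on I (\<lambda>s. 20 + 20 * \<bar>k s\<bar>)"
    unfolding k_def mink_def by (intro continuous_intros Tc)
  have za: "z a = 0"
    using null_frame_mink[OF assms(3)] by (simp add: z_def zero_prod_def)
  have z0: "z s = 0" if "s \<in> I" for s
    by (rule gronwall_zero[OF I(2) assms(2) that kc zd Gn za])
  have "(X b)$1 > 0"
  proof (rule ccontr)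
    assume "\<not> (X b)$1 > 0"
    \<comment> \<open>At a zero of the first coordinate the null vector \<open>X s\<close> would be
      0, against its product 1 with \<open>Y s\<close>.\<close>
    have nz: "(X s)$1 \<noteq> 0" if "s \<in> I" for s
    proof
      assume "(X s)$1 = 0"
      moreover have "mink (X s) (X s) = 0" "mink (X s) (Y s) = 1"
        using z0[OF that] by (auto simp: z_def zero_prod_def)
      ultimately have "(X s)$2 = 0 \<and> (X s)$3 = 0"
        by (simp add: mink_def sum_squares_eq_zero_iff)
      with \<open>(X s)$1 = 0\<close> \<open>mink (X s) (Y s) = 1\<close> show False by (simp add: mink_def)
    qed
    have "is_interval ((\<lambda>s. (X s)$1) ` I)"
      using I Xc by (intro is_interval_connected_1[THEN iffD2] connected_continuous_image)
        (auto simp: is_interval_connected_1 intro!: continuous_intros)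
    moreover have "(X a)$1 \<in> (\<lambda>s. (X s)$1) ` I" "(X b)$1 \<in> (\<lambda>s. (X s)$1) ` I"
      using assms by auto
    moreover have "(X b)$1 \<le> 0" "0 \<le> (X a)$1"
      using \<open>\<not> (X b)$1 > 0\<close> null_frame_mink(10)[OF assms(3)] by auto
    ultimately have "0 \<in> (\<lambda>s. (X s)$1) ` I"
      unfolding is_interval_1 by blast
    with nz show False by auto
  qed
  with z0[OF assms(4)] show ?thesis
    by (simp add: null_frame_def z_def zero_prod_def)
qed

text \<open>A linear isometry permutes the light cone, and the product with a future timelike vector
  tells the two halves of the cone apart; hence a single timelike vector whose orientation is kept
  settles the future cone.\<close>

lemma cone_isometryI:
  assumes iso: "\<And>u w. mink (M *v u) (M *v w) = mink u w"
    and e: "mink e e < 0" "e$1 > 0" "(M *v e)$1 > 0"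
  shows "cone_isometry M"
proof -
  have Me: "mink (M *v e) (M *v e) < 0" using iso e by simp
  have future: "p$1 > 0 \<longleftrightarrow> mink p d < 0" if "p \<in> light_cone" "mink d d < 0" "d$1 > 0" for p d
    using mink_causal_timelike[OF that(2), of p] that by (auto simp: light_cone_def mult_less_0_iff zero_less_mult_iff)
  have "inj ((*v) M)"
  proof (rule injI)
    fix u w assume "M *v u = M *v w"
    then have "mink (u - w) z = 0" for z
      using iso[of "u - w" z] by (simp add: matrix_vector_mult_diff_distrib mink_simps)
    from this[of "vector [1, 0, 0]"] this[of "vector [0, 1, 0]"] this[of "vector [0, 0, 1]"]
    show "u = w" by (simp add: mink_def vec_eq_iff forall_3)
  qed
  then have "surj ((*v) M)"
    by (simp add: linear_injective_imp_surjective)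
  have cone: "M *v p \<in> light_cone \<longleftrightarrow> p \<in> light_cone" for p
    using \<open>inj ((*v) M)\<close> iso[of p p] injD[of "(*v) M" p 0] by (auto simp: light_cone_def)
  have "M *v p \<in> future_cone \<longleftrightarrow> p \<in> future_cone" for p
    using cone[of p] future[of p e] future[of "M *v p" "M *v e"] e Me iso[of p e]
    by (auto simp: future_cone_def)
  then have "(*v) M ` future_cone = future_cone"
    using \<open>surj ((*v) M)\<close> by (auto simp: image_iff) (metis surjD)
  then show ?thesis using iso by (simp add: cone_isometry_def)
qed

lemma cone_isometry_null_frame:
  assumes "cone_isometry M" "null_frame X T Y"
  shows "null_frame (M *v X) (M *v T) (M *v Y)"
proof -
  have "M *v X \<in> future_cone"
    using assms null_frame_future_cone unfolding cone_isometry_def by blast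
  then show ?thesis
    using assms by (simp add: null_frame_def cone_isometry_def future_cone_def)
qed

text \<open>The formula is the expansion in the first frame with its vectors replaced by those of
  the second. Equal Gram matrices make it an isometry, and \<open>X - Y\<close> shows that it keeps
  the time orientation.\<close>

lemma frame_isometry:
  assumes F: "null_frame X T Y" and F': "null_frame X' T' Y'"
  shows "\<exists>M. cone_isometry M \<and> (\<forall>u. M *v u = mink u Y *\<^sub>R X' + mink u T *\<^sub>R T' + mink u X *\<^sub>R Y')"
proof -
  define L where "L u = mink u Y *\<^sub>R X' + mink u T *\<^sub>R T' + mink u X *\<^sub>R Y'" for u
  have "linear L"
    by (auto simp: L_def linear_iff mink_simps algebra_simps)
  then have M: "matrix L *v u = L u" for u
    by (simp add: matrix_works)
  note m = null_frame_mink[OF F'] null_frame_mink[OF F]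
  have "cone_isometry (matrix L)"
  proof (rule cone_isometryI)
    show "mink (matrix L *v u) (matrix L *v w) = mink u w" for u w
      unfolding M null_frame_mink_expand[OF F, of u w] by (simp add: L_def mink_simps m)
    show "mink (X - Y) (X - Y) < 0" "(X - Y)$1 > 0"
      by (fact null_frame_timelike[OF F])+
    have "L (X - Y) = X' - Y'" by (simp add: L_def mink_simps m)
    then show "(matrix L *v (X - Y))$1 > 0"
      unfolding M using null_frame_timelike[OF F'] by simp
  qed
  then show ?thesis using M L_def by metis
qed

section \<open>Curves with \<open>k = c + \<langle>T, v\<rangle>\<close> and solutions of the frame
  system\<close>

lemma smooth_on_frame_solution:
  assumes "ode_solution (frame_field v c) I z"
  shows "smooth_on I (\<lambda>s. fst (z s))"
proof -
  have I: "open I" using assms by (simp add: ode_solution_def open_interval_def)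
  have "smooth_on I z"
  proof (rule smooth_on_bootstrap[OF I])
    show "(z has_vector_derivative frame_field v c (z s)) (at s)" if "s \<in> I" for s
      using assms that by (simp add: ode_solution_def)
    fix n assume z: "higher_differentiable_on I z n"
    note lin = higher_differentiable_on_linear[OF I]
    have X: "higher_differentiable_on I (\<lambda>s. fst (z s)) n"
      and z2: "higher_differentiable_on I (\<lambda>s. snd (z s)) n"
      by (rule lin[OF bounded_linear_fst z] lin[OF bounded_linear_snd z])+
    have T: "higher_differentiable_on I (\<lambda>s. fst (snd (z s))) n"
      and Y: "higher_differentiable_on I (\<lambda>s. snd (snd (z s))) n"
      by (rule lin[OF bounded_linear_fst z2] lin[OF bounded_linear_snd z2])+
    have k: "higher_differentiable_on I (\<lambda>s. c + mink (fst (snd (z s))) v) n"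
      by (intro higher_differentiable_on_add[OF I] higher_differentiable_on_const[OF I]
          lin[OF bounded_bilinear.bounded_linear_left[OF bounded_bilinear_mink] T])
    have "higher_differentiable_on I (\<lambda>s. (fst (snd (z s)),
        (c + mink (fst (snd (z s))) v) *\<^sub>R fst (z s) + - snd (snd (z s)),
        - ((c + mink (fst (snd (z s))) v) *\<^sub>R fst (snd (z s))))) n"
      by (intro higher_differentiable_on_Pair[OF I] higher_differentiable_on_add[OF I] T
          higher_differentiable_on_bilinear[OF I bounded_bilinear_scaleR k]
          lin[OF bounded_linear_minus[OF bounded_linear_ident]] X Y)
    then show "higher_differentiable_on I (\<lambda>s. frame_field v c (z s)) n"
      by (simp add: frame_field_def case_prod_unfold del: minus_add_distrib)
  qed
  then show ?thesis
    by (rule smooth_on_linear[OF I bounded_linear_fst])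
qed

lemma frame_solution_solves:
  assumes ode: "ode_solution (frame_field v c) I (\<lambda>s. (X s, T s, Y s))"
    and fr: "a \<in> I" "null_frame (X a) (T a) (Y a)"
  shows "solves v c I X"
    and "\<And>s. s \<in> I \<Longrightarrow> tangent X s = T s" "\<And>s. s \<in> I \<Longrightarrow> associated X s = Y s"
    and "\<And>s. s \<in> I \<Longrightarrow> curvature X s = c + mink (T s) v"
proof -
  have I: "open_interval I" "open I" using ode by (auto simp: frame_ode_iff open_interval_def)
  have fr: "null_frame (X s) (T s) (Y s)" if "s \<in> I" for s
    by (rule null_frame_preserved[OF ode fr that])
  have d: "(X has_vector_derivative 1 *\<^sub>R T s) (at s)"
      "(T has_vector_derivative 1 *\<^sub>R ((c + mink (T s) v) *\<^sub>R X s - Y s)) (at s)" if "s \<in> I" for s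
    using ode that unfolding frame_ode_iff scaleR_one by blast+
  have f: "velocity X s = 1 *\<^sub>R T s" "tangent X s = T s" "associated X s = Y s"
      "curvature X s = c + mink (T s) v" "spacelike (velocity X s)" if "s \<in> I" for s
    by (rule frame_of_curve[OF I(2) d fr zero_less_one that]; assumption)+
  show T: "tangent X s = T s" and "associated X s = Y s" and k: "curvature X s = c + mink (T s) v"
    if "s \<in> I" for s using f[OF that] by blast+
  have "smooth_on I X" using smooth_on_frame_solution[OF ode] by simp
  moreover have "velocity X s = T s" if "s \<in> I" for s using f(1)[OF that] by simp
  ultimately have "arc_length_curve I X"
    using I fr f(5) null_frame_mink(4)[OF fr]
    by (auto simp: arc_length_curve_def spacelike_curve_def intro: null_frame_future_cone)
  then show "solves v c I X"
    using T k by (simp add: solves_def)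
qed

text \<open>The converse of \<open>frame_solution_solves\<close>. Differentiating the constant Gram
  entries yields the components of \<open>T'\<close> and \<open>Y'\<close> in the frame; only the
  component of \<open>T'\<close> along \<open>X\<close> remains free, and it is the
  curvature.\<close>

lemma solves_frame:
  assumes "solves v c I X"
  shows "ode_solution (frame_field v c) I (\<lambda>s. (X s, tangent X s, associated X s))"
    and "\<And>s. s \<in> I \<Longrightarrow> null_frame (X s) (tangent X s) (associated X s)"
    and "\<And>s. s \<in> I \<Longrightarrow> tangent X s = velocity X s"
proof -
  define T where "T = velocity X"
  define T' where "T' s = vector_derivative T (at s)" for s
  have I: "open_interval I" "open I" and sm: "smooth_on I X"
    and cone: "\<And>s. s \<in> I \<Longrightarrow> X s \<in> future_cone"
    and TT: "\<And>s. s \<in> I \<Longrightarrow> mink (T s) (T s) = 1"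
    and k: "\<And>s. s \<in> I \<Longrightarrow> curvature X s = c + mink (tangent X s) v"
    using assms by (auto simp: solves_def arc_length_curve_def spacelike_curve_def open_interval_def T_def)
  have X: "(X has_vector_derivative T s) (at s)" if "s \<in> I" for s
    using smooth_on_vector_derivative(1)[OF I(2) sm that] by (simp add: T_def velocity_def)
  have "smooth_on I T"
    using smooth_on_vector_derivative(2)[OF I(2) sm] by (simp add: T_def velocity_def[abs_def])
  note sT = smooth_on_vector_derivative[OF I(2) this]
  have T: "(T has_vector_derivative T' s) (at s)" if "s \<in> I" for s
    using sT(1)[OF that] by (simp add: T'_def)
  have T': "(T' has_vector_derivative vector_derivative T' (at s)) (at s)" if "s \<in> I" for s
    using smooth_on_vector_derivative(1)[OF I(2) sT(2) that] by (simp add: T'_def[abs_def])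
  have const: "D = 0" if "s \<in> I" "(f has_real_derivative D) (at s)" "\<And>s. s \<in> I \<Longrightarrow> f s = b" for f s D b
  proof -
    have "((\<lambda>_. b) has_real_derivative D) (at s)"
      by (rule has_field_derivative_transform_within_open[OF that(2) I(2) that(1)]) (rule that(3))
    then show ?thesis using DERIV_unique DERIV_const by blast
  qed
  have XX: "mink (X s) (X s) = 0" if "s \<in> I" for s
    using cone[OF that] by (simp add: future_cone_def light_cone_def)
  have XT: "mink (X s) (T s) = 0" if "s \<in> I" for s
    using const[OF that has_real_derivative_mink[OF X[OF that] X[OF that]] XX]
    by (simp add: mink_commute[of "T s" "X s"])
  have XT': "mink (X s) (T' s) = - 1" if "s \<in> I" for s
    using const[OF that has_real_derivative_mink[OF X[OF that] T[OF that]] XT] TT[OF that] by simp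
  have TT': "mink (T s) (T' s) = 0" if "s \<in> I" for s
    using const[OF that has_real_derivative_mink[OF T[OF that] T[OF that]] TT]
    by (simp add: mink_commute[of "T' s" "T s"])
  obtain Y where fr: "\<And>s. s \<in> I \<Longrightarrow> null_frame (X s) (T s) (Y s)"
    using null_frame_exists[OF cone XT TT] by metis
  define \<kappa> where "\<kappa> s = mink (T' s) (Y s)" for s
  have T'_eq: "T' s = \<kappa> s *\<^sub>R X s - Y s" if "s \<in> I" for s
    using null_frame_expand[OF fr[OF that], of "T' s"] XT'[OF that] TT'[OF that]
    by (simp add: \<kappa>_def mink_commute[of "T' s" "X s"] mink_commute[of "T' s" "T s"])
  have d: "(X has_vector_derivative 1 *\<^sub>R T s) (at s)"
      "(T has_vector_derivative 1 *\<^sub>R (\<kappa> s *\<^sub>R X s - Y s)) (at s)" if "s \<in> I" for s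
    using X[OF that] T[OF that] T'_eq[OF that] by simp_all
  have f: "velocity X s = 1 *\<^sub>R T s" "tangent X s = T s" "associated X s = Y s"
      "curvature X s = \<kappa> s" "spacelike (velocity X s)" if "s \<in> I" for s
    by (rule frame_of_curve[OF I(2) d fr zero_less_one that]; assumption)+
  have \<kappa>: "\<kappa> s = c + mink (T s) v" if "s \<in> I" for s
    using f(2,4)[OF that] k[OF that] by simp
  have Y: "(Y has_vector_derivative - \<kappa> s *\<^sub>R T s) (at s)" if s: "s \<in> I" for s
  proof -
    \<comment> \<open>\<open>Y\<close> comes without any regularity; it is differentiable because it
      equals \<open>k X - T'\<close>, whose ingredients are. The value of the derivative is then
      found from the Gram relations.\<close>
    have "((\<lambda>s. (c + mink (T s) v) *\<^sub>R X s - T' s) has_vector_derivative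
        (c + mink (T s) v) *\<^sub>R T s + mink (T' s) v *\<^sub>R X s - vector_derivative T' (at s)) (at s)"
      using has_real_derivative_mink[OF T[OF s] has_vector_derivative_const[of v]]
      by (intro has_vector_derivative_diff T' s has_vector_derivative_scaleR X)
        (auto intro!: derivative_eq_intros simp: mink_simps)
    then obtain D where "((\<lambda>s. (c + mink (T s) v) *\<^sub>R X s - T' s) has_vector_derivative D) (at s)"
      by blast
    then have D: "(Y has_vector_derivative D) (at s)"
      by (rule has_vector_derivative_transform_within_open[OF _ I(2) s]) (simp add: T'_eq \<kappa>)
    note m = null_frame_mink[OF fr]
    have "mink D (Y s) = 0"
      using const[OF s has_real_derivative_mink[OF D D] m(9)] by (simp add: mink_commute[of "Y s" D])
    moreover have "mink D (T s) = - \<kappa> s"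
      using const[OF s has_real_derivative_mink[OF D T[OF s]] m(8)] by (simp add: \<kappa>_def mink_commute[of "T' s" "Y s"])
    moreover have "mink D (X s) = 0"
      using const[OF s has_real_derivative_mink[OF D X[OF s]] m(6)] m(8)[OF s] by simp
    ultimately have "D = - \<kappa> s *\<^sub>R T s"
      using null_frame_expand[OF fr[OF s], of D] by simp
    with D show ?thesis by simp
  qed
  have "ode_solution (frame_field v c) I (\<lambda>s. (X s, T s, Y s))"
    unfolding frame_ode_iff using I X T Y T'_eq \<kappa> by simp
  then have "((\<lambda>s. (X s, T s, Y s)) has_vector_derivative frame_field v c (X s, T s, Y s)) (at s)"
    if "s \<in> I" for s using that by (simp add: ode_solution_def)
  then have "((\<lambda>s. (X s, tangent X s, associated X s)) has_vector_derivative frame_field v c (X s, T s, Y s)) (at s)"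
    if "s \<in> I" for s
    by (rule has_vector_derivative_transform_within_open[OF _ I(2) that]) (use that f(2,3) in auto)
  then show "ode_solution (frame_field v c) I (\<lambda>s. (X s, tangent X s, associated X s))"
    using I f(2,3) by (simp add: ode_solution_def)
  show "null_frame (X s) (tangent X s) (associated X s)" "tangent X s = velocity X s" if "s \<in> I" for s
    using that f(2,3) fr by (auto simp: T_def)
qed

subsection \<open>Maximal solutions\<close>

lemma open_interval_einterval:
  assumes "open_interval I"
  shows "einterval (Inf (ereal ` I)) (Sup (ereal ` I)) = I"
proof
  have I: "open I" "is_interval I" "I \<noteq> {}" using assms by (auto simp: open_interval_def)
  show "einterval (Inf (ereal ` I)) (Sup (ereal ` I)) \<subseteq> I"
  proof
    fix s assume "s \<in> einterval (Inf (ereal ` I)) (Sup (ereal ` I))"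
    then obtain a b where "a \<in> I" "b \<in> I" "a < s" "s < b"
      by (auto simp: einterval_def Inf_less_iff less_Sup_iff)
    then show "s \<in> I" using I(2) unfolding is_interval_1 by (meson less_imp_le)
  qed
  show "I \<subseteq> einterval (Inf (ereal ` I)) (Sup (ereal ` I))"
  proof
    fix s assume "s \<in> I"
    then obtain e where e: "e > 0" "ball s e \<subseteq> I" using I(1) openE by blast
    then have "s - e / 2 \<in> I" "s + e / 2 \<in> I" by (auto simp: subset_iff dist_real_def)
    then show "s \<in> einterval (Inf (ereal ` I)) (Sup (ereal ` I))"
      using e by (force simp: einterval_def Inf_less_iff less_Sup_iff)
  qed
qed

lemma einterval_Inf_Sup:
  assumes "a < b"
  shows "Inf (ereal ` einterval a b) = a" "Sup (ereal ` einterval a b) = b"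
proof -
  show "Inf (ereal ` einterval a b) = a"
  proof (rule antisym)
    show "Inf (ereal ` einterval a b) \<le> a"
    proof (rule ccontr)
      assume "\<not> Inf (ereal ` einterval a b) \<le> a"
      then obtain r where "a < ereal r" "ereal r < min b (Inf (ereal ` einterval a b))"
        using ereal_dense2[of a "min b (Inf (ereal ` einterval a b))"] assms by (auto simp: not_le)
      then show False
        using Inf_lower[of "ereal r" "ereal ` einterval a b"] by (auto simp: einterval_def)
    qed
    show "a \<le> Inf (ereal ` einterval a b)"
      by (rule Inf_greatest) (auto simp: einterval_def)
  qed
  show "Sup (ereal ` einterval a b) = b"
  proof (rule antisym)
    show "b \<le> Sup (ereal ` einterval a b)"
    proof (rule ccontr)
      assume "\<not> b \<le> Sup (ereal ` einterval a b)"
      then obtain r where "max a (Sup (ereal ` einterval a b)) < ereal r" "ereal r < b"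
        using ereal_dense2[of "max a (Sup (ereal ` einterval a b))" b] assms by (auto simp: not_le)
      then show False
        using Sup_upper[of "ereal r" "ereal ` einterval a b"] by (auto simp: einterval_def)
    qed
    show "Sup (ereal ` einterval a b) \<le> b"
      by (rule Sup_least) (auto simp: einterval_def)
  qed
qed

text \<open>The flow through the initial frame is itself a solution extending \<open>X\<close>, so
  maximality forces the domains to agree.\<close>

lemma maximal_solution_flow:
  assumes "maximal_solution v c \<alpha> \<omega> X"
  defines "z0 \<equiv> (X 0, tangent X 0, associated X 0)"
  shows "einterval \<alpha> \<omega> = frame.domain v c z0"
    and "\<And>s. s \<in> einterval \<alpha> \<omega> \<Longrightarrow> frame.flow v c z0 s = (X s, tangent X s, associated X s)"
    and "null_frame (X 0) (tangent X 0) (associated X 0)"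
proof -
  have s: "solves v c (einterval \<alpha> \<omega>) X" and 0: "0 \<in> einterval \<alpha> \<omega>"
    using assms(1) by (auto simp: maximal_solution_def einterval_def zero_ereal_def)
  note f = frame.flow_eq[OF solves_frame(1)[OF s] 0, folded z0_def]
  show fl: "frame.flow v c z0 s = (X s, tangent X s, associated X s)" if "s \<in> einterval \<alpha> \<omega>" for s
    by (rule f(2)[OF that])
  show fr: "null_frame (X 0) (tangent X 0) (associated X 0)" by (rule solves_frame(2)[OF s 0])
  have "solves v c (frame.domain v c z0) (\<lambda>s. fst (frame.flow v c z0 s))"
    using frame.ode_solution_flow[of v c z0] frame.zero_in_domain[of v c z0] frame.flow_0[of v c z0] fr
    by (intro frame_solution_solves(1)[where T = "\<lambda>s. fst (snd (frame.flow v c z0 s))"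
          and Y = "\<lambda>s. snd (snd (frame.flow v c z0 s))" and a = 0]) (simp_all add: z0_def)
  then show "einterval \<alpha> \<omega> = frame.domain v c z0"
    using assms(1) f(1) fl unfolding maximal_solution_def by (metis fst_conv subsetI)
qed

lemma maximal_solution_exists:
  assumes fr: "null_frame X0 T0 Y0"
  shows "\<exists>\<alpha> \<omega> X. maximal_solution v c \<alpha> \<omega> X \<and> X 0 = X0 \<and> tangent X 0 = T0 \<and> associated X 0 = Y0"
proof -
  define z0 where "z0 = (X0, T0, Y0)"
  define D where "D = frame.domain v c z0"
  define X where "X s = fst (frame.flow v c z0 s)" for s
  define T where "T s = fst (snd (frame.flow v c z0 s))" for s
  define Y where "Y s = snd (snd (frame.flow v c z0 s))" for s
  have ode: "ode_solution (frame_field v c) D (\<lambda>s. (X s, T s, Y s))"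
    using frame.ode_solution_flow[of v c z0] by (simp add: D_def X_def T_def Y_def)
  have 0: "0 \<in> D" "X 0 = X0" "T 0 = T0" "Y 0 = Y0"
    using frame.zero_in_domain[of v c z0] frame.flow_0[of v c z0] by (simp_all add: D_def X_def T_def Y_def z0_def)
  have D: "open_interval D" "open D" using ode by (auto simp: frame_ode_iff open_interval_def)
  have fr: "null_frame (X 0) (T 0) (Y 0)" using fr 0 by simp
  note f = frame_solution_solves[OF ode 0(1) fr]
  define \<alpha> \<omega> where "\<alpha> = Inf (ereal ` D)" and "\<omega> = Sup (ereal ` D)"
  have ei: "einterval \<alpha> \<omega> = D" unfolding \<alpha>_def \<omega>_def by (rule open_interval_einterval[OF D(1)])
  have "maximal_solution v c \<alpha> \<omega> X"
    unfolding maximal_solution_def ei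
  proof (intro conjI allI impI)
    show "\<alpha> < 0" "0 < \<omega>" using 0(1) by (auto simp: ei[symmetric] einterval_def zero_ereal_def)
    show "solves v c D X" by (rule f(1))
    \<comment> \<open>A competitor agrees with \<open>X\<close> near 0, so it has the same velocity
      there and the same \<open>Y\<close> by uniqueness of the null frame; therefore it cannot live
      beyond the domain of the flow.\<close>
    fix I X' assume *: "solves v c I X' \<and> D \<subseteq> I \<and> (\<forall>s\<in>D. X' s = X s)"
    then have s': "solves v c I X'" and I0: "0 \<in> I" using 0 by auto
    have "vector_derivative X' (at 0) = vector_derivative X (at 0)"
      using * 0(1) D(2)
      by (intro vector_derivative_cong_eq eventually_mono[OF eventually_nhds_in_open[OF D(2) 0(1)]]) auto
    then have T': "tangent X' 0 = T 0"
      using solves_frame(3)[OF s' I0] solves_frame(3)[OF f(1) 0(1)] f(2)[OF 0(1)] by (simp add: velocity_def)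
    have X': "X' 0 = X 0" using * 0 by simp
    have "associated X' 0 = Y 0"
      using solves_frame(2)[OF s' I0] unfolding T' X' 
      by (intro null_frame_unique[OF fr]) (auto simp: null_frame_def)
    then have "I \<subseteq> D"
      using frame.flow_eq(1)[OF solves_frame(1)[OF s'] I0] T' X' 0 by (auto simp: D_def z0_def)
    then show "I = D" using * by blast
  qed
  then show ?thesis using f(2,3)[OF 0(1)] 0 by blast
qed

text \<open>The isometry matching the frames at 0 fixes \<open>v\<close>, because \<open>v\<close>
  has the same coordinates in both; the frame field involves \<open>v\<close> only through
  \<langle>T, v\<rangle> and so commutes with it. Uniqueness for the frame equation does the
  rest.\<close>

lemma maximal_solution_isometric:
  assumes s: "maximal_solution v c \<alpha> \<omega> X" "maximal_solution v c \<alpha>' \<omega>' X'"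
    and eq: "initial_values v X = initial_values v X'"
  shows "\<exists>M. cone_isometry M \<and> M *v v = v \<and> (\<forall>s\<in>einterval \<alpha> \<omega>. X' s = M *v X s)"
    and "einterval \<alpha> \<omega> \<subseteq> einterval \<alpha>' \<omega>'"
proof -
  note f = maximal_solution_flow[OF s(1)] and f' = maximal_solution_flow[OF s(2)]
  obtain M where M: "cone_isometry M" "\<And>u. M *v u =
      mink u (associated X 0) *\<^sub>R X' 0 + mink u (tangent X 0) *\<^sub>R tangent X' 0 + mink u (X 0) *\<^sub>R associated X' 0"
    using frame_isometry[OF f(3) f'(3)] by blast
  have iso: "mink (M *v u) (M *v w) = mink u w" for u w using M(1) by (simp add: cone_isometry_def)
  have Mv: "M *v v = v"
    using null_frame_expand[OF f'(3), of v] eq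
    by (simp add: M(2) initial_values_def mink_commute[of v])
  have ode: "ode_solution (frame_field v c) (einterval \<alpha> \<omega>) (\<lambda>s. (X s, tangent X s, associated X s))"
    and 0: "0 \<in> einterval \<alpha> \<omega>"
    using s(1) solves_frame(1) by (auto simp: maximal_solution_def einterval_def zero_ereal_def)
  have "mink (M *v u) v = mink u v" for u using iso[of u v] Mv by simp
  then have odeM: "ode_solution (frame_field v c) (einterval \<alpha> \<omega>)
      (\<lambda>s. (M *v X s, M *v tangent X s, M *v associated X s))"
    using ode unfolding frame_ode_iff
    by (auto intro!: bounded_linear.has_vector_derivative[OF matrix_vector_mul_bounded_linear, THEN has_vector_derivative_eq_rhs]
        simp: matrix_vector_mult_diff_distrib matrix_vector_mult_scaleR)
  have z0: "(M *v X 0, M *v tangent X 0, M *v associated X 0) = (X' 0, tangent X' 0, associated X' 0)"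
    using null_frame_mink[OF f(3)] by (simp add: M(2))
  note g = frame.flow_eq[OF odeM 0, unfolded z0]
  show sub: "einterval \<alpha> \<omega> \<subseteq> einterval \<alpha>' \<omega>'"
    using g(1) f'(1) by blast
  have "X' s = M *v X s" if "s \<in> einterval \<alpha> \<omega>" for s
    using g(2)[OF that] f'(2)[of s] that sub by auto
  then show "\<exists>M. cone_isometry M \<and> M *v v = v \<and> (\<forall>s\<in>einterval \<alpha> \<omega>. X' s = M *v X s)"
    using M(1) Mv by blast
qed

lemma maximal_solution_ends_unique:
  assumes "maximal_solution v c \<alpha> \<omega> X" "maximal_solution v c \<alpha>' \<omega>' X'"
    and "initial_values v X = initial_values v X'"
  shows "\<alpha>' = \<alpha> \<and> \<omega>' = \<omega>"
proof -
  have "einterval \<alpha> \<omega> = einterval \<alpha>' \<omega>'"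
    using maximal_solution_isometric(2)[OF assms] maximal_solution_isometric(2)[OF assms(2,1) assms(3)[symmetric]]
    by blast
  moreover have "\<alpha> < \<omega>" "\<alpha>' < \<omega>'"
    using assms by (auto simp: maximal_solution_def)
  ultimately show ?thesis using einterval_Inf_Sup by metis
qed

subsection \<open>Self-similar evolution\<close>

text \<open>\<open>S\<close> and \<open>C\<close> are the coefficients of \<open>A\<close> and
  \<open>A^2\<close> in \<open>exp (g A)\<close> when \<open>A^3 = q A\<close>: polynomial,
  hyperbolic or trigonometric according to the sign of \<open>q\<close>. The quadratic identity is
  the Pythagorean relation of these functions and later makes the exponential an isometry.\<close>

lemma rotation_coefficients:
  obtains S C :: "real \<Rightarrow> real" where "S 0 = 0" "C 0 = 0" "\<And>g. C g \<ge> 0" "\<And>g. (S g)\<^sup>2 = 2 * C g + q * (C g)\<^sup>2"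
    "\<And>g. (S has_real_derivative 1 + q * C g) (at g)" "\<And>g. (C has_real_derivative S g) (at g)"
proof -
  consider "q = 0" | "q > 0" | "q < 0" by linarith
  then show ?thesis
  proof cases
    case 1
    show ?thesis
      by (rule that[of "\<lambda>g. g" "\<lambda>g. g\<^sup>2 / 2"]) (auto simp: 1 intro!: derivative_eq_intros)
  next
    case 2
    define r where "r = sqrt q"
    have r: "r > 0" "q = r\<^sup>2" using 2 by (auto simp: r_def)
    show ?thesis
    proof (rule that[of "\<lambda>g. sinh (r * g) / r" "\<lambda>g. (cosh (r * g) - 1) / r\<^sup>2"])
      fix g
      show "(cosh (r * g) - 1) / r\<^sup>2 \<ge> 0" using cosh_real_ge_1[of "r * g"] by simp
      have "(sinh (r * g))\<^sup>2 = (cosh (r * g))\<^sup>2 - 1" using cosh_square_eq[of "r * g"] by simp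
      then show "(sinh (r * g) / r)\<^sup>2 = 2 * ((cosh (r * g) - 1) / r\<^sup>2) + q * ((cosh (r * g) - 1) / r\<^sup>2)\<^sup>2"
      proof -
        have "q * ((cosh (r * g) - 1) / r\<^sup>2)\<^sup>2 = (cosh (r * g) - 1)\<^sup>2 / r\<^sup>2"
          using r by (simp add: power_divide power2_eq_square)
        then show ?thesis
          using \<open>(sinh (r * g))\<^sup>2 = _\<close>
          by (simp add: power_divide add_divide_distrib[symmetric] power2_eq_square algebra_simps)
      qed
    qed (use r in \<open>auto intro!: derivative_eq_intros simp: field_simps power2_eq_square\<close>)
  next
    case 3
    define r where "r = sqrt (- q)"
    have "r > 0" "r\<^sup>2 = - q" using 3 by (auto simp: r_def)
    then have r: "r > 0" "q = - r\<^sup>2" by auto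
    show ?thesis
    proof (rule that[of "\<lambda>g. sin (r * g) / r" "\<lambda>g. (1 - cos (r * g)) / r\<^sup>2"])
      fix g
      show "(1 - cos (r * g)) / r\<^sup>2 \<ge> 0" by simp
      have "(sin (r * g))\<^sup>2 = 1 - (cos (r * g))\<^sup>2" by (rule sin_squared_eq)
      then show "(sin (r * g) / r)\<^sup>2 = 2 * ((1 - cos (r * g)) / r\<^sup>2) + q * ((1 - cos (r * g)) / r\<^sup>2)\<^sup>2"
      proof -
        have "q * ((1 - cos (r * g)) / r\<^sup>2)\<^sup>2 = - (1 - cos (r * g))\<^sup>2 / r\<^sup>2"
          using r by (simp add: power_divide power2_eq_square)
        then show ?thesis
          using \<open>(sin (r * g))\<^sup>2 = _\<close>
          by (simp add: power_divide add_divide_distrib[symmetric] diff_divide_distrib[symmetric] power2_eq_square algebra_simps)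
      qed
    qed (use r in \<open>auto intro!: derivative_eq_intros simp: field_simps power2_eq_square\<close>)
  qed
qed

text \<open>The rotation angle of the self-similar evolution is not the time \<open>t\<close> but \<open>g t\<close>, where \<open>g' = 1 / f\<^sup>2\<close>: a curve scaled
  by \<open>f\<close> has its curvature divided by \<open>f\<^sup>2\<close>.\<close>

lemma similarity_coefficients:
  fixes c q :: real
  obtains J :: "real set" and f S C :: "real \<Rightarrow> real" where
    "open_interval J" "0 \<in> J" "f 0 = 1" "S 0 = 0" "C 0 = 0"
    "\<And>t. t \<in> J \<Longrightarrow> f t > 0" "\<And>t. C t \<ge> 0" "\<And>t. (S t)\<^sup>2 = 2 * C t + q * (C t)\<^sup>2"
    "\<And>t. t \<in> J \<Longrightarrow> (f has_real_derivative c / f t) (at t)"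
    "\<And>t. t \<in> J \<Longrightarrow> (S has_real_derivative (1 + q * C t) / (f t)\<^sup>2) (at t)"
    "\<And>t. t \<in> J \<Longrightarrow> (C has_real_derivative S t / (f t)\<^sup>2) (at t)"
    "smooth_on J f" "smooth_on J (\<lambda>t. 1 / f t)" "smooth_on J S" "smooth_on J C"
    "c = 0 \<Longrightarrow> (\<forall>t. f t = 1)"
proof -
  obtain S0 C0 :: "real \<Rightarrow> real" where SC: "S0 0 = 0" "C0 0 = 0" "\<And>g. C0 g \<ge> 0"
      "\<And>g. (S0 g)\<^sup>2 = 2 * C0 g + q * (C0 g)\<^sup>2"
      "\<And>g. (S0 has_real_derivative 1 + q * C0 g) (at g)" "\<And>g. (C0 has_real_derivative S0 g) (at g)"
    using rotation_coefficients[of q] by blast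
  \<comment> \<open>The scaling has to supply the normal velocity \<open>f' / f = c / f^2\<close>,
    so \<open>f^2\<close> grows at rate \<open>2 c\<close>; \<open>J\<close> is where this leaves it
    positive.\<close>
  define J where "J = {t. 1 + 2 * c * t > 0}"
  define f where "f t = sqrt (1 + 2 * c * t)" for t
  define g where "g t = (if c = 0 then t else ln (1 + 2 * c * t) / (2 * c))" for t
  define S where "S t = S0 (g t)" for t
  define C where "C t = C0 (g t)" for t
  have "open J" unfolding J_def by (intro open_Collect_less continuous_intros)
  moreover have "is_interval J"
    unfolding is_interval_convex_1 J_def
  proof (rule convexI, clarify)
    fix s t u w :: real
    assume *: "0 < 1 + 2 * c * s" "0 < 1 + 2 * c * t" "0 \<le> u" "0 \<le> w" "u + w = 1"
    have "1 + 2 * c * (u *\<^sub>R s + w *\<^sub>R t) = u * (1 + 2 * c * s) + w * (1 + 2 * c * t)"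
      using *(5) by (simp add: algebra_simps)
    moreover have "\<dots> > 0"
    proof (cases "u = 0")
      case False
      then show ?thesis using * by (intro add_pos_nonneg) auto
    qed (use * in auto)
    ultimately show "0 < 1 + 2 * c * (u *\<^sub>R s + w *\<^sub>R t)" by simp
  qed
  moreover have "0 \<in> J" by (simp add: J_def)
  ultimately have J: "open_interval J" "open J" by (auto simp: open_interval_def)
  have f: "f t > 0" "(f t)\<^sup>2 = 1 + 2 * c * t" if "t \<in> J" for t
    using that by (auto simp: f_def J_def)
  have df: "(f has_real_derivative c / f t) (at t)" if "t \<in> J" for t
    using that unfolding f_def J_def
    by (auto intro!: derivative_eq_intros simp: field_simps)
  have dg: "(g has_real_derivative 1 / (f t)\<^sup>2) (at t)" if "t \<in> J" for t
  proof (cases "c = 0")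
    case True
    then show ?thesis using f(2)[OF that] by (simp add: g_def[abs_def])
  next
    case False
    have "((\<lambda>t. ln (1 + 2 * c * t) / (2 * c)) has_real_derivative 1 / (1 + 2 * c * t) * (2 * c) / (2 * c)) (at t)"
      using that by (auto simp: J_def intro!: derivative_eq_intros)
    with False show ?thesis using f(2)[OF that] by (simp add: g_def[abs_def])
  qed
  have dS: "(S has_real_derivative (1 + q * C t) / (f t)\<^sup>2) (at t)" if "t \<in> J" for t
    using DERIV_chain2[OF SC(5) dg[OF that]] by (simp add: S_def[abs_def] C_def)
  have dC: "(C has_real_derivative S t / (f t)\<^sup>2) (at t)" if "t \<in> J" for t
    using DERIV_chain2[OF SC(6) dg[OF that]] by (simp add: C_def[abs_def] S_def)
  \<comment> \<open>\<open>1 / f\<close> solves the polynomial equation \<open>h' = - c h^3\<close>,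
    so its smoothness follows by bootstrapping rather than from properties of the root;
    \<open>f\<close>, \<open>S\<close> and \<open>C\<close> then inherit it.\<close>
  define h where "h t = 1 / f t" for t
  have dh: "(h has_vector_derivative - c * (h t * (h t * h t))) (at t)" if "t \<in> J" for t
    unfolding has_real_derivative_iff_has_vector_derivative[symmetric] h_def
    using df[OF that] f(1)[OF that] by (auto intro!: derivative_eq_intros simp: field_simps power2_eq_square)
  note mult = higher_differentiable_on_bilinear[OF J(2) bounded_bilinear_mult]
  note lin = higher_differentiable_on_linear[OF J(2)]
  have sh: "smooth_on J h"
    by (rule smooth_on_bootstrap[OF J(2) dh])
      (intro lin[OF bounded_linear_mult_right] mult | assumption)+
  have sf: "smooth_on J f"
  proof (rule smooth_on_antiderivative[OF J(2)])
    show "(f has_vector_derivative c * h t) (at t)" if "t \<in> J" for t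
      using df[OF that] by (simp add: h_def has_real_derivative_iff_has_vector_derivative)
    show "smooth_on J (\<lambda>t. c * h t)"
      by (rule smooth_on_linear[OF J(2) bounded_linear_mult_right sh])
  qed
  have sSC: "smooth_on J (\<lambda>t. (S t, C t))"
  proof (rule smooth_on_bootstrap[OF J(2)])
    show "((\<lambda>t. (S t, C t)) has_vector_derivative ((1 + q * C t) * (h t * h t), S t * (h t * h t))) (at t)"
      if "t \<in> J" for t
      using dS[OF that] dC[OF that]
      by (intro has_vector_derivative_Pair)
        (auto simp: h_def power2_eq_square has_real_derivative_iff_has_vector_derivative)
    fix n assume *: "higher_differentiable_on J (\<lambda>t. (S t, C t)) n"
    have "higher_differentiable_on J S n" "higher_differentiable_on J C n" "higher_differentiable_on J h n"
      using lin[OF bounded_linear_fst *] lin[OF bounded_linear_snd *] sh by (auto simp: smooth_on_def)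
    then show "higher_differentiable_on J (\<lambda>t. ((1 + q * C t) * (h t * h t), S t * (h t * h t))) n"
      by (intro higher_differentiable_on_Pair[OF J(2)] mult higher_differentiable_on_add[OF J(2)]
          higher_differentiable_on_const[OF J(2)] lin[OF bounded_linear_mult_right])
  qed
  show ?thesis
  proof (rule that[of J f S C])
    show "smooth_on J (\<lambda>t. 1 / f t)" using sh by (simp add: h_def[abs_def])
    show "smooth_on J S" "smooth_on J C"
      using smooth_on_linear[OF J(2) bounded_linear_fst sSC] smooth_on_linear[OF J(2) bounded_linear_snd sSC] by simp_all
    show "S 0 = 0" "C 0 = 0" "C t \<ge> 0" "(S t)\<^sup>2 = 2 * C t + q * (C t)\<^sup>2" for t
      using SC by (auto simp: S_def C_def g_def)
  qed (use J \<open>0 \<in> J\<close> f df dS dC sf in \<open>auto simp: f_def\<close>)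
qed

text \<open>\<open>\<langle>lorentz_cross u w, z\<rangle>\<close> is the determinant of \<open>u, w, z\<close>.\<close>

definition lorentz_cross :: "real^3 \<Rightarrow> real^3 \<Rightarrow> real^3" where
  "lorentz_cross u w = vector [u$3 * w$2 - u$2 * w$3, u$3 * w$1 - u$1 * w$3, u$1 * w$2 - u$2 * w$1]"

lemma bounded_bilinear_lorentz_cross: "bounded_bilinear lorentz_cross"
  by (intro bilinear_conv_bounded_bilinear[THEN iffD1])
    (auto simp: bilinear_def linear_iff lorentz_cross_def vec_eq_iff forall_3 algebra_simps)

lemma lorentz_cross_skew: "mink (lorentz_cross u v) w = - mink u (lorentz_cross w v)"
  by (simp add: lorentz_cross_def mink_def algebra_simps)

text \<open>Cayley-Hamilton for the skew map \<open>w \<mapsto> w \<times> v\<close>; this supplies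
  \<open>A^3 = q A\<close> with \<open>q = \<langle>v, v\<rangle>\<close>.\<close>

lemma lorentz_cross_cube:
  "lorentz_cross (lorentz_cross (lorentz_cross w v) v) v = mink v v *\<^sub>R lorentz_cross w v"
  by (simp add: lorentz_cross_def mink_def vec_eq_iff forall_3 algebra_simps)

lemma lorentz_cross_degenerate [simp]:
  "lorentz_cross u u = 0" "mink (lorentz_cross u w) w = 0" "mink (lorentz_cross u w) u = 0"
  by (simp_all add: lorentz_cross_def mink_def vec_eq_iff forall_3 algebra_simps)

text \<open>The metric has determinant -1, so the squared determinant of three vectors is minus
  their Gram determinant, and that of a null frame is -1.\<close>

lemma null_frame_det:
  assumes "null_frame X T Y"
  shows "(mink (lorentz_cross X T) Y)\<^sup>2 = 1"
proof -
  have "(mink (lorentz_cross X T) Y)\<^sup>2 = - (mink X X * (mink T T * mink Y Y - (mink T Y)\<^sup>2)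
      - mink X T * (mink X T * mink Y Y - mink T Y * mink X Y)
      + mink X Y * (mink X T * mink T Y - mink T T * mink X Y))"
    by (simp add: lorentz_cross_def mink_def power2_eq_square) algebra
  then show ?thesis by (simp add: null_frame_mink[OF assms])
qed

locale cone_similarity =
  fixes A :: "real^3^3" and c q :: real and J :: "real set" and f S C :: "real \<Rightarrow> real"
  assumes skew: "\<And>u w. mink (A *v u) w = - mink u (A *v w)"
    and cube: "\<And>u. A *v (A *v (A *v u)) = q *\<^sub>R (A *v u)"
    and J: "open_interval J" "0 \<in> J"
    and initial: "f 0 = 1" "S 0 = 0" "C 0 = 0"
    and f_pos: "\<And>t. t \<in> J \<Longrightarrow> f t > 0"
    and SC: "\<And>t. C t \<ge> 0" "\<And>t. (S t)\<^sup>2 = 2 * C t + q * (C t)\<^sup>2"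
    and f_deriv: "\<And>t. t \<in> J \<Longrightarrow> (f has_real_derivative c / f t) (at t)"
    and S_deriv: "\<And>t. t \<in> J \<Longrightarrow> (S has_real_derivative (1 + q * C t) / (f t)\<^sup>2) (at t)"
    and C_deriv: "\<And>t. t \<in> J \<Longrightarrow> (C has_real_derivative S t / (f t)\<^sup>2) (at t)"
    and smooth: "smooth_on J f" "smooth_on J (\<lambda>t. 1 / f t)" "smooth_on J S" "smooth_on J C"
begin

text \<open>This is \<open>exp (g t A)\<close>, a polynomial in \<open>A\<close> since \<open>A\<^sup>3 = q A\<close>.\<close>

definition M :: "real \<Rightarrow> real^3^3" where
  "M t = mat 1 + S t *\<^sub>R A + C t *\<^sub>R (A ** A)"

lemma M_apply: "M t *v u = u + S t *\<^sub>R (A *v u) + C t *\<^sub>R (A *v (A *v u))"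
  by (simp add: M_def matrix_vector_mult_add_rdistrib scaleR_matrix_vector_assoc[symmetric]
      matrix_vector_mul_assoc)

lemma M_isometry: "mink (M t *v u) (M t *v w) = mink u w"
proof -
  \<comment> \<open>Skewness moves every \<open>A\<close> to the second argument: the terms odd in
    \<open>A\<close> cancel, and the cube relation reduces the fourth power to the second.\<close>
  have "mink (M t *v u) (M t *v w) = mink u w + (2 * C t + q * (C t)\<^sup>2 - (S t)\<^sup>2) * mink u (A *v (A *v w))"
    by (simp add: M_apply mink_simps skew cube power2_eq_square algebra_simps)
  then show ?thesis by (simp add: SC)
qed

lemma cone_isometry_M: "cone_isometry (M t)"
proof (rule cone_isometryI[OF M_isometry])
  define e :: "real^3" where "e = vector [1, 0, 0]"
  have first: "u$1 = - mink u e" for u by (simp add: e_def mink_def)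
  show "mink e e < 0" "e$1 > 0" by (simp_all add: e_def mink_def)
  have Ae: "mink (A *v e) e = 0"
    using skew[of e e] by (simp add: mink_commute[of e "A *v e"])
  \<comment> \<open>\<open>A *v e\<close> is orthogonal to the time axis, so its square is not
    negative; with \<open>C t \<ge> 0\<close> the first coordinate of \<open>e\<close> can only
    grow.\<close>
  have "mink (A *v e) (A *v e) \<ge> 0"
    using Ae by (simp add: e_def mink_def)
  then have "(M t *v e)$1 \<ge> 1"
    using SC(1)[of t] unfolding first
    by (simp add: M_apply mink_simps Ae skew[of "A *v e" e]) (simp add: e_def mink_def)
  then show "(M t *v e)$1 > 0" by simp
qed

lemma M_0: "M 0 = mat 1"
  by (simp add: M_def initial)

lemma smooth_M: "smooth_on J M"
proof -
  have J: "open J" using J by (simp add: open_interval_def)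
  have "smooth_on J (\<lambda>t. mat 1 + S t *\<^sub>R A + C t *\<^sub>R (A ** A))"
    by (intro smooth_on_add smooth_on_scaleR smooth_on_const J smooth)
  then show ?thesis by (simp add: M_def[abs_def])
qed

lemma M_deriv:
  assumes "t \<in> J"
  shows "((\<lambda>t. M t *v u) has_vector_derivative (1 / (f t)\<^sup>2) *\<^sub>R (M t *v (A *v u))) (at t)"
  unfolding M_apply using S_deriv[OF assms] C_deriv[OF assms]
  by (auto intro!: derivative_eq_intros simp: cube algebra_simps add_divide_distrib)

text \<open>Stated for a general scaling \<open>\<phi>\<close> and speed \<open>a\<close> because it
  is used twice: with \<open>f\<close> for \<open>X\<close>, and with \<open>1 / f\<close> for
  \<open>- Y\<close> and its non-unit speed. Scaling adds \<open>\<phi>' / \<phi>\<close> to the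
  normal velocity, while the rotation contributes at the rate \<open>1 / f^2\<close> in either
  case.\<close>

lemma similarity_evolution:
  assumes I: "open_interval I" and Z: "smooth_on I Z"
    and der: "\<And>s. s \<in> I \<Longrightarrow> (Z has_vector_derivative a s *\<^sub>R U s) (at s)"
      "\<And>s. s \<in> I \<Longrightarrow> (U has_vector_derivative a s *\<^sub>R (\<kappa> s *\<^sub>R Z s - W s)) (at s)"
    and fr: "\<And>s. s \<in> I \<Longrightarrow> null_frame (Z s) (U s) (W s)" "\<And>s. s \<in> I \<Longrightarrow> a s > 0"
    and \<phi>: "smooth_on J \<phi>" "\<And>t. t \<in> J \<Longrightarrow> \<phi> t > 0" "\<And>t. t \<in> J \<Longrightarrow> (\<phi> has_real_derivative \<phi>' t) (at t)"
  defines "F \<equiv> \<lambda>t s. \<phi> t *\<^sub>R (M t *v Z s)"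
  shows "curve_family I J F"
    and "\<And>s t. s \<in> I \<Longrightarrow> t \<in> J \<Longrightarrow> curvature (F t) s = \<kappa> s / (\<phi> t)\<^sup>2"
    and "\<And>s t. s \<in> I \<Longrightarrow> t \<in> J \<Longrightarrow> mink (vector_derivative (\<lambda>t. F t s) (at t)) (associated (F t) s) =
      \<phi>' t / \<phi> t + mink (A *v Z s) (W s) / (f t)\<^sup>2"
proof -
  have op: "open I" "open J" using I J by (auto simp: open_interval_def)
  have matder: "((\<lambda>s. B *v z s) has_vector_derivative B *v w) (at s)"
    if "(z has_vector_derivative w) (at s)" for B :: "real^3^3" and z w and s :: real
    by (rule bounded_linear.has_vector_derivative[OF matrix_vector_mul_bounded_linear that])
  have F1: "(F t has_vector_derivative (\<phi> t * a s) *\<^sub>R (M t *v U s)) (at s)"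
    and F2: "((\<lambda>s. M t *v U s) has_vector_derivative
      (\<phi> t * a s) *\<^sub>R ((\<kappa> s / (\<phi> t)\<^sup>2) *\<^sub>R F t s - (1 / \<phi> t) *\<^sub>R (M t *v W s))) (at s)"
    and F3: "null_frame (F t s) (M t *v U s) ((1 / \<phi> t) *\<^sub>R (M t *v W s))"
    if "s \<in> I" "t \<in> J" for s t
  proof -
    have "((\<lambda>s. \<phi> t *\<^sub>R (M t *v Z s)) has_vector_derivative \<phi> t *\<^sub>R (M t *v (a s *\<^sub>R U s))) (at s)"
      by (intro bounded_linear.has_vector_derivative[OF bounded_linear_scaleR_right] matder der that)
    then show "(F t has_vector_derivative (\<phi> t * a s) *\<^sub>R (M t *v U s)) (at s)"
      by (simp add: F_def matrix_vector_mult_scaleR)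
    have "((\<lambda>s. M t *v U s) has_vector_derivative M t *v (a s *\<^sub>R (\<kappa> s *\<^sub>R Z s - W s))) (at s)"
      by (intro matder der that)
    then show "((\<lambda>s. M t *v U s) has_vector_derivative
      (\<phi> t * a s) *\<^sub>R ((\<kappa> s / (\<phi> t)\<^sup>2) *\<^sub>R F t s - (1 / \<phi> t) *\<^sub>R (M t *v W s))) (at s)"
      using \<phi>(2)[OF that(2)]
      by (simp add: F_def matrix_vector_mult_scaleR matrix_vector_mult_diff_distrib scaleR_diff_right power2_eq_square)
    show "null_frame (F t s) (M t *v U s) ((1 / \<phi> t) *\<^sub>R (M t *v W s))"
      unfolding F_def
      by (intro null_frame_scaleR cone_isometry_null_frame cone_isometry_M fr \<phi> that)
  qed
  have frame: "associated (F t) s = (1 / \<phi> t) *\<^sub>R (M t *v W s)" "curvature (F t) s = \<kappa> s / (\<phi> t)\<^sup>2"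
    "spacelike (velocity (F t) s)" if "s \<in> I" "t \<in> J" for s t
  proof -
    have pos: "\<phi> t * a s > 0" if "s \<in> I" for s using \<phi>(2)[OF \<open>t \<in> J\<close>] fr(2)[OF that] by simp
    show "associated (F t) s = (1 / \<phi> t) *\<^sub>R (M t *v W s)" "curvature (F t) s = \<kappa> s / (\<phi> t)\<^sup>2"
      "spacelike (velocity (F t) s)"
      by (rule frame_of_curve[OF op(1) F1[OF _ that(2)] F2[OF _ that(2)] F3[OF _ that(2)] pos that(1)]; assumption)+
  qed
  then show "curvature (F t) s = \<kappa> s / (\<phi> t)\<^sup>2" if "s \<in> I" "t \<in> J" for s t using that by blast
  have "smooth_on (I \<times> J) (\<lambda>(s, t). F t s)"
  proof -
    have IJ: "open (I \<times> J)" by (rule open_Times[OF op])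
    have s: "smooth_on (I \<times> J) (\<lambda>p. u (fst p))" if "smooth_on I u" for u :: "real \<Rightarrow> real^3"
      by (rule smooth_on_compose_linear[OF op(1) IJ bounded_linear_fst _ that]) auto
    have t: "smooth_on (I \<times> J) (\<lambda>p. u (snd p))" if "smooth_on J u" for u :: "real \<Rightarrow> real"
      by (rule smooth_on_compose_linear[OF op(2) IJ bounded_linear_snd _ that]) auto
    note mat = smooth_on_linear[OF IJ matrix_vector_mul_bounded_linear]
    have "smooth_on (I \<times> J) (\<lambda>p. \<phi> (snd p) *\<^sub>R (Z (fst p) + S (snd p) *\<^sub>R (A *v Z (fst p))
        + C (snd p) *\<^sub>R (A *v (A *v Z (fst p)))))"
      by (intro smooth_on_scaleR smooth_on_add IJ t \<phi> smooth mat s Z)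
    then show ?thesis by (simp add: F_def M_apply case_prod_unfold)
  qed
  moreover have "spacelike_curve I (F t)" if "t \<in> J" for t
  proof -
    have "smooth_on I (F t)"
      unfolding F_def
      by (intro smooth_on_linear[OF op(1) bounded_linear_scaleR_right]
          smooth_on_linear[OF op(1) matrix_vector_mul_bounded_linear] Z)
    then show ?thesis
      using I F3 frame(3) that by (auto simp: spacelike_curve_def intro: null_frame_future_cone)
  qed
  ultimately show "curve_family I J F" using J by (simp add: curve_family_def)
  show "mink (vector_derivative (\<lambda>t. F t s) (at t)) (associated (F t) s) =
      \<phi>' t / \<phi> t + mink (A *v Z s) (W s) / (f t)\<^sup>2" if "s \<in> I" "t \<in> J" for s t
  proof -
    have "((\<lambda>t. F t s) has_vector_derivative \<phi> t *\<^sub>R ((1 / (f t)\<^sup>2) *\<^sub>R (M t *v (A *v Z s)))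
        + \<phi>' t *\<^sub>R (M t *v Z s)) (at t)"
      unfolding F_def by (intro has_vector_derivative_scaleR \<phi> M_deriv that)
    then show ?thesis
      using \<phi>(2)[OF that(2)] null_frame_mink(5)[OF fr(1)[OF that(1)]]
      by (simp add: vector_derivative_at frame[OF that] mink_simps M_isometry field_simps)
  qed
qed

lemma similarity_data_M:
  assumes "smooth_on J \<phi>" "\<And>t. t \<in> J \<Longrightarrow> \<phi> t > 0" "\<phi> 0 = 1"
  shows "similarity_data J \<phi> M"
  using assms cone_isometry_M smooth_M M_0 by (simp add: similarity_data_def)

end

lemma solves_self_similar:
  assumes s: "solves v c I X"
  shows "self_similar_CF I X" "c = 0 \<Longrightarrow> soliton_CF I X"
    and "\<And>K. open_interval K \<Longrightarrow> K \<subseteq> I \<Longrightarrow> \<forall>s\<in>K. curvature X s \<noteq> 0 \<Longrightarrow>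
      self_similar_ICF K (\<lambda>s. - associated X s)"
proof -
  define T Y where "T = tangent X" and "Y = associated X"
  define k where "k = curvature X"
  note fr = solves_frame(2)[OF s, folded T_def Y_def]
  have I: "open_interval I" "open I" "connected I" and sm: "smooth_on I X"
    using s by (auto simp: solves_def arc_length_curve_def spacelike_curve_def open_interval_def
        is_interval_connected_1)
  have k: "k s = c + mink (T s) v" if "s \<in> I" for s
    using s that by (simp add: solves_def k_def T_def)
  have ode: "(X has_vector_derivative T s) (at s)"
      "(T has_vector_derivative k s *\<^sub>R X s - Y s) (at s)"
      "(Y has_vector_derivative - k s *\<^sub>R T s) (at s)" if "s \<in> I" for s
    using solves_frame(1)[OF s, folded T_def Y_def] that k[OF that] by (simp_all add: frame_ode_iff)
  \<comment> \<open>Signed volume of the frame: constant because every term of its derivative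
    repeats a vector, and of square 1. Its value \<open>\<delta>\<close> is built into
    \<open>A\<close> so that the rotation moves \<open>X\<close> with normal velocity \<langle>T,
    v\<rangle> rather than its negative.\<close>
  define D where "D s = mink (lorentz_cross (X s) (T s)) (Y s)" for s
  have "(D has_real_derivative 0) (at s)" if "s \<in> I" for s
  proof -
    note lc = bounded_bilinear.has_vector_derivative[OF bounded_bilinear_lorentz_cross ode(1,2)[OF that]]
    have "(D has_real_derivative mink (lorentz_cross (X s) (T s)) (- k s *\<^sub>R T s) +
        mink (lorentz_cross (X s) (k s *\<^sub>R X s - Y s) + lorentz_cross (T s) (T s)) (Y s)) (at s)"
      unfolding D_def by (rule has_real_derivative_mink[OF lc ode(3)[OF that]])
    then show ?thesis
      by (simp add: mink_simps bounded_bilinear.diff_right[OF bounded_bilinear_lorentz_cross]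
          bounded_bilinear.scaleR_right[OF bounded_bilinear_lorentz_cross])
  qed
  then obtain \<delta> where \<delta>: "\<And>s. s \<in> I \<Longrightarrow> D s = \<delta>"
    using has_field_derivative_zero_constant[of I D] I
    by (metis has_field_derivative_at_within is_interval_connected_1 is_interval_convex)
  have \<delta>2: "\<delta> * \<delta> = 1"
    using I(1) null_frame_det[OF fr] \<delta> by (fastforce simp: D_def open_interval_def power2_eq_square)
  define L where "L w = \<delta> *\<^sub>R lorentz_cross w v" for w
  define A where "A = matrix L"
  define q where "q = mink v v"
  have "linear L"
    unfolding L_def using bounded_bilinear.bounded_linear_left[OF bounded_bilinear_lorentz_cross, of v]
    by (intro linear_compose_scale_right bounded_linear.linear)
  then have A: "A *v w = \<delta> *\<^sub>R lorentz_cross w v" for w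
    by (simp add: A_def matrix_works L_def)
  have AXY: "mink (A *v X s) (Y s) = mink (T s) v" if "s \<in> I" for s
  proof -
    \<comment> \<open>The components of \<open>v\<close> along \<open>X\<close> and \<open>Y\<close>
      drop out of the determinant; the one along \<open>T\<close> is multiplied by
      \<open>D s\<close>.\<close>
    have "mink (lorentz_cross (X s) v) (Y s) = mink v (T s) * D s"
      by (subst null_frame_expand[OF fr[OF that], of v])
        (simp add: D_def mink_simps bounded_bilinear.add_right[OF bounded_bilinear_lorentz_cross]
          bounded_bilinear.scaleR_right[OF bounded_bilinear_lorentz_cross])
    then show ?thesis using \<delta>[OF that] \<delta>2 by (simp add: A mink_simps mink_commute[of v])
  qed
  have skew: "mink (A *v u) w = - mink u (A *v w)" for u w
    using lorentz_cross_skew[of u v w] by (simp add: A mink_simps)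
  have cube: "A *v (A *v (A *v u)) = q *\<^sub>R (A *v u)" for u
    using \<delta>2 by (simp add: A lorentz_cross_cube q_def bounded_bilinear.scaleR_left[OF bounded_bilinear_lorentz_cross])
  obtain J f S C where *: "open_interval J" "0 \<in> J" "f 0 = 1" "S 0 = 0" "C 0 = 0"
    "\<And>t. t \<in> J \<Longrightarrow> f t > 0" "\<And>t. C t \<ge> 0" "\<And>t. (S t)\<^sup>2 = 2 * C t + q * (C t)\<^sup>2"
    "\<And>t. t \<in> J \<Longrightarrow> (f has_real_derivative c / f t) (at t)"
    "\<And>t. t \<in> J \<Longrightarrow> (S has_real_derivative (1 + q * C t) / (f t)\<^sup>2) (at t)"
    "\<And>t. t \<in> J \<Longrightarrow> (C has_real_derivative S t / (f t)\<^sup>2) (at t)"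
    "smooth_on J f" "smooth_on J (\<lambda>t. 1 / f t)" "smooth_on J S" "smooth_on J C"
    and f1: "c = 0 \<Longrightarrow> (\<forall>t. f t = 1)"
    using similarity_coefficients[of q c] by blast
  interpret cone_similarity A c q J f S C
    by unfold_locales (fact skew cube *)+
  have d: "(X has_vector_derivative 1 *\<^sub>R T s) (at s)"
      "(T has_vector_derivative 1 *\<^sub>R (k s *\<^sub>R X s - Y s)) (at s)" if "s \<in> I" for s
    using ode[OF that] by simp_all
  have ev1: "curve_family I J (\<lambda>t s. f t *\<^sub>R (M t *v X s))"
    by (rule similarity_evolution(1)[OF I(1) sm d fr zero_less_one smooth(1) f_pos f_deriv]; assumption)
  have ev2: "curvature (\<lambda>s. f t *\<^sub>R (M t *v X s)) s = k s / (f t)\<^sup>2"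
    and ev3: "mink (vector_derivative (\<lambda>t. f t *\<^sub>R (M t *v X s)) (at t)) (associated (\<lambda>s. f t *\<^sub>R (M t *v X s)) s) =
      c / f t / f t + mink (A *v X s) (Y s) / (f t)\<^sup>2" if "s \<in> I" "t \<in> J" for s t
    by (rule similarity_evolution(2,3)[OF I(1) sm d fr zero_less_one smooth(1) f_pos f_deriv that]; assumption)+
  have CF: "CF_solution I J X (\<lambda>t s. f t *\<^sub>R (M t *v X s))"
    unfolding CF_solution_def
  proof (intro conjI ballI)
    show "curve_family I J (\<lambda>t s. f t *\<^sub>R (M t *v X s))" by (rule ev1)
    show "f 0 *\<^sub>R (M 0 *v X s) = X s" for s by (simp add: initial M_0)
    fix t s assume st: "t \<in> J" "s \<in> I"
    \<comment> \<open>The balance is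
      \<open>c / f^2 + \<langle>T, v\<rangle> / f^2 = k / f^2\<close>, the curvature of the scaled
      curve.\<close>
    show "mink (vector_derivative (\<lambda>t. f t *\<^sub>R (M t *v X s)) (at t)) (associated (\<lambda>s. f t *\<^sub>R (M t *v X s)) s) =
        curvature (\<lambda>s. f t *\<^sub>R (M t *v X s)) s"
      unfolding ev2[OF st(2,1)] ev3[OF st(2,1)]
      using f_pos[OF st(1)] by (simp add: AXY[OF st(2)] k[OF st(2)] power2_eq_square add_divide_distrib)
  qed
  have sim: "similarity_data J f M"
    by (rule similarity_data_M[OF smooth(1) f_pos initial(1)])
  show "self_similar_CF I X"
    using CF sim unfolding self_similar_CF_def by blast
  show "soliton_CF I X" if "c = 0"
    using CF sim f1[OF that] unfolding soliton_CF_def by blast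
  fix K assume K: "open_interval K" "K \<subseteq> I" "\<forall>s\<in>K. curvature X s \<noteq> 0"
  have Kop: "open K" "connected K" using K by (auto simp: open_interval_def is_interval_connected_1)
  have k0: "k s \<noteq> 0" if "s \<in> K" for s using K(3) that by (simp add: k_def)
  have kc: "continuous_on K k"
  proof -
    have "continuous_on K T"
      using ode(2) K(2) has_vector_derivative_continuous
      by (intro continuous_at_imp_continuous_on) blast
    then have "continuous_on K (\<lambda>s. c + mink (T s) v)"
      unfolding mink_def by (intro continuous_intros)
    then show ?thesis using k K(2) by (subst continuous_on_cong[OF refl, of _ _ "\<lambda>s. c + mink (T s) v"]) auto
  qed
  \<comment> \<open>\<open>- Y\<close> has velocity \<open>k T\<close>, so its speed is
    \<open>\<bar>k\<bar>\<close> and its unit tangent \<open>T\<close> or \<open>- T\<close>; on an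
    interval without zeros the sign \<open>\<sigma>\<close> of \<open>k\<close> is constant.\<close>
  obtain \<sigma> :: real where \<sigma>: "\<sigma> * \<sigma> = 1" "\<And>s. s \<in> K \<Longrightarrow> \<sigma> * k s > 0"
  proof (cases "\<exists>s\<in>K. k s < 0")
    case True
    then obtain s0 where s0: "s0 \<in> K" "k s0 < 0" by blast
    have "k s < 0" if "s \<in> K" for s
    proof (rule ccontr)
      assume "\<not> k s < 0"
      then have "0 \<in> k ` K"
        using s0 that
        by (intro connectedD_interval[OF connected_continuous_image[OF kc Kop(2)], of "k s0" "k s" 0, OF imageI imageI]) auto
      then show False using k0 by auto
    qed
    then show ?thesis by (intro that[of "- 1"]) auto
  next
    case False
    then show ?thesis using k0 by (intro that[of 1]) (auto simp: not_less order_less_le)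
  qed
  define Z where "Z s = - Y s" for s
  define U where "U s = \<sigma> *\<^sub>R T s" for s
  have Zder: "(Z has_vector_derivative (\<sigma> * k s) *\<^sub>R U s) (at s)" if "s \<in> K" for s
  proof -
    have "(Z has_vector_derivative - (- k s *\<^sub>R T s)) (at s)"
      unfolding Z_def using ode(3) that K(2) by (intro has_vector_derivative_minus) blast
    moreover have "(\<sigma> * k s) *\<^sub>R U s = (\<sigma> * \<sigma> * k s) *\<^sub>R T s"
      by (simp add: U_def ac_simps)
    ultimately show ?thesis using \<sigma>(1) by simp
  qed
  have Uder: "(U has_vector_derivative (\<sigma> * k s) *\<^sub>R ((1 / k s) *\<^sub>R Z s - - X s)) (at s)" if "s \<in> K" for s
  proof -
    have "(U has_vector_derivative \<sigma> *\<^sub>R (k s *\<^sub>R X s - Y s)) (at s)"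
      unfolding U_def using ode(2) that K(2)
      by (intro bounded_linear.has_vector_derivative[OF bounded_linear_scaleR_right]) blast
    moreover have "(\<sigma> * k s) *\<^sub>R ((1 / k s) *\<^sub>R Z s - - X s) = \<sigma> *\<^sub>R (k s *\<^sub>R X s - Y s)"
      using k0[OF that] by (simp add: Z_def scaleR_add_right scaleR_diff_right)
    ultimately show ?thesis by simp
  qed
  have Zfr: "null_frame (Z s) (U s) (- X s)" if "s \<in> K" for s
  proof -
    have "\<sigma> = 1 \<or> \<sigma> = - 1" using \<sigma>(1) by (metis power2_eq_1_iff power2_eq_square)
    moreover have "null_frame (- Y s) (T s) (- X s)"
      using fr K(2) that by (blast intro: null_frame_flip)
    ultimately show ?thesis using null_frame_uminus by (auto simp: Z_def U_def)
  qed
  have Zsm: "smooth_on K Z"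
  proof -
    have "smooth_on I T"
      by (rule smooth_on_cong[OF I(2) _ smooth_on_vector_derivative(2)[OF I(2) sm]])
        (rule vector_derivative_at[OF ode(1)])
    have ks: "smooth_on I (\<lambda>s. c + mink (T s) v)"
      by (intro smooth_on_add smooth_on_const I(2) smooth_on_linear[OF I(2) bounded_bilinear.bounded_linear_left[OF bounded_bilinear_mink] \<open>smooth_on I T\<close>])
    have "smooth_on I (\<lambda>s. (c + mink (T s) v) *\<^sub>R T s)"
      by (intro smooth_on_scaleR I(2) ks \<open>smooth_on I T\<close>)
    then have w: "smooth_on K (\<lambda>s. (c + mink (T s) v) *\<^sub>R T s)"
      using K(2) by (rule smooth_on_subset)
    have "(Z has_vector_derivative (c + mink (T s) v) *\<^sub>R T s) (at s)" if "s \<in> K" for s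
    proof -
      have "(\<sigma> * k s) *\<^sub>R U s = (\<sigma> * \<sigma> * k s) *\<^sub>R T s"
        by (simp add: U_def ac_simps)
      moreover have "k s = c + mink (T s) v" using k K(2) that by blast
      ultimately show ?thesis using Zder[OF that] \<sigma>(1) by simp
    qed
    from smooth_on_antiderivative[OF Kop(1) this w] show ?thesis .
  qed
  have h_pos: "1 / f t > 0" if "t \<in> J" for t using f_pos[OF that] by simp
  have h_deriv: "((\<lambda>t. 1 / f t) has_real_derivative - c / (f t)^3) (at t)" if "t \<in> J" for t
    using f_deriv[OF that] f_pos[OF that]
    by (auto intro!: derivative_eq_intros simp: field_simps power2_eq_square power3_eq_cube)
  have evI1: "curve_family K J (\<lambda>t s. (1 / f t) *\<^sub>R (M t *v Z s))"
    by (rule similarity_evolution(1)[OF K(1) Zsm Zder Uder Zfr \<sigma>(2) smooth(2) h_pos h_deriv]; assumption)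
  have evI2: "curvature (\<lambda>s. (1 / f t) *\<^sub>R (M t *v Z s)) s = 1 / k s / (1 / f t)\<^sup>2"
    and evI3: "mink (vector_derivative (\<lambda>t. (1 / f t) *\<^sub>R (M t *v Z s)) (at t)) (associated (\<lambda>s. (1 / f t) *\<^sub>R (M t *v Z s)) s) =
      - c / (f t)^3 / (1 / f t) + mink (A *v Z s) (- X s) / (f t)\<^sup>2" if "s \<in> K" "t \<in> J" for s t
    by (rule similarity_evolution(2,3)[OF K(1) Zsm Zder Uder Zfr \<sigma>(2) smooth(2) h_pos h_deriv that]; assumption)+
  have "ICF_solution K J Z (\<lambda>t s. (1 / f t) *\<^sub>R (M t *v Z s))"
    unfolding ICF_solution_def
  proof (intro conjI ballI)
    show "curve_family K J (\<lambda>t s. (1 / f t) *\<^sub>R (M t *v Z s))" by (rule evI1)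
    show "(1 / f 0) *\<^sub>R (M 0 *v Z s) = Z s" for s by (simp add: initial M_0)
    fix t s assume st: "t \<in> J" "s \<in> K"
    then have "s \<in> I" using K(2) by blast
    have AZ: "mink (A *v Z s) (- X s) = - mink (T s) v"
      using AXY[OF \<open>s \<in> I\<close>] skew[of "Z s" "X s"]
      by (simp add: Z_def mink_minus_left mink_minus_right mink_commute[of "Y s"])
    show "curvature (\<lambda>s. (1 / f t) *\<^sub>R (M t *v Z s)) s \<noteq> 0"
      unfolding evI2[OF st(2,1)] using k0[OF st(2)] f_pos[OF st(1)] by simp
    \<comment> \<open>With the scaling \<open>1 / f\<close> the curvature is \<open>f^2 / k\<close>,
      and both contributions to the normal velocity change sign:
      \<open>- c / f^2 - \<langle>T, v\<rangle> / f^2 = - k / f^2\<close>.\<close>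
    show "mink (vector_derivative (\<lambda>t. (1 / f t) *\<^sub>R (M t *v Z s)) (at t)) (associated (\<lambda>s. (1 / f t) *\<^sub>R (M t *v Z s)) s) =
        - 1 / curvature (\<lambda>s. (1 / f t) *\<^sub>R (M t *v Z s)) s"
      unfolding evI2[OF st(2,1)] evI3[OF st(2,1)] AZ
      using f_pos[OF st(1)] k0[OF st(2)] k[OF \<open>s \<in> I\<close>]
      by (simp add: power2_eq_square power3_eq_cube field_simps)
  qed
  moreover have "similarity_data J (\<lambda>t. 1 / f t) M"
    by (rule similarity_data_M[OF smooth(2) h_pos]) (simp_all add: initial)
  ultimately have "self_similar_ICF K Z"
    unfolding self_similar_ICF_def by blast
  then show "self_similar_ICF K (\<lambda>s. - associated X s)"
    by (simp add: Z_def[abs_def] Y_def)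
qed

subsection \<open>Zeros of the curvature\<close>

text \<open>A barrier argument: \<open>f\<close> could leave the region above \<open>R\<close> only
  at a first point where it equals \<open>R\<close>, and there it is increasing. Positivity of
  \<open>f'\<close> is asked for only when the whole history lies in the region, which suits an
  estimate that takes effect with a delay.\<close>

lemma trapped_above:
  fixes f :: "real \<Rightarrow> real"
  assumes der: "\<And>u. a \<le> u \<Longrightarrow> (f has_real_derivative f' u) (at u)" and "R \<le> f a"
    and trap: "\<And>u. a \<le> u \<Longrightarrow> \<forall>w\<in>{a..u}. R \<le> f w \<Longrightarrow> f u = R \<Longrightarrow> 0 < f' u"
    and "a \<le> b"
  shows "R \<le> f b"
proof (rule ccontr)
  assume "\<not> R \<le> f b"
  define B where "B = {w \<in> {a..b}. f w < R}"
  have "b \<in> B" using \<open>\<not> R \<le> f b\<close> \<open>a \<le> b\<close> by (auto simp: B_def)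
  define u where "u = Inf B"
  have bdd: "bdd_below B" by (auto simp: B_def)
  have u: "a \<le> u" "u \<le> b"
    using \<open>b \<in> B\<close> bdd by (auto simp: u_def B_def intro: cInf_greatest cInf_lower)
  have before: "R \<le> f w" if "a \<le> w" "w < u" for w
  proof -
    have "w \<notin> B" using that(2) cInf_lower[OF _ bdd] by (force simp: u_def)
    then show ?thesis using that u(2) by (auto simp: B_def)
  qed
  have after: "\<exists>w\<in>B. w < u + d" if "d > 0" for d
    using \<open>b \<in> B\<close> that cInf_lessD[of B "u + d"] by (auto simp: u_def)
  have lower: "u \<le> w" if "w \<in> B" for w
    using that bdd by (simp add: u_def cInf_lower)
  have cont: "isCont f u" using der[OF u(1)] by (rule DERIV_isCont)
  show False
  proof (cases "f u" R rule: linorder_cases)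
    case less
    then have "a \<noteq> u" using assms(2) by auto
    have "eventually (\<lambda>w. f w < R) (at u)"
      using cont less unfolding isCont_def by (rule order_tendstoD(2))
    then obtain d where d: "d > 0" "\<And>w. w \<noteq> u \<Longrightarrow> dist w u < d \<Longrightarrow> f w < R"
      unfolding eventually_at by auto
    define w where "w = max a (u - d / 2)"
    have "a \<le> w" "w < u" "dist w u < d"
      using d(1) u(1) \<open>a \<noteq> u\<close> by (auto simp: w_def dist_real_def)
    with before d(2)[of w] show False by force
  next
    case equal
    then have "\<forall>w\<in>{a..u}. R \<le> f w" using before by (metis atLeastAtMost_iff order_le_less)
    then have "0 < f' u" using trap u(1) equal by blast
    then obtain d where d: "d > 0" "\<And>h. 0 < h \<Longrightarrow> h < d \<Longrightarrow> f u < f (u + h)"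
      using DERIV_pos_inc_right[OF der[OF u(1)]] by blast
    obtain w where w: "w \<in> B" "w < u + d" using after[OF d(1)] by blast
    then have "f w < R" by (simp add: B_def)
    with equal lower[OF w(1)] have "u < w" by (cases "w = u") auto
    with d(2)[of "w - u"] w(2) equal \<open>f w < R\<close> show False by simp
  next
    case greater
    have "eventually (\<lambda>w. R < f w) (at u)"
      using cont greater unfolding isCont_def by (rule order_tendstoD(1))
    then obtain d where d: "d > 0" "\<And>w. w \<noteq> u \<Longrightarrow> dist w u < d \<Longrightarrow> R < f w"
      unfolding eventually_at by auto
    obtain w where "w \<in> B" "w < u + d" using after[OF d(1)] by blast
    then show False
      using lower[of w] greater d(2)[of w] by (cases "w = u") (auto simp: B_def dist_real_def)
  qed
qed

lemma card_le_2_if_no_three: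
  fixes Z :: "real set"
  assumes "\<And>a b d. a \<in> Z \<Longrightarrow> b \<in> Z \<Longrightarrow> d \<in> Z \<Longrightarrow> a < b \<Longrightarrow> b < d \<Longrightarrow> False"
  shows "finite Z" "card Z \<le> 2"
proof -
  have no: "\<not> (T \<subseteq> Z \<and> card T = 3)" for T
  proof
    assume T: "T \<subseteq> Z \<and> card T = 3"
    then obtain a b d where "T = {a, b, d}" "a \<noteq> b" "a \<noteq> d" "b \<noteq> d"
      by (auto simp: card_3_iff)
    with T show False
      using assms[of a b d] assms[of a d b] assms[of b a d] assms[of b d a] assms[of d a b] assms[of d b a]
      by (auto simp: neq_iff)
  qed
  show "finite Z" using no infinite_arbitrarily_large[of Z 3] by blast
  show "card Z \<le> 2"
  proof (rule ccontr)
    assume "\<not> card Z \<le> 2"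
    then have "3 \<le> card Z" by simp
    then show False using no obtain_subset_with_card_n[of 3 Z] by blast
  qed
qed

text \<open>The equations of the coordinates \<open>x\<close>, \<open>\<tau>\<close>, \<open>y\<close> of \<open>v\<close> in the frame of the curve.\<close>

locale coordinate_ode =
  fixes I :: "real set" and x \<tau> y k :: "real \<Rightarrow> real" and c q :: real
  assumes I: "open_interval I"
    and k_eq: "\<And>s. k s = c + \<tau> s"
    and x_deriv: "\<And>s. s \<in> I \<Longrightarrow> (x has_real_derivative \<tau> s) (at s)"
    and \<tau>_deriv: "\<And>s. s \<in> I \<Longrightarrow> (\<tau> has_real_derivative k s * x s - y s) (at s)"
    and y_deriv: "\<And>s. s \<in> I \<Longrightarrow> (y has_real_derivative - k s * \<tau> s) (at s)"
    and invariant: "\<And>s. s \<in> I \<Longrightarrow> 2 * x s * y s + (\<tau> s)\<^sup>2 = q"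
    and nondegenerate: "\<And>s. s \<in> I \<Longrightarrow> k s = 0 \<Longrightarrow> y s \<noteq> 0"
begin

lemma k_deriv: "s \<in> I \<Longrightarrow> (k has_real_derivative k s * x s - y s) (at s)"
  using DERIV_add[OF DERIV_const \<tau>_deriv, of s c] by (simp add: k_eq[abs_def])

lemma between_in_I: "a \<in> I \<Longrightarrow> b \<in> I \<Longrightarrow> a \<le> s \<Longrightarrow> s \<le> b \<Longrightarrow> s \<in> I"
  using I unfolding open_interval_def is_interval_1 by blast

lemma continuous_on_k: "S \<subseteq> I \<Longrightarrow> continuous_on S k"
  using k_deriv DERIV_isCont by (intro continuous_at_imp_continuous_on) blast

definition W :: "real \<Rightarrow> real" where
  "W s = y s + c * x s"

lemma W_deriv: "s \<in> I \<Longrightarrow> (W has_real_derivative - (\<tau> s)\<^sup>2) (at s)"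
  unfolding W_def using x_deriv y_deriv
  by (auto intro!: derivative_eq_intros simp: k_eq power2_eq_square algebra_simps)

lemma W_decreasing:
  assumes "a \<in> I" "b \<in> I" "a \<le> b"
  shows "W b \<le> W a"
  using assms(3)
proof (rule DERIV_nonpos_imp_nonincreasing)
  show "\<exists>d. DERIV W s :> d \<and> d \<le> 0" if "a \<le> s" "s \<le> b" for s
    using W_deriv[OF between_in_I[OF assms(1,2) that]] by auto
qed

text \<open>A zero of \<open>k\<close> is simple, since \<open>k' = - y\<close> there and
  \<open>nondegenerate\<close> applies; so the later zeros stay away from \<open>a\<close>, and
  compactness gives a least one.\<close>

lemma next_zero:
  assumes ab: "a \<in> I" "b \<in> I" "a < b" and "k a = 0" "k b = 0"
  obtains b' where "a < b'" "b' \<le> b" "k b' = 0" "\<And>s. a < s \<Longrightarrow> s < b' \<Longrightarrow> k s \<noteq> 0"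
proof -
  have "y a \<noteq> 0" and d: "(k has_real_derivative - y a) (at a)"
    using nondegenerate k_deriv[OF ab(1)] ab assms(4) by auto
  have "\<exists>d>0. \<forall>h. 0 < h \<longrightarrow> h < d \<longrightarrow> k (a + h) \<noteq> 0"
  proof (cases "y a > 0")
    case True
    then show ?thesis using DERIV_neg_dec_right[OF d] assms(4) by fastforce
  next
    case False
    then show ?thesis using DERIV_pos_inc_right[OF d] \<open>y a \<noteq> 0\<close> assms(4) by fastforce
  qed
  then obtain d where d: "d > 0" "\<And>h. 0 < h \<Longrightarrow> h < d \<Longrightarrow> k (a + h) \<noteq> 0" by blast
  then have d': "k s \<noteq> 0" if "a < s" "s < a + d" for s using that d(2)[of "s - a"] by simp
  define B where "B = {s \<in> {a + d..b}. k s = 0}"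
  have "a + d \<le> b" using d'[of b] ab assms(5) by force
  then have "b \<in> B" using assms by (simp add: B_def)
  have "{a + d..b} \<subseteq> I" using between_in_I[OF ab(1,2)] d(1) by auto
  then have "continuous_on {a + d..b} k" by (rule continuous_on_k)
  then have "closed B" unfolding B_def by (intro continuous_closed_preimage_constant) auto
  moreover have "bounded B" by (rule bounded_subset[of "{a + d..b}"]) (auto simp: B_def)
  ultimately have "compact B" by (simp add: compact_eq_bounded_closed)
  then obtain b' where b': "b' \<in> B" "\<And>s. s \<in> B \<Longrightarrow> b' \<le> s"
    using compact_attains_inf[of B] \<open>b \<in> B\<close> by blast
  show ?thesis
  proof (rule that[of b'])
    show "a < b'" "b' \<le> b" "k b' = 0" using b'(1) d(1) by (auto simp: B_def)
    show "k s \<noteq> 0" if "a < s" "s < b'" for s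
      using d'[OF that(1)] b'(2)[of s] b'(1) that by (force simp: B_def)
  qed
qed

text \<open>At a zero \<open>k' = - y\<close>, so the sign of \<open>k\<close> just inside each end
  of the gap is read off from \<open>y\<close>; as \<open>k\<close> keeps one sign in the gap,
  \<open>y\<close> has opposite signs at the two ends.\<close>

lemma hump:
  assumes ab: "a \<in> I" "b \<in> I" "a < b" "k a = 0" "k b = 0" and ne: "\<And>s. a < s \<Longrightarrow> s < b \<Longrightarrow> k s \<noteq> 0"
  shows "(\<forall>s. a < s \<longrightarrow> s < b \<longrightarrow> 0 < k s) \<and> y a < 0 \<and> 0 < y b \<or>
    (\<forall>s. a < s \<longrightarrow> s < b \<longrightarrow> k s < 0) \<and> 0 < y a \<and> y b < 0"
proof -
  have d: "(k has_real_derivative - y a) (at a)" "(k has_real_derivative - y b) (at b)"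
    using k_deriv[OF ab(1)] k_deriv[OF ab(2)] ab by simp_all
  have ya: "y a \<noteq> 0" "y b \<noteq> 0" using nondegenerate ab by auto
  have conn: "connected (k ` {a<..<b})"
    using between_in_I[OF ab(1,2)] by (intro connected_continuous_image continuous_on_k) auto
  have sign: "\<not> (k s < 0 \<and> 0 < k t)" if "a < s" "s < b" "a < t" "t < b" for s t
  proof
    assume "k s < 0 \<and> 0 < k t"
    then have "0 \<in> k ` {a<..<b}"
      using that by (intro connectedD_interval[OF conn, of "k s" "k t" 0, OF imageI imageI]) auto
    with ne show False by auto
  qed
  define m where "m = (a + b) / 2"
  have m: "a < m" "m < b" using ab by (auto simp: m_def)
  have step: "\<exists>h. 0 < h \<and> h < e \<and> h < b - a" if "0 < e" for e
    using dense[of 0 "min e (b - a)"] that ab(3) by auto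
  have right: "\<exists>s. a < s \<and> s < b \<and> 0 < - y a * k s"
  proof (cases "y a > 0")
    case True
    then obtain e where e: "e > 0" "\<And>h. 0 < h \<Longrightarrow> h < e \<Longrightarrow> k (a + h) < k a"
      using DERIV_neg_dec_right[OF d(1)] by auto
    obtain h where h: "0 < h" "h < e" "h < b - a" using step[OF e(1)] by blast
    then have "k (a + h) < 0" using e(2)[of h] ab by simp
    with True h ab show ?thesis
      by (intro exI[of _ "a + h"]) (auto simp: zero_less_mult_iff mult_less_0_iff)
  next
    case False
    then obtain e where e: "e > 0" "\<And>h. 0 < h \<Longrightarrow> h < e \<Longrightarrow> k (a + h) > k a"
      using DERIV_pos_inc_right[OF d(1)] ya by auto
    obtain h where h: "0 < h" "h < e" "h < b - a" using step[OF e(1)] by blast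
    then have "k (a + h) > 0" using e(2)[of h] ab by simp
    with False ya h ab show ?thesis
      by (intro exI[of _ "a + h"]) (auto simp: zero_less_mult_iff mult_less_0_iff)
  qed
  have left: "\<exists>s. a < s \<and> s < b \<and> 0 < y b * k s"
  proof (cases "y b > 0")
    case True
    then obtain e where e: "e > 0" "\<And>h. 0 < h \<Longrightarrow> h < e \<Longrightarrow> k (b - h) > k b"
      using DERIV_neg_dec_left[OF d(2)] by auto
    obtain h where h: "0 < h" "h < e" "h < b - a" using step[OF e(1)] by blast
    then have "k (b - h) > 0" using e(2)[of h] ab by simp
    with True h ab show ?thesis
      by (intro exI[of _ "b - h"]) (auto simp: zero_less_mult_iff mult_less_0_iff)
  next
    case False
    then obtain e where e: "e > 0" "\<And>h. 0 < h \<Longrightarrow> h < e \<Longrightarrow> k (b - h) < k b"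
      using DERIV_pos_inc_left[OF d(2)] ya by auto
    obtain h where h: "0 < h" "h < e" "h < b - a" using step[OF e(1)] by blast
    then have "k (b - h) < 0" using e(2)[of h] ab by simp
    with False ya h ab show ?thesis
      by (intro exI[of _ "b - h"]) (auto simp: zero_less_mult_iff mult_less_0_iff)
  qed
  obtain s t where s: "a < s" "s < b" "0 < - y a * k s" and t: "a < t" "t < b" "0 < y b * k t"
    using left right by blast
  show ?thesis
  proof (cases "k m > 0")
    case True
    then have pos: "0 < k u" if "a < u" "u < b" for u
      using sign[OF that m] ne[OF that] by force
    then have "y a < 0" "0 < y b"
      using s(3) t(3) pos[OF s(1,2)] pos[OF t(1,2)] by (auto simp: zero_less_mult_iff mult_less_0_iff)
    with pos show ?thesis by blast
  next
    case False
    then have neg: "k u < 0" if "a < u" "u < b" for u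
      using sign[OF m that] ne[OF that] ne[OF m] by force
    then have "0 < y a" "y b < 0"
      using s(3) t(3) neg[OF s(1,2)] neg[OF t(1,2)] by (auto simp: zero_less_mult_iff mult_less_0_iff)
    with neg show ?thesis by blast
  qed
qed

text \<open>Over consecutive gaps \<open>k\<close> alternates in sign, and so does \<open>y\<close>
  at the zeros. If \<open>c \<le> 0\<close>, a positive hump has \<open>y' = - k \<tau> < 0\<close>,
  against the rise of \<open>y\<close> across it. If \<open>c > 0\<close>, \<open>x\<close> falls
  across both humps, whereas \<open>x y\<close> has the same value at all zeros, so \<open>x\<close>
  would have to alternate with \<open>y\<close> or vanish throughout.\<close>

lemma no_three_zeros:
  assumes abd: "a \<in> I" "b \<in> I" "d \<in> I" "k a = 0" "k b = 0" "k d = 0" "a < b" "b < d"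
  shows False
proof -
  obtain b1 where b1: "a < b1" "b1 \<le> b" "k b1 = 0" "\<And>s. a < s \<Longrightarrow> s < b1 \<Longrightarrow> k s \<noteq> 0"
    using next_zero[OF abd(1,2,7,4,5)] by blast
  have I1: "b1 \<in> I" using between_in_I[OF abd(1,2)] b1 by auto
  have "b1 < d" using b1 abd by simp
  then obtain b2 where b2: "b1 < b2" "b2 \<le> d" "k b2 = 0" "\<And>s. b1 < s \<Longrightarrow> s < b2 \<Longrightarrow> k s \<noteq> 0"
    using next_zero[OF I1 abd(3) _ b1(3) abd(6)] by blast
  have I2: "b2 \<in> I" using between_in_I[OF I1 abd(3)] b2 by auto
  have in_I: "u \<in> I" if "a \<le> u" "u \<le> b2" for u using between_in_I[OF abd(1) I2 that] .
  note h1 = hump[OF abd(1) I1 b1(1) abd(4) b1(3,4)] and h2 = hump[OF I1 I2 b2(1) b1(3) b2(3,4)]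
  have cont: "continuous_on {u..w} x" "continuous_on {u..w} y" if "a \<le> u" "w \<le> b2" for u w
  proof -
    have "isCont x s \<and> isCont y s" if "a \<le> s" "s \<le> b2" for s
      using DERIV_isCont[OF x_deriv[OF in_I[OF that]]] DERIV_isCont[OF y_deriv[OF in_I[OF that]]] by blast
    then show "continuous_on {u..w} x" "continuous_on {u..w} y"
      using that by (auto intro!: continuous_at_imp_continuous_on)
  qed
  have pos_nonpos: False
    if "c \<le> 0" "a \<le> u" "u < w" "w \<le> b2" "\<forall>s. u < s \<longrightarrow> s < w \<longrightarrow> 0 < k s" "y u < 0" "0 < y w" for u w
  proof -
    have "y w < y u"
    proof (rule DERIV_neg_imp_decreasing_open[OF that(3)])
      fix s assume s: "u < s" "s < w"
      then have "k s > 0" using that by blast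
      moreover have "\<tau> s > 0" using \<open>k s > 0\<close> that(1) k_eq[of s] by simp
      ultimately show "\<exists>d. DERIV y s :> d \<and> d < 0"
        using y_deriv[of s] in_I[of s] s that by (intro exI[of _ "- k s * \<tau> s"]) auto
    qed (use cont that in auto)
    with that show False by simp
  qed
  \<comment> \<open>Here \<open>y\<close> rises, so the decrease of \<open>W = y + c x\<close> must
    be borne by \<open>x\<close>.\<close>
  have pos_pos: "x w < x u" if "c > 0" "a \<le> u" "u < w" "w \<le> b2" "y u < 0" "0 < y w" for u w
  proof -
    have "W w \<le> W u" using that by (intro W_decreasing in_I) auto
    then have "c * x w < c * x u" using that unfolding W_def by linarith
    with that(1) show ?thesis by simp
  qed
  have neg_pos: "x w < x u"
    if "c > 0" "a \<le> u" "u < w" "w \<le> b2" "\<forall>s. u < s \<longrightarrow> s < w \<longrightarrow> k s < 0" for u w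
  proof (rule DERIV_neg_imp_decreasing_open[OF that(3)])
    fix s assume s: "u < s" "s < w"
    then have "k s < 0" using that by blast
    then have "\<tau> s < 0" using that(1) k_eq[of s] by simp
    then show "\<exists>d. DERIV x s :> d \<and> d < 0"
      using x_deriv[of s] in_I[of s] s that by auto
  qed (use cont that in auto)
  \<comment> \<open>At a zero \<open>\<tau> = - c\<close>, so the first integral fixes the product
    \<open>x y\<close>.\<close>
  have zero: "2 * (x u * y u) = q - c\<^sup>2" if "u \<in> I" "k u = 0" for u
  proof -
    have "\<tau> u = - c" using that k_eq[of u] by simp
    with invariant[OF that(1)] show ?thesis by simp
  qed
  note z = zero[OF abd(1,4)] zero[OF I1 b1(3)] zero[OF I2 b2(3)]
  show False
  proof (cases "c \<le> 0")
    case True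
    then show False
      using h1 h2 pos_nonpos[of a b1] pos_nonpos[of b1 b2] b1(1) b2(1) by auto
  next
    case False
    then have x: "x b1 < x a" "x b2 < x b1"
      using h1 h2 pos_pos[of a b1] pos_pos[of b1 b2] neg_pos[of a b1] neg_pos[of b1 b2] b1(1) b2(1) by auto
    have y: "y a < 0 \<and> 0 < y b1 \<and> y b2 < 0 \<or> 0 < y a \<and> y b1 < 0 \<and> 0 < y b2"
      using h1 h2 by auto
    have eq: "x a * y a = x b1 * y b1" "x b1 * y b1 = x b2 * y b2" using z by auto
    have neg: "u < 0 \<and> 0 < w \<or> 0 < u \<and> w < 0 \<or> u = 0 \<and> w = 0"
      if "u * r = w * t" "r < 0 \<and> 0 < t \<or> 0 < r \<and> t < 0" for u w r t :: real
      using that by (smt (verit) mult_pos_pos mult_neg_neg mult_pos_neg mult_neg_pos mult_eq_0_iff)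
    from neg[OF eq(1)] neg[OF eq(2)] y x show False by auto
  qed
qed

lemma zeros: "finite {s \<in> I. k s = 0}" "card {s \<in> I. k s = 0} \<le> 2"
  using card_le_2_if_no_three[of "{s \<in> I. k s = 0}"] no_three_zeros by blast+

end

subsection \<open>Ends of the curvature\<close>

context coordinate_ode
begin

lemma constant_sign:
  assumes "\<And>s. a \<le> s \<Longrightarrow> s \<in> I" "\<And>s. a \<le> s \<Longrightarrow> k s \<noteq> 0"
  shows "(\<forall>s\<ge>a. 0 < k s) \<or> (\<forall>s\<ge>a. k s < 0)"
proof (rule ccontr)
  assume "\<not> ?thesis"
  then obtain s t where "a \<le> s" "a \<le> t" "k s < 0" "0 < k t"
    using assms(2) by (metis linorder_less_linear)
  moreover have "connected (k ` {a..})"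
    using assms(1) by (intro connected_continuous_image continuous_on_k) auto
  ultimately have "0 \<in> k ` {a..}"
    by (intro connectedD_interval[of "k ` {a..}" "k s" "k t" 0, OF _ imageI imageI]) auto
  then show False using assms(2) by auto
qed

end

locale bounded_end = coordinate_ode +
  fixes a K :: real
  assumes ray: "\<And>s. a \<le> s \<Longrightarrow> s \<in> I" and k_bound: "\<And>s. a \<le> s \<Longrightarrow> \<bar>k s\<bar> \<le> K"
begin

text \<open>\<open>K'\<close> bounds \<open>\<tau> = k - c\<close> and with it the slope of
  \<open>x\<close>; the summand 1 keeps it positive. \<open>B\<close> bounds the product
  \<open>x y\<close> through the first integral.\<close>

definition K' :: real where "K' = K + \<bar>c\<bar> + 1"
definition B :: real where "B = (\<bar>q\<bar> + K'\<^sup>2) / 2"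

lemma K_nonneg: "0 \<le> K" using k_bound[of a] by simp
lemma K'_pos: "0 < K'" using K_nonneg by (simp add: K'_def)
lemma B_nonneg: "0 \<le> B" by (simp add: B_def)

lemma \<tau>_bound: "a \<le> s \<Longrightarrow> \<bar>\<tau> s\<bar> \<le> K'"
  using k_bound[of s] k_eq[of s] by (simp add: K'_def)

lemma xy_bound: "a \<le> s \<Longrightarrow> \<bar>x s\<bar> * \<bar>y s\<bar> \<le> B"
proof -
  assume "a \<le> s"
  have "(\<tau> s)\<^sup>2 \<le> K'\<^sup>2" using \<tau>_bound[OF \<open>a \<le> s\<close>] by (simp add: abs_le_square_iff[symmetric])
  moreover have "2 * (x s * y s) = q - (\<tau> s)\<^sup>2" using invariant[OF ray[OF \<open>a \<le> s\<close>]] by simp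
  ultimately have "2 * \<bar>x s * y s\<bar> \<le> \<bar>q\<bar> + K'\<^sup>2"
    using zero_le_power2[of "\<tau> s"] by linarith
  then show ?thesis by (simp add: B_def abs_mult)
qed

lemma x_step:
  assumes "a \<le> s" "s \<le> u"
  shows "\<bar>x u - x s\<bar> \<le> K' * (u - s)"
proof (cases "s = u")
  case False
  then have "s < u" using assms by simp
  moreover have "DERIV x w :> \<tau> w" if "s \<le> w" "w \<le> u" for w
    using x_deriv ray that assms by auto
  ultimately obtain w where "s < w" "w < u" "x u - x s = (u - s) * \<tau> w"
    using MVT2[of s u x \<tau>] by blast
  then show ?thesis using \<tau>_bound[of w] assms by (simp add: abs_mult mult.commute mult_right_mono)
qed simp

text \<open>An argument of Barbalat's type: \<open>W\<close> decreases at rate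
  \<open>\<tau>^2\<close> and is bounded below, while \<open>\<tau>\<close> is Lipschitz, so
  \<open>\<tau>\<close> cannot keep returning to a fixed positive size.\<close>

lemma bounded_x_tendsto:
  assumes x: "\<And>s. a \<le> s \<Longrightarrow> \<bar>x s\<bar> \<le> R"
  shows "(\<tau> \<longlongrightarrow> 0) at_top"
proof -
  have R: "0 \<le> R" using x[of a] by simp
  have kx: "\<bar>k s * x s\<bar> \<le> K * R" if "a \<le> s" for s
    unfolding abs_mult using k_bound[OF that] x[OF that] K_nonneg by (intro mult_mono) auto
  have cx: "\<bar>c * x s\<bar> \<le> \<bar>c\<bar> * R" if "a \<le> s" for s
    unfolding abs_mult using x[OF that] by (intro mult_left_mono) auto
  have W_dec: "W t \<le> W s" if "a \<le> s" "s \<le> t" for s t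
    using that by (intro W_decreasing ray) auto
  define w0 where "w0 = - (K * R + \<bar>c\<bar> * R + 1)"
  text \<open>Below \<open>w0\<close> the derivative of \<open>\<tau>\<close> would stay at least 1.\<close>
  have W_low: "w0 \<le> W s" if s: "a \<le> s" for s
  proof (rule ccontr)
    assume less: "\<not> w0 \<le> W s"
    \<comment> \<open>A slope of at least 1 over time \<open>2 * K' + 1\<close> exceeds the total
      range \<open>2 * K'\<close> of \<open>\<tau>\<close>.\<close>
    have "1 * (2 * K' + 1) \<le> \<tau> (s + (2 * K' + 1)) - \<tau> s"
    proof -
      have "DERIV \<tau> w :> k w * x w - y w" if "s \<le> w" "w \<le> s + (2 * K' + 1)" for w
        using \<tau>_deriv ray that s by auto
      then obtain w where w: "s < w" "\<tau> (s + (2 * K' + 1)) - \<tau> s = (2 * K' + 1) * (k w * x w - y w)"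
        using MVT2[of s "s + (2 * K' + 1)" \<tau> "\<lambda>w. k w * x w - y w"] K'_pos by auto
      have "W w \<le> W s" using W_dec s w by simp
      then have "1 \<le> k w * x w - y w"
        using kx[of w] cx[of w] less s w(1) by (simp add: W_def w0_def)
      then show ?thesis unfolding w(2) using K'_pos by simp
    qed
    moreover have "\<bar>\<tau> (s + (2 * K' + 1))\<bar> \<le> K'" using s K'_pos by (intro \<tau>_bound) simp
    ultimately have "2 * K' + 1 \<le> K' + K'"
      using \<tau>_bound[OF s] by (smt (verit))
    then show False by simp
  qed
  \<comment> \<open>Lipschitz constant of \<open>\<tau>\<close>: a bound for \<open>k x\<close> plus
    one for \<open>y = W - c x\<close>, where \<open>W\<close> lies between \<open>w0\<close> and
    \<open>W a\<close>.\<close>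
  define D where "D = K * R + (\<bar>W a\<bar> + \<bar>w0\<bar> + \<bar>c\<bar> * R) + 1"
  have D: "D > 0" using K_nonneg R by (simp add: D_def add_nonneg_pos)
  have \<tau>': "\<bar>k s * x s - y s\<bar> \<le> D" if "a \<le> s" for s
    using kx[OF that] cx[OF that] W_low[OF that] W_dec[of a s] that by (simp add: D_def W_def)
  have \<tau>_step: "\<bar>\<tau> u - \<tau> s\<bar> \<le> D * (u - s)" if "a \<le> s" "s \<le> u" for s u
  proof (cases "s = u")
    case False
    then have "s < u" using that by simp
    moreover have "DERIV \<tau> w :> k w * x w - y w" if "s \<le> w" "w \<le> u" for w
      using \<tau>_deriv ray that \<open>a \<le> s\<close> by auto
    ultimately obtain w where "s < w" "w < u" "\<tau> u - \<tau> s = (u - s) * (k w * x w - y w)"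
      using MVT2[of s u \<tau> "\<lambda>w. k w * x w - y w"] by blast
    then show ?thesis using \<tau>'[of w] that by (simp add: abs_mult mult.commute mult_right_mono)
  qed simp
  define L where "L = Inf (W ` {a..})"
  have bdd: "bdd_below (W ` {a..})" using W_low by (auto simp: bdd_below_def)
  have L: "L \<le> W s" if "a \<le> s" for s using that bdd by (auto simp: L_def intro: cInf_lower)
  have "eventually (\<lambda>s. \<bar>\<tau> s\<bar> < e) at_top" if e: "e > 0" for e
  proof -
    define h where "h = e / (2 * D)"
    have h: "h > 0" "D * h = e / 2" using e D by (auto simp: h_def)
    define \<eta> where "\<eta> = (e / 2)\<^sup>2 * h"
    have "\<eta> > 0" using e h by (simp add: \<eta>_def)
    then obtain s2 where s2: "a \<le> s2" "W s2 < L + \<eta>"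
      using cInf_lessD[of "W ` {a..}" "L + \<eta>"] by (auto simp: L_def)
    have "\<bar>\<tau> s\<bar> < e" if s: "s2 \<le> s" for s
    proof (rule ccontr)
      assume big: "\<not> \<bar>\<tau> s\<bar> < e"
      have "DERIV W w :> - (\<tau> w)\<^sup>2" if "s \<le> w" "w \<le> s + h" for w
        using W_deriv ray that s s2 by auto
      then obtain w where w: "s < w" "w < s + h" "W (s + h) - W s = h * - (\<tau> w)\<^sup>2"
        using MVT2[of s "s + h" W "\<lambda>w. - (\<tau> w)\<^sup>2"] h by auto
      have "\<bar>\<tau> w - \<tau> s\<bar> \<le> D * (w - s)" using \<tau>_step s s2 w by simp
      also have "\<dots> \<le> D * h" using w D by (intro mult_left_mono) auto
      finally have "e / 2 \<le> \<bar>\<tau> w\<bar>" using big h(2) by linarith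
      then have "(e / 2)\<^sup>2 \<le> (\<tau> w)\<^sup>2" using e by (simp add: abs_le_square_iff[symmetric])
      then have "\<eta> \<le> h * (\<tau> w)\<^sup>2" using h by (simp add: \<eta>_def mult.commute)
      then have "W (s + h) \<le> W s2 - \<eta>" using w(3) W_dec[OF s2(1) s] by linarith
      with s2 L[of "s + h"] s h show False by linarith
    qed
    then show ?thesis using eventually_at_top_linorder by blast
  qed
  then show ?thesis by (simp add: tendsto_iff dist_real_def)
qed

text \<open>With \<open>N = k\<^sup>2\<close> one has \<open>N' = 2 x N - 2 k y\<close>, where \<open>\<bar>k y\<bar> \<le> K B / \<bar>x\<bar>\<close>: a large positive \<open>x\<close> makes \<open>N\<close> exceed its
  bound within time 1 unless it is small, and a large negative \<open>x\<close> makes it small within time 1.\<close>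

lemma ky_bound:
  assumes "a \<le> u" "r \<le> \<bar>x u\<bar>" "0 < r"
  shows "\<bar>k u * y u\<bar> \<le> K * B / r"
proof -
  have "r * \<bar>y u\<bar> \<le> B"
    using mult_right_mono[OF assms(2) abs_ge_zero[of "y u"]] xy_bound[OF assms(1)] by linarith
  then have "\<bar>y u\<bar> \<le> B / r" using assms(3) by (simp add: field_simps)
  then have "\<bar>k u\<bar> * \<bar>y u\<bar> \<le> K * (B / r)"
    using k_bound[OF assms(1)] K_nonneg by (intro mult_mono) auto
  then show ?thesis by (simp add: abs_mult)
qed

text \<open>\<open>r\<close> is the size of \<open>\<bar>x\<bar>\<close> that counts as large: the
  forcing term is then at most half of \<open>\<delta>^2\<close>, and the growth factor
  \<open>exp (2 * r) \<ge> 1 + 2 * r\<close> over unit time lifts the other half above the bound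
  \<open>K^2\<close>.\<close>

lemma threshold:
  assumes "0 < \<delta>"
  obtains r where "1 \<le> r" "K * B / r\<^sup>2 \<le> \<delta>\<^sup>2 / 2" "K\<^sup>2 < \<delta>\<^sup>2 / 2 * (1 + 2 * r)"
proof -
  define r where "r = 1 + 2 * K * B / \<delta>\<^sup>2 + K\<^sup>2 / \<delta>\<^sup>2"
  have nn: "0 \<le> 2 * K * B / \<delta>\<^sup>2" "0 \<le> K\<^sup>2 / \<delta>\<^sup>2"
    using K_nonneg B_nonneg by auto
  then have r: "1 \<le> r" "2 * K * B / \<delta>\<^sup>2 \<le> r" "K\<^sup>2 / \<delta>\<^sup>2 \<le> r" by (auto simp: r_def)
  have "2 * K * B \<le> r * \<delta>\<^sup>2" "K\<^sup>2 \<le> r * \<delta>\<^sup>2"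
    using r(2,3) assms by (simp_all add: divide_le_eq)
  moreover have "r * \<delta>\<^sup>2 \<le> r\<^sup>2 * \<delta>\<^sup>2"
    using r(1) by (intro mult_right_mono) (auto simp: power2_eq_square)
  ultimately have "2 * K * B \<le> r\<^sup>2 * \<delta>\<^sup>2" by linarith
  then have "K * B / r\<^sup>2 \<le> \<delta>\<^sup>2 / 2" using r(1) by (simp add: field_simps)
  moreover have "0 < \<delta>\<^sup>2" using assms by simp
  then have "K\<^sup>2 < \<delta>\<^sup>2 / 2 * (1 + 2 * r)"
  proof -
    have "\<delta>\<^sup>2 / 2 * (1 + 2 * r) = \<delta>\<^sup>2 / 2 + r * \<delta>\<^sup>2" by (simp add: algebra_simps)
    then show ?thesis using \<open>K\<^sup>2 \<le> r * \<delta>\<^sup>2\<close> \<open>0 < \<delta>\<^sup>2\<close> by linarith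
  qed
  ultimately show ?thesis using that r(1) by blast
qed

lemma small_if_x_large:
  assumes "0 < \<delta>"
  shows "\<exists>R. \<forall>s\<ge>a. R \<le> x s \<longrightarrow> \<bar>k s\<bar> < \<delta>"
proof -
  obtain r where r: "1 \<le> r" "K * B / r\<^sup>2 \<le> \<delta>\<^sup>2 / 2" "K\<^sup>2 < \<delta>\<^sup>2 / 2 * (1 + 2 * r)"
    using threshold[OF assms] .
  \<comment> \<open>Since \<open>\<bar>k y\<bar> \<le> r \<beta>\<close>, one gets
    \<open>(k^2 - \<beta>)' \<ge> 2 r (k^2 - \<beta>)\<close> while \<open>x \<ge> r\<close>;
    \<open>G\<close> below is the integrated form of this.\<close>
  define \<beta> where "\<beta> = K * B / r\<^sup>2"
  \<comment> \<open>The margin \<open>K'\<close> is the most that \<open>x\<close> can move in unit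
    time, so \<open>x \<ge> r\<close> holds on all of \<open>[s, s + 1]\<close>.\<close>
  have "\<bar>k s\<bar> < \<delta>" if s: "a \<le> s" "r + K' \<le> x s" for s
  proof (rule ccontr)
    assume "\<not> \<bar>k s\<bar> < \<delta>"
    then have N: "\<delta>\<^sup>2 \<le> (k s)\<^sup>2" using assms by (simp add: abs_le_square_iff[symmetric])
    have xr: "r \<le> x u" if "s \<le> u" "u \<le> s + 1" for u
    proof -
      have "K' * (u - s) \<le> K' * 1" using that K'_pos by (intro mult_left_mono) auto
      then show ?thesis using x_step[OF s(1) that(1)] s(2) by linarith
    qed
    define G where "G u = ((k u)\<^sup>2 - \<beta>) * exp (- 2 * r * u)" for u
    define G' where "G' u = (2 * k u * (k u * x u - y u) - 2 * r * ((k u)\<^sup>2 - \<beta>)) * exp (- 2 * r * u)" for u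
    have "G s \<le> G (s + 1)"
    proof (rule DERIV_nonneg_imp_nondecreasing[where f = G])
      fix u assume u: "s \<le> u" "u \<le> s + 1"
      have "(G has_real_derivative G' u) (at u)"
        unfolding G_def G'_def using k_deriv[of u] ray[of u] u s
        by (auto intro!: derivative_eq_intros simp: algebra_simps)
      moreover have "0 \<le> G' u"
      proof -
        have "\<bar>k u * y u\<bar> \<le> K * B / r" using ky_bound[of u r] xr[OF u] u s r(1) by auto
        also have "\<dots> = r * \<beta>" using r(1) by (simp add: \<beta>_def power2_eq_square)
        finally have "k u * y u \<le> r * \<beta>" by simp
        moreover have "r * (k u)\<^sup>2 \<le> x u * (k u)\<^sup>2" using xr[OF u] by (intro mult_right_mono) auto
        ultimately show ?thesis
          unfolding G'_def by (intro mult_nonneg_nonneg) (auto simp: power2_eq_square algebra_simps)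
      qed
      ultimately show "\<exists>d. DERIV G u :> d \<and> 0 \<le> d" by blast
    qed simp
    then have "((k s)\<^sup>2 - \<beta>) * exp (- 2 * r * s) * exp (2 * r * (s + 1)) \<le>
        ((k (s + 1))\<^sup>2 - \<beta>) * exp (- 2 * r * (s + 1)) * exp (2 * r * (s + 1))"
      unfolding G_def by (intro mult_right_mono) auto
    then have "((k s)\<^sup>2 - \<beta>) * exp (2 * r) \<le> (k (s + 1))\<^sup>2 - \<beta>"
      by (simp add: mult.assoc exp_add[symmetric] algebra_simps)
    moreover have "\<delta>\<^sup>2 / 2 * (1 + 2 * r) \<le> ((k s)\<^sup>2 - \<beta>) * exp (2 * r)"
    proof (rule mult_mono)
      show "\<delta>\<^sup>2 / 2 \<le> (k s)\<^sup>2 - \<beta>" using N r(2) unfolding \<beta>_def by linarith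
      then show "0 \<le> (k s)\<^sup>2 - \<beta>" using zero_le_power2[of \<delta>] by linarith
    qed (use r(1) exp_ge_add_one_self[of "2 * r"] in auto)
    moreover have "(k (s + 1))\<^sup>2 \<le> K\<^sup>2"
      using k_bound[of "s + 1"] s(1) by (simp add: abs_le_square_iff[symmetric])
    moreover have "0 \<le> \<beta>" using K_nonneg B_nonneg by (simp add: \<beta>_def)
    ultimately show False using r(3) by linarith
  qed
  then show ?thesis by blast
qed

text \<open>For negative \<open>x\<close> the inequality for \<open>k^2 - \<beta>\<close> contracts
  instead of expanding, so nothing is forced at \<open>s\<close> itself; smallness is available only
  at \<open>s + 1\<close>.\<close>

lemma small_after_x_large_negative:
  assumes "0 < \<delta>"
  shows "\<exists>R. \<forall>s\<ge>a. x s \<le> - R \<longrightarrow> \<bar>k (s + 1)\<bar> < \<delta>"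
proof -
  obtain r where r: "1 \<le> r" "K * B / r\<^sup>2 \<le> \<delta>\<^sup>2 / 2" "K\<^sup>2 < \<delta>\<^sup>2 / 2 * (1 + 2 * r)"
    using threshold[OF assms] .
  define \<beta> where "\<beta> = K * B / r\<^sup>2"
  have "\<bar>k (s + 1)\<bar> < \<delta>" if s: "a \<le> s" "x s \<le> - (r + K')" for s
  proof -
    have xr: "x u \<le> - r" if "s \<le> u" "u \<le> s + 1" for u
    proof -
      have "K' * (u - s) \<le> K' * 1" using that K'_pos by (intro mult_left_mono) auto
      then show ?thesis using x_step[OF s(1) that(1)] s(2) by linarith
    qed
    define G where "G u = ((k u)\<^sup>2 - \<beta>) * exp (2 * r * u)" for u
    define G' where "G' u = (2 * k u * (k u * x u - y u) + 2 * r * ((k u)\<^sup>2 - \<beta>)) * exp (2 * r * u)" for u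
    have "G (s + 1) \<le> G s"
    proof (rule DERIV_nonpos_imp_nonincreasing[where f = G])
      fix u assume u: "s \<le> u" "u \<le> s + 1"
      have "(G has_real_derivative G' u) (at u)"
        unfolding G_def G'_def using k_deriv[of u] ray[of u] u s
        by (auto intro!: derivative_eq_intros simp: algebra_simps)
      moreover have "G' u \<le> 0"
      proof -
        have "\<bar>k u * y u\<bar> \<le> K * B / r" using ky_bound[of u r] xr[OF u] u s r(1) by auto
        also have "\<dots> = r * \<beta>" using r(1) by (simp add: \<beta>_def power2_eq_square)
        finally have "- (k u * y u) \<le> r * \<beta>" by simp
        moreover have "x u * (k u)\<^sup>2 \<le> - r * (k u)\<^sup>2" using xr[OF u] by (intro mult_right_mono) auto
        ultimately show ?thesis
          unfolding G'_def by (intro mult_nonpos_nonneg) (auto simp: power2_eq_square algebra_simps)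
      qed
      ultimately show "\<exists>d. DERIV G u :> d \<and> d \<le> 0" by blast
    qed simp
    then have "((k (s + 1))\<^sup>2 - \<beta>) * exp (2 * r * (s + 1)) * exp (- 2 * r * s) \<le>
        ((k s)\<^sup>2 - \<beta>) * exp (2 * r * s) * exp (- 2 * r * s)"
      unfolding G_def by (intro mult_right_mono) auto
    then have "((k (s + 1))\<^sup>2 - \<beta>) * exp (2 * r) \<le> (k s)\<^sup>2 - \<beta>"
      by (simp add: mult.assoc exp_add[symmetric] algebra_simps)
    moreover have "(k s)\<^sup>2 \<le> K\<^sup>2"
      using k_bound[OF s(1)] by (simp add: abs_le_square_iff[symmetric])
    moreover have "0 \<le> \<beta>" using K_nonneg B_nonneg by (simp add: \<beta>_def)
    moreover have "\<delta>\<^sup>2 / 2 * (1 + 2 * r) \<le> \<delta>\<^sup>2 / 2 * exp (2 * r)"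
      using exp_ge_add_one_self[of "2 * r"] by (intro mult_left_mono) auto
    ultimately have "((k (s + 1))\<^sup>2 - \<beta>) * exp (2 * r) < \<delta>\<^sup>2 / 2 * exp (2 * r)"
      using r(3) by linarith
    then have "(k (s + 1))\<^sup>2 < \<delta>\<^sup>2" using r(2) by (simp add: \<beta>_def)
    then show ?thesis using assms by (metis abs_le_square_iff abs_of_pos not_le)
  qed
  then show ?thesis by blast
qed

text \<open>Restricting to thresholds up to \<open>d\<close> allows \<open>d = \<bar>c\<bar>\<close>
  when \<open>c \<noteq> 0\<close>, and then \<open>\<bar>k\<bar> < \<delta>\<close> already
  determines the sign of \<open>\<tau> = k - c\<close>.\<close>

lemma k_tendsto_0I:
  assumes "\<And>\<delta>. 0 < \<delta> \<Longrightarrow> \<delta> \<le> d \<Longrightarrow> \<exists>b\<ge>a. \<forall>s\<ge>b. \<bar>k s\<bar> < \<delta>" "0 < d"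
  shows "(k \<longlongrightarrow> 0) at_top"
  unfolding tendsto_iff dist_real_def
proof (intro allI impI)
  fix e :: real assume "0 < e"
  then obtain b where "\<forall>s\<ge>b. \<bar>k s\<bar> < min e d" using assms(1)[of "min e d"] assms(2) by auto
  then show "\<forall>\<^sub>F s in at_top. \<bar>k s - 0\<bar> < e" unfolding eventually_at_top_linorder by auto
qed

text \<open>For unbounded \<open>x\<close> the sign of \<open>c\<close> decides on the side. Small
  \<open>k\<close> gives \<open>\<tau>\<close> the sign of \<open>- c\<close>, which traps
  \<open>x\<close> once it is far out on that side; the other side is excluded by the decreasing
  \<open>W\<close> if \<open>c < 0\<close> and by the same drift if \<open>c > 0\<close>. For
  \<open>c = 0\<close> there is no drift, but \<open>\<tau> = k\<close> has finitely many zeros, so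
  \<open>x\<close> is eventually monotone.\<close>

theorem k_tendsto: "(k \<longlongrightarrow> c) at_top \<or> (k \<longlongrightarrow> 0) at_top"
proof (cases "\<exists>R. \<forall>s\<ge>a. \<bar>x s\<bar> \<le> R")
  case True
  then have "(\<tau> \<longlongrightarrow> 0) at_top" using bounded_x_tendsto by blast
  then have "((\<lambda>s. c + \<tau> s) \<longlongrightarrow> c + 0) at_top" by (intro tendsto_intros)
  then show ?thesis by (simp add: k_eq[abs_def])
next
  case False
  then have unb: "\<exists>s\<ge>a. R < \<bar>x s\<bar>" for R by (meson not_le)
  consider "c < 0" | "c > 0" | "c = 0" by linarith
  then have "(k \<longlongrightarrow> 0) at_top"
  proof cases
    case 1
    \<comment> \<open>For \<open>x \<le> - 1\<close> the product bound gives
      \<open>\<bar>y\<bar> \<le> B\<close>, so \<open>W \<le> W a\<close> caps \<open>c * x\<close>,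
      which is positive there.\<close>
    define X where "X = \<bar>W a\<bar> + B"
    have low: "x s \<ge> - (X / - c + 1)" if s: "a \<le> s" for s
    proof (rule ccontr)
      assume n: "\<not> x s \<ge> - (X / - c + 1)"
      have "0 \<le> X / - c" using 1 B_nonneg by (intro divide_nonneg_nonneg) (auto simp: X_def)
      then have "\<bar>x s\<bar> \<ge> 1" using n by linarith
      then have "1 * \<bar>y s\<bar> \<le> \<bar>x s\<bar> * \<bar>y s\<bar>" by (intro mult_right_mono) auto
      then have "\<bar>y s\<bar> \<le> B" using xy_bound[OF s] by simp
      moreover have "W s \<le> W a" using s ray by (intro W_decreasing) auto
      ultimately have "c * x s \<le> X" by (simp add: W_def X_def)
      moreover have "c * - (X / - c + 1) < c * x s" using n 1 by (intro mult_strict_left_mono_neg) auto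
      moreover have "c * - (X / - c + 1) = X - c" using 1 by (simp add: field_simps)
      ultimately show False using 1 by simp
    qed
    show ?thesis
    proof (rule k_tendsto_0I)
      fix \<delta> assume \<delta>: "0 < \<delta>" "\<delta> \<le> - c"
      obtain R where R: "\<And>s. a \<le> s \<Longrightarrow> R \<le> x s \<Longrightarrow> \<bar>k s\<bar> < \<delta>" using small_if_x_large[OF \<delta>(1)] by blast
      obtain b where b: "a \<le> b" "max \<bar>R\<bar> (\<bar>X / - c + 1\<bar>) < \<bar>x b\<bar>" using unb by blast
      have "R \<le> x s" if "b \<le> s" for s
      proof (rule trapped_above[where f = x and a = b])
        show "(x has_real_derivative \<tau> u) (at u)" if "b \<le> u" for u using that b x_deriv ray by auto
        show "R \<le> x b" using b low[OF b(1)] by linarith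
        show "0 < \<tau> u" if "b \<le> u" "x u = R" for u
          using R[of u] that b \<delta> k_eq[of u] by auto
      qed (use that in auto)
      then show "\<exists>b\<ge>a. \<forall>s\<ge>b. \<bar>k s\<bar> < \<delta>" using R b by (intro exI[of _ b]) auto
    qed (use 1 in auto)
  next
    case 2
    obtain R0 where R0: "\<And>s. a \<le> s \<Longrightarrow> R0 \<le> x s \<Longrightarrow> \<bar>k s\<bar> < c" using small_if_x_large[OF 2] by blast
    \<comment> \<open>From \<open>R0\<close> upwards \<open>k < c\<close>, so \<open>x\<close>
      decreases and cannot pass the level \<open>X\<close>.\<close>
    define X where "X = max R0 (x a)"
    have up: "x s \<le> X" if s: "a \<le> s" for s
    proof -
      have "- X \<le> - x s"
      proof (rule trapped_above[where f = "\<lambda>s. - x s" and a = a and f' = "\<lambda>s. - \<tau> s"])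
        show "((\<lambda>s. - x s) has_real_derivative - \<tau> u) (at u)" if "a \<le> u" for u
          using that by (intro DERIV_minus x_deriv ray)
        show "0 < - \<tau> u" if "a \<le> u" "- x u = - X" for u
          using R0[of u] that k_eq[of u] by (auto simp: X_def)
      qed (use s in \<open>auto simp: X_def\<close>)
      then show ?thesis by simp
    qed
    show ?thesis
    proof (rule k_tendsto_0I)
      fix \<delta> assume \<delta>: "0 < \<delta>" "\<delta> \<le> c"
      obtain R where R: "\<And>s. a \<le> s \<Longrightarrow> x s \<le> - R \<Longrightarrow> \<bar>k (s + 1)\<bar> < \<delta>"
        using small_after_x_large_negative[OF \<delta>(1)] by blast
      \<comment> \<open>The extra \<open>K'\<close> below \<open>- R\<close> means that
        \<open>x\<close> needs more than unit time to come back to \<open>- R\<close>, which covers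
        the delay in the estimate for \<open>k\<close>.\<close>
      obtain b where b: "a \<le> b" "max \<bar>X\<bar> (\<bar>R\<bar> + K' + 1) < \<bar>x b\<bar>" using unb by blast
      then have xb: "x b < - R - K'" using up[OF b(1)] by linarith
      have trap: "R \<le> - x s" if "b \<le> s" for s
      proof (rule trapped_above[where f = "\<lambda>s. - x s" and a = b and f' = "\<lambda>s. - \<tau> s"])
        show "((\<lambda>s. - x s) has_real_derivative - \<tau> u) (at u)" if "b \<le> u" for u
          using that b by (intro DERIV_minus x_deriv ray) auto
        show "R \<le> - x b" using xb K'_pos by simp
        show "0 < - \<tau> u" if u: "b \<le> u" "\<forall>w\<in>{b..u}. R \<le> - x w" "- x u = R" for u
        proof -
          have "K' * 1 < K' * (u - b)" using x_step[OF b(1) u(1)] xb u(3) by simp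
          then have "b \<le> u - 1" using K'_pos by (simp only: mult_less_cancel_left_pos)
          then have "\<bar>k u\<bar> < \<delta>" using R[of "u - 1"] u(2)[rule_format, of "u - 1"] b(1) by simp
          then show ?thesis using \<delta> k_eq[of u] by simp
        qed
      qed (use that in auto)
      show "\<exists>b\<ge>a. \<forall>s\<ge>b. \<bar>k s\<bar> < \<delta>"
      proof (intro exI[of _ "b + 1"] conjI allI impI)
        show "\<bar>k s\<bar> < \<delta>" if "b + 1 \<le> s" for s
          using R[of "s - 1"] trap[of "s - 1"] that b(1) by simp
      qed (use b in auto)
    qed (use 2 in auto)
  next
    case 3
    have "finite {s \<in> I. k s = 0}" by (rule zeros)
    then obtain b0 where b0: "\<And>s. s \<in> I \<Longrightarrow> k s = 0 \<Longrightarrow> s < b0"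
      using bdd_above_finite unfolding bdd_above_def by (metis (mono_tags, lifting) gt_ex le_less_trans mem_Collect_eq)
    define b where "b = max a b0"
    have b: "a \<le> b" "\<And>s. b \<le> s \<Longrightarrow> s \<in> I" "\<And>s. b \<le> s \<Longrightarrow> k s \<noteq> 0"
      using b0 ray by (fastforce simp: b_def)+
    have "\<bar>x s\<bar> \<le> \<bar>x a\<bar> + K' * (b - a)" if "a \<le> s" "s \<le> b" for s
    proof -
      have "K' * (s - a) \<le> K' * (b - a)" using that K'_pos by (intro mult_left_mono) auto
      then show ?thesis using x_step[of a s] that by linarith
    qed
    then have unb': "\<exists>s\<ge>b. R < \<bar>x s\<bar>" for R
      using unb[of "max R (\<bar>x a\<bar> + K' * (b - a))"] by (metis linear max.strict_boundedE not_le)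
    have \<tau>k: "\<tau> s = k s" for s using k_eq[of s] 3 by simp
    from constant_sign[OF b(2,3)] consider "\<forall>s\<ge>b. 0 < k s" | "\<forall>s\<ge>b. k s < 0" by blast
    then show ?thesis
    proof cases
      case 1
      have mono: "x s \<le> x t" if "b \<le> s" "s \<le> t" for s t
        using that(2)
      proof (rule DERIV_nonneg_imp_nondecreasing)
        show "\<exists>d. DERIV x u :> d \<and> 0 \<le> d" if "s \<le> u" "u \<le> t" for u
        proof -
          have "b \<le> u" using that \<open>b \<le> s\<close> by simp
          then show ?thesis using x_deriv[OF b(2)[OF \<open>b \<le> u\<close>]] 1 \<open>b \<le> u\<close> \<tau>k[of u] by (intro exI[of _ "\<tau> u"]) (auto intro: less_imp_le)
        qed
      qed
      show ?thesis
      proof (rule k_tendsto_0I[of 1])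
        fix \<delta> :: real assume "0 < \<delta>"
        then obtain R where R: "\<And>s. a \<le> s \<Longrightarrow> R \<le> x s \<Longrightarrow> \<bar>k s\<bar> < \<delta>" using small_if_x_large by blast
        obtain s where s: "b \<le> s" "max \<bar>x b\<bar> \<bar>R\<bar> < \<bar>x s\<bar>" using unb' by blast
        then have "R \<le> x s" using mono[of b s] by linarith
        then have "\<bar>k t\<bar> < \<delta>" if "s \<le> t" for t using R[of t] mono[of s t] s b(1) that by linarith
        then show "\<exists>b\<ge>a. \<forall>s\<ge>b. \<bar>k s\<bar> < \<delta>" using s b(1) by (intro exI[of _ s]) auto
      qed simp
    next
      case 2
      have mono: "x t \<le> x s" if "b \<le> s" "s \<le> t" for s t
        using that(2)
      proof (rule DERIV_nonpos_imp_nonincreasing)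
        show "\<exists>d. DERIV x u :> d \<and> d \<le> 0" if "s \<le> u" "u \<le> t" for u
        proof -
          have "b \<le> u" using that \<open>b \<le> s\<close> by simp
          then show ?thesis using x_deriv[OF b(2)[OF \<open>b \<le> u\<close>]] 2 \<open>b \<le> u\<close> \<tau>k[of u] by (intro exI[of _ "\<tau> u"]) (auto intro: less_imp_le)
        qed
      qed
      show ?thesis
      proof (rule k_tendsto_0I[of 1])
        fix \<delta> :: real assume "0 < \<delta>"
        then obtain R where R: "\<And>s. a \<le> s \<Longrightarrow> x s \<le> - R \<Longrightarrow> \<bar>k (s + 1)\<bar> < \<delta>"
          using small_after_x_large_negative by blast
        obtain s where s: "b \<le> s" "max \<bar>x b\<bar> \<bar>R\<bar> < \<bar>x s\<bar>" using unb' by blast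
        then have "x s \<le> - R" using mono[of b s] by linarith
        then have "\<bar>k t\<bar> < \<delta>" if "s + 1 \<le> t" for t
          using R[of "t - 1"] mono[of s "t - 1"] s b(1) that by auto
        then show "\<exists>b\<ge>a. \<forall>s\<ge>b. \<bar>k s\<bar> < \<delta>" using s b(1) by (intro exI[of _ "s + 1"]) auto
      qed simp
    qed
  qed
  then show ?thesis ..
qed

end

context coordinate_ode
begin

text \<open>Reversing \<open>s\<close> in the usual way turns \<open>\<tau>\<close> into
  \<open>- \<tau>\<close> and spoils \<open>k = c + \<tau>\<close>; changing the signs of
  \<open>x\<close> and \<open>y\<close> instead keeps the system, its first integral and
  \<open>c\<close>. The end at minus infinity thus needs no analysis of its own.\<close>

lemma mirror: "coordinate_ode (uminus ` I) (\<lambda>s. - x (- s)) (\<lambda>s. \<tau> (- s)) (\<lambda>s. - y (- s)) (\<lambda>s. k (- s)) c q"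
proof
  have "open I" "connected I" "I \<noteq> {}" using I by (auto simp: open_interval_def is_interval_connected_1)
  then show "open_interval (uminus ` I)"
    using open_negations[of I] connected_continuous_image[OF continuous_on_minus[OF continuous_on_id], of I]
    by (auto simp: open_interval_def is_interval_connected_1)
  fix s
  show "k (- s) = c + \<tau> (- s)" by (rule k_eq)
  assume "s \<in> uminus ` I"
  then have s: "- s \<in> I" by auto
  note d = DERIV_mirror[THEN iffD1]
  show "((\<lambda>s. - x (- s)) has_real_derivative \<tau> (- s)) (at s)"
    using DERIV_minus[OF d[OF x_deriv[OF s]]] by simp
  show "((\<lambda>s. \<tau> (- s)) has_real_derivative k (- s) * - x (- s) - - y (- s)) (at s)"
    using d[OF \<tau>_deriv[OF s]] by simp
  show "((\<lambda>s. - y (- s)) has_real_derivative - k (- s) * \<tau> (- s)) (at s)"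
    using DERIV_minus[OF d[OF y_deriv[OF s]]] by simp
  show "2 * - x (- s) * - y (- s) + (\<tau> (- s))\<^sup>2 = q" using invariant[OF s] by simp
  show "k (- s) = 0 \<Longrightarrow> - y (- s) \<noteq> 0" using nondegenerate[OF s] by simp
qed

lemma k_tendsto_at_top:
  assumes "\<And>s. a \<le> s \<Longrightarrow> s \<in> I" "Bfun k at_top"
  shows "(k \<longlongrightarrow> c) at_top \<or> (k \<longlongrightarrow> 0) at_top"
proof -
  obtain K b where K: "\<And>s. b \<le> s \<Longrightarrow> \<bar>k s\<bar> \<le> K"
    using assms(2) unfolding Bfun_def eventually_at_top_linorder by auto
  interpret bounded_end I x \<tau> y k c q "max a b" K
    using assms(1) K by unfold_locales auto
  show ?thesis by (rule k_tendsto)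
qed

lemma k_tendsto_at_bot:
  assumes "\<And>s. s \<le> a \<Longrightarrow> s \<in> I" "Bfun k at_bot"
  shows "(k \<longlongrightarrow> c) at_bot \<or> (k \<longlongrightarrow> 0) at_bot"
proof -
  interpret m: coordinate_ode "uminus ` I" "\<lambda>s. - x (- s)" "\<lambda>s. \<tau> (- s)" "\<lambda>s. - y (- s)" "\<lambda>s. k (- s)" c q
    by (rule mirror)
  have "Bfun (\<lambda>s. k (- s)) at_top"
    using assms(2) unfolding Bfun_def at_bot_mirror eventually_filtermap .
  moreover have "s \<in> uminus ` I" if "- a \<le> s" for s
    using assms(1)[of "- s"] that by (auto simp: image_iff intro: bexI[of _ "- s"])
  ultimately show ?thesis
    using m.k_tendsto_at_top[of "- a"] by (simp add: at_bot_mirror filterlim_filtermap)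
qed

end

subsection \<open>Trivial and nontrivial solutions\<close>

text \<open>\<open>h\<close> counts the removed points to the left. Two points with the same count
  have no removed point between them and lie in one component, and there are at most
  \<open>card Z + 1\<close> counts.\<close>

lemma components_minus_finite:
  fixes I Z :: "real set"
  assumes I: "is_interval I" and Z: "finite Z"
  shows "finite (components (I - Z))" "card (components (I - Z)) \<le> card Z + 1"
proof -
  define S where "S = I - Z"
  define h where "h s = card {z \<in> Z. z < s}" for s
  have comp: "connected_component_set S s = connected_component_set S t"
    if "s \<in> S" "t \<in> S" "h s = h t" "s \<le> t" for s t
  proof -
    have eq: "{z \<in> Z. z < s} = {z \<in> Z. z < t}"
    proof (rule card_subset_eq)
      show "finite {z \<in> Z. z < t}" using Z by simp
      show "{z \<in> Z. z < s} \<subseteq> {z \<in> Z. z < t}" using that(4) by auto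
      show "card {z \<in> Z. z < s} = card {z \<in> Z. z < t}" using that(3) by (simp add: h_def)
    qed
    have "z \<notin> Z" if "s \<le> z" "z \<le> t" for z
    proof
      assume "z \<in> Z"
      with \<open>t \<in> S\<close> have "z \<noteq> t" by (auto simp: S_def)
      with that \<open>z \<in> Z\<close> have "z \<in> {z \<in> Z. z < t}" by simp
      then have "z < s" unfolding eq[symmetric] by simp
      with that(1) show False by simp
    qed
    then have "{s..t} \<inter> Z = {}" by auto
    moreover have "{s..t} \<subseteq> I"
      using that(1,2) I unfolding S_def is_interval_1 by auto
    ultimately have "connected_component S s t"
      using that(4) unfolding S_def connected_component_def by (intro exI[of _ "{s..t}"]) auto
    then show ?thesis by (metis connected_component_eq mem_Collect_eq)
  qed
  define g where "g n = connected_component_set S (inv_into S h n)" for n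
  have "connected_component_set S s = g (h s)" if "s \<in> S" for s
  proof -
    have "inv_into S h (h s) \<in> S" "h (inv_into S h (h s)) = h s"
      using that by (auto intro: inv_into_into f_inv_into_f)
    then show ?thesis
      using comp[OF that, of "inv_into S h (h s)"] comp[OF _ that, of "inv_into S h (h s)"]
      unfolding g_def by (metis linear)
  qed
  then have eq: "components S = g ` h ` S"
    by (auto simp: components_def image_image)
  have "h ` S \<subseteq> {..card Z}"
    using Z by (auto simp: h_def intro: card_mono)
  then have hS: "finite (h ` S)" "card (h ` S) \<le> card Z + 1"
    using card_mono[of "{..card Z}" "h ` S"] finite_subset by auto
  show "finite (components (I - Z))" "card (components (I - Z)) \<le> card Z + 1"
    using hS card_image_le[OF hS(1), of g] eq unfolding S_def by auto
qed

text \<open>The two sets of coordinates belonging to constant curvature: the equilibria, with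
  \<open>k = c\<close>, and the points with \<open>k = 0\<close> and \<open>y = 0\<close>.\<close>

definition degenerate :: "real \<Rightarrow> (real \<times> real \<times> real) set" where
  "degenerate c = {p. fst (snd p) = 0 \<and> snd (snd p) = c * fst p \<or> fst (snd p) = - c \<and> snd (snd p) = 0}"

lemma closed_degenerate: "closed (degenerate c)"
  unfolding degenerate_def
  by (intro closed_Collect_disj closed_Collect_conj closed_Collect_eq continuous_intros)

context
  fixes v :: "real^3" and c :: real and I :: "real set" and X :: "real \<Rightarrow> real^3"
  assumes sol: "solves v c I X"
begin

private definition "x s = mink (X s) v"
private definition "\<tau> s = mink (tangent X s) v"
private definition "y s = mink (associated X s) v"

private lemma I: "open_interval I" "is_interval I" "open I"
  using sol by (auto simp: solves_def arc_length_curve_def spacelike_curve_def open_interval_def)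

private lemma curvature_eq: "s \<in> I \<Longrightarrow> curvature X s = c + \<tau> s"
  using sol by (simp add: solves_def \<tau>_def)

private lemma derivs:
  assumes "s \<in> I"
  shows "(x has_real_derivative \<tau> s) (at s)"
    "(\<tau> has_real_derivative (c + \<tau> s) * x s - y s) (at s)"
    "(y has_real_derivative - (c + \<tau> s) * \<tau> s) (at s)"
proof -
  have d: "(X has_vector_derivative tangent X s) (at s)"
    "(tangent X has_vector_derivative (c + \<tau> s) *\<^sub>R X s - associated X s) (at s)"
    "(associated X has_vector_derivative - (c + \<tau> s) *\<^sub>R tangent X s) (at s)"
    using solves_frame(1)[OF sol] assms unfolding frame_ode_iff \<tau>_def by blast+
  note D = d[THEN has_real_derivative_mink[OF _ has_vector_derivative_const[of v]]]
  show "(x has_real_derivative \<tau> s) (at s)"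
    "(\<tau> has_real_derivative (c + \<tau> s) * x s - y s) (at s)"
    "(y has_real_derivative - (c + \<tau> s) * \<tau> s) (at s)"
    using D unfolding x_def[abs_def] \<tau>_def[abs_def] y_def[abs_def]
    by (simp_all add: mink_simps del: minus_add_distrib)
qed

private lemma cont: "continuous_on I x" "continuous_on I \<tau>"
  using derivs DERIV_isCont by (blast intro: continuous_at_imp_continuous_on)+

text \<open>The pair \<open>k\<close>, \<open>y\<close> satisfies a linear homogeneous system with
  coefficients built from \<open>x\<close> and \<open>\<tau>\<close>, so a common zero
  persists.\<close>

lemma zero_curvature_solution:
  assumes "a \<in> I" "curvature X a = 0" "mink (associated X a) v = 0" "s \<in> I"
  shows "curvature X s = 0"
proof -
  have "(c + \<tau> s, y s) = 0"
  proof (rule gronwall_zero[OF I(2) assms(1,4)])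
    show "continuous_on I (\<lambda>s. \<bar>x s\<bar> + \<bar>\<tau> s\<bar> + 1)" by (intro continuous_intros cont)
    show "((\<lambda>s. (c + \<tau> s, y s)) has_vector_derivative ((c + \<tau> s) * x s - y s, - (c + \<tau> s) * \<tau> s)) (at s)"
      if "s \<in> I" for s
      using derivs[OF that] unfolding has_real_derivative_iff_has_vector_derivative
      by (intro has_vector_derivative_Pair) (auto intro!: derivative_eq_intros)
    show "norm ((c + \<tau> s) * x s - y s, - (c + \<tau> s) * \<tau> s) \<le> (\<bar>x s\<bar> + \<bar>\<tau> s\<bar> + 1) * norm (c + \<tau> s, y s)" for s
    proof -
      define n where "n = norm (c + \<tau> s, y s)"
      have n: "\<bar>c + \<tau> s\<bar> \<le> n" "\<bar>y s\<bar> \<le> n"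
        using norm_fst_le[of "c + \<tau> s" "y s"] norm_snd_le[of "y s" "c + \<tau> s"] by (auto simp: n_def)
      have "norm ((c + \<tau> s) * x s - y s, - (c + \<tau> s) * \<tau> s) \<le> \<bar>(c + \<tau> s) * x s - y s\<bar> + \<bar>- (c + \<tau> s) * \<tau> s\<bar>"
        using norm_Pair_le[of "(c + \<tau> s) * x s - y s" "- (c + \<tau> s) * \<tau> s"] by simp
      also have "\<dots> \<le> (\<bar>c + \<tau> s\<bar> * \<bar>x s\<bar> + \<bar>y s\<bar>) + \<bar>c + \<tau> s\<bar> * \<bar>\<tau> s\<bar>"
        using abs_triangle_ineq4[of "(c + \<tau> s) * x s" "y s"] by (simp add: abs_mult del: minus_add_distrib)
      also have "\<dots> \<le> (n * \<bar>x s\<bar> + n) + n * \<bar>\<tau> s\<bar>"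
        using n by (intro add_mono mult_right_mono) auto
      finally show ?thesis by (simp add: n_def[symmetric] algebra_simps)
    qed
    show "(c + \<tau> a, y a) = 0"
      using assms curvature_eq by (simp add: y_def zero_prod_def)
  qed
  then show ?thesis using curvature_eq[OF assms(4)] by (simp add: zero_prod_def)
qed

text \<open>The same principle for the pair \<open>\<tau>\<close>, \<open>y - c x\<close>, whose
  vanishing describes the equilibria.\<close>

lemma equilibrium_solution:
  assumes "a \<in> I" "mink (tangent X a) v = 0" "mink (associated X a) v = c * mink (X a) v" "s \<in> I"
  shows "curvature X s = c"
proof -
  have "(\<tau> s, y s - c * x s) = 0"
  proof (rule gronwall_zero[OF I(2) assms(1,4)])
    show "continuous_on I (\<lambda>s. \<bar>x s\<bar> + \<bar>2 * c + \<tau> s\<bar> + 1)" by (intro continuous_intros cont)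
    show "((\<lambda>s. (\<tau> s, y s - c * x s)) has_vector_derivative
        (\<tau> s * x s - (y s - c * x s), - (2 * c + \<tau> s) * \<tau> s)) (at s)"
      if "s \<in> I" for s
    proof (rule has_vector_derivative_Pair)
      show "(\<tau> has_vector_derivative \<tau> s * x s - (y s - c * x s)) (at s)"
        using derivs(2)[OF that] by (simp add: has_real_derivative_iff_has_vector_derivative algebra_simps)
      show "((\<lambda>s. y s - c * x s) has_vector_derivative - (2 * c + \<tau> s) * \<tau> s) (at s)"
        using derivs(1,3)[OF that] unfolding has_real_derivative_iff_has_vector_derivative[symmetric]
        by (auto intro!: derivative_eq_intros simp: algebra_simps)
    qed
    show "norm (\<tau> s * x s - (y s - c * x s), - (2 * c + \<tau> s) * \<tau> s) \<le>
        (\<bar>x s\<bar> + \<bar>2 * c + \<tau> s\<bar> + 1) * norm (\<tau> s, y s - c * x s)" for s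
    proof -
      define w where "w = y s - c * x s"
      define n where "n = norm (\<tau> s, w)"
      have n: "\<bar>\<tau> s\<bar> \<le> n" "\<bar>w\<bar> \<le> n"
        using norm_fst_le[of "\<tau> s" w] norm_snd_le[of w "\<tau> s"] by (auto simp: n_def)
      have "norm (\<tau> s * x s - w, - (2 * c + \<tau> s) * \<tau> s) \<le> \<bar>\<tau> s * x s - w\<bar> + \<bar>- (2 * c + \<tau> s) * \<tau> s\<bar>"
        using norm_Pair_le[of "\<tau> s * x s - w" "- (2 * c + \<tau> s) * \<tau> s"] by simp
      also have "\<dots> \<le> (\<bar>\<tau> s\<bar> * \<bar>x s\<bar> + \<bar>w\<bar>) + \<bar>\<tau> s\<bar> * \<bar>2 * c + \<tau> s\<bar>"
        using abs_triangle_ineq4[of "\<tau> s * x s" w] by (simp add: abs_mult mult.commute del: minus_add_distrib)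
      also have "\<dots> \<le> (n * \<bar>x s\<bar> + n) + n * \<bar>2 * c + \<tau> s\<bar>"
        using n by (intro add_mono mult_right_mono) auto
      finally show ?thesis by (simp add: n_def[symmetric] w_def[symmetric] algebra_simps)
    qed
    show "(\<tau> a, y a - c * x a) = 0"
      using assms by (simp add: y_def x_def \<tau>_def zero_prod_def)
  qed
  then show ?thesis using curvature_eq[OF assms(4)] by (simp add: zero_prod_def)
qed

text \<open>For constant \<open>k = \<kappa>\<close>, \<open>\<tau>' = 0\<close> gives
  \<open>y = \<kappa> x\<close>, and differentiating that gives \<open>\<kappa> \<tau> = 0\<close>:
  the two factors are the two branches of \<open>degenerate\<close>.\<close>

lemma trivial_curve_iff:
  assumes "a \<in> I"
  shows "trivial_curve I X \<longleftrightarrow> (mink (X a) v, mink (tangent X a) v, mink (associated X a) v) \<in> degenerate c"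
proof
  assume "trivial_curve I X"
  then obtain \<kappa> where \<kappa>: "\<And>s. s \<in> I \<Longrightarrow> c + \<tau> s = \<kappa>"
    using curvature_eq by (auto simp: trivial_curve_def)
  have const: "D = 0" if "s \<in> I" "(f has_real_derivative D) (at s)" "\<And>s. s \<in> I \<Longrightarrow> f s = b" for f s D b
  proof -
    have "((\<lambda>_. b) has_real_derivative D) (at s)"
      by (rule has_field_derivative_transform_within_open[OF that(2) I(3) that(1)]) (rule that(3))
    then show ?thesis using DERIV_unique DERIV_const by blast
  qed
  have y: "y s = \<kappa> * x s" if "s \<in> I" for s
  proof -
    have "\<tau> s = \<kappa> - c" if "s \<in> I" for s using \<kappa>[OF that] by simp
    from const[OF that derivs(2)[OF that] this] show ?thesis by (simp add: \<kappa>[OF that])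
  qed
  have "((\<lambda>s. y s - \<kappa> * x s) has_real_derivative - (c + \<tau> a) * \<tau> a - \<kappa> * \<tau> a) (at a)"
    using derivs[OF assms] by (auto intro!: derivative_eq_intros)
  from const[OF assms this, of 0] have "\<kappa> * \<tau> a = 0" using y \<kappa>[OF assms] by simp
  then show "(mink (X a) v, mink (tangent X a) v, mink (associated X a) v) \<in> degenerate c"
    using y[OF assms] \<kappa>[OF assms] by (auto simp: degenerate_def x_def y_def \<tau>_def)
next
  assume "(mink (X a) v, mink (tangent X a) v, mink (associated X a) v) \<in> degenerate c"
  then show "trivial_curve I X"
    using zero_curvature_solution[OF assms] equilibrium_solution[OF assms] curvature_eq[OF assms]
    unfolding trivial_curve_def degenerate_def \<tau>_def by auto
qed

lemma solution_coordinate_ode: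
  assumes "\<not> trivial_curve I X"
  shows "coordinate_ode I (\<lambda>s. mink (X s) v) (\<lambda>s. mink (tangent X s) v) (\<lambda>s. mink (associated X s) v)
    (\<lambda>s. c + mink (tangent X s) v) c (mink v v)"
proof
  fix s assume s: "s \<in> I"
  show "((\<lambda>s. mink (X s) v) has_real_derivative mink (tangent X s) v) (at s)"
    "((\<lambda>s. mink (tangent X s) v) has_real_derivative
      (c + mink (tangent X s) v) * mink (X s) v - mink (associated X s) v) (at s)"
    "((\<lambda>s. mink (associated X s) v) has_real_derivative - (c + mink (tangent X s) v) * mink (tangent X s) v) (at s)"
    using derivs[OF s] unfolding x_def[abs_def] \<tau>_def[abs_def] y_def[abs_def] by blast+
  show "2 * mink (X s) v * mink (associated X s) v + (mink (tangent X s) v)\<^sup>2 = mink v v"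
    by (rule null_frame_invariant[OF solves_frame(2)[OF sol s]])
  show "mink (associated X s) v \<noteq> 0" if "c + mink (tangent X s) v = 0"
    using zero_curvature_solution[OF s] curvature_eq[OF s] that assms
    by (auto simp: trivial_curve_def \<tau>_def)
qed (use I in auto)

text \<open>The difference \<open>w\<close> of two admissible vectors is orthogonal to every
  \<open>T\<close>; its products with \<open>X\<close> and \<open>Y\<close> are then constants
  \<open>p\<close> and \<open>r\<close> with \<open>k p = r\<close>, so a non-constant
  \<open>k\<close> leaves only 0. This is what separates the causal classes.\<close>

lemma nontrivial_determines_vector:
  assumes sol': "solves v' c I X" and nontrivial: "\<not> trivial_curve I X"
  shows "v = v'"
proof -
  define w where "w = v - v'"
  obtain a where a: "a \<in> I" using I(1) by (auto simp: open_interval_def)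
  have Tw: "mink (tangent X s) w = 0" if "s \<in> I" for s
    using sol sol' that by (simp add: solves_def w_def mink_simps)
  have d: "(X has_vector_derivative tangent X s) (at s)"
    "(tangent X has_vector_derivative curvature X s *\<^sub>R X s - associated X s) (at s)"
    "(associated X has_vector_derivative - curvature X s *\<^sub>R tangent X s) (at s)" if "s \<in> I" for s
    using solves_frame(1)[OF sol] that curvature_eq[OF that] unfolding frame_ode_iff \<tau>_def by (simp_all del: minus_add_distrib)
  note D = d[THEN has_real_derivative_mink[OF _ has_vector_derivative_const[of w]]]
  have const: "\<exists>b. \<forall>s\<in>I. f s = b" if "\<And>s. s \<in> I \<Longrightarrow> (f has_real_derivative 0) (at s)" for f
    using has_field_derivative_zero_constant[of I f] I(2) that
    by (metis has_field_derivative_at_within is_interval_convex)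
  obtain p where p: "\<And>s. s \<in> I \<Longrightarrow> mink (X s) w = p"
    using const[of "\<lambda>s. mink (X s) w"] D(1) Tw by (auto simp: mink_simps)
  obtain r where r: "\<And>s. s \<in> I \<Longrightarrow> mink (associated X s) w = r"
    using const[of "\<lambda>s. mink (associated X s) w"] D(3) Tw by (auto simp: mink_simps)
  have k: "curvature X s * p = r" if "s \<in> I" for s
  proof -
    have "((\<lambda>_. 0) has_real_derivative curvature X s * p - r) (at s)"
      by (rule has_field_derivative_transform_within_open[OF D(2)[OF that, THEN DERIV_cong] I(3) that])
        (use Tw p r that in \<open>auto simp: mink_simps\<close>)
    then show ?thesis using DERIV_unique[OF _ DERIV_const] by fastforce
  qed
  have "p = 0"
  proof (rule ccontr)
    assume "p \<noteq> 0"
    then have "curvature X s = r / p" if "s \<in> I" for s using k[OF that] by (simp add: field_simps)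
    with nontrivial show False by (auto simp: trivial_curve_def)
  qed
  then have "r = 0" using k[OF a] by simp
  have "w = 0"
    using null_frame_expand[OF solves_frame(2)[OF sol a], of w] p[OF a] r[OF a] Tw[OF a] \<open>p = 0\<close> \<open>r = 0\<close>
    by (simp add: mink_commute[of w])
  then show ?thesis by (simp add: w_def)
qed

end

text \<open>With bounded \<open>k\<close> the frame equation is linear with bounded coefficients, so
  by Gronwall the frame stays bounded up to \<open>e\<close> and the solution continues beyond,
  against maximality.\<close>

lemma finite_end_unbounded:
  assumes max: "maximal_solution v c \<alpha> \<omega> X" and e: "ereal e = \<alpha> \<or> ereal e = \<omega>"
    and a: "a \<in> einterval \<alpha> \<omega>"
    and K: "\<And>s. s \<in> closed_segment a e - {e} \<Longrightarrow> \<bar>curvature X s\<bar> \<le> K"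
  shows False
proof -
  define I where "I = einterval \<alpha> \<omega>"
  define z where "z s = (X s, tangent X s, associated X s)" for s
  have sol: "solves v c I X" using max by (simp add: maximal_solution_def I_def)
  note ode = solves_frame(1)[OF sol, folded z_def]
  have "0 \<in> I" using max by (auto simp: maximal_solution_def I_def einterval_def zero_ereal_def)
  have e_notin: "e \<notin> I" using e by (auto simp: I_def einterval_def)
  have sub: "closed_segment a e - {e} \<subseteq> I"
  proof
    fix s assume "s \<in> closed_segment a e - {e}"
    then have s: "a \<le> s \<and> s < e \<or> e < s \<and> s \<le> a"
      by (auto simp: closed_segment_eq_real_ivl split: if_splits)
    have "\<alpha> < ereal a" "ereal a < \<omega>" using a by (auto simp: einterval_def)
    moreover have "\<alpha> \<le> ereal e" "ereal e \<le> \<omega>"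
      using e calculation less_trans[of \<alpha> "ereal a" \<omega>] by (auto intro: less_imp_le)
    ultimately show "s \<in> I"
      using s le_less_trans[of \<alpha> "ereal e" "ereal s"] less_le_trans[of "ereal s" "ereal e" \<omega>]
        le_less_trans[of "ereal s" "ereal a" \<omega>] less_le_trans[of \<alpha> "ereal a" "ereal s"]
      by (auto simp: I_def einterval_def)
  qed
  have K0: "0 \<le> K" using K[of a] a e_notin by (force simp: I_def)
  \<comment> \<open>Growth rate of the frame equation under \<open>\<bar>k\<bar> \<le> K\<close>:
    two terms without \<open>k\<close> and two products with it.\<close>
  define L where "L = 2 + 2 * K"
  have bd: "norm (z s) \<le> exp (L * \<bar>e - a\<bar>) * norm (z a)" if s: "s \<in> closed_segment a e - {e}" for s
  proof -
    have seg: "closed_segment a s \<subseteq> closed_segment a e - {e}"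
      using s by (auto simp: closed_segment_eq_real_ivl split: if_splits)
    have "norm (z s) \<le> exp (L * \<bar>s - a\<bar>) * norm (z a)"
    proof (rule gronwall)
      fix u assume "u \<in> closed_segment a s"
      then have u: "u \<in> I" "\<bar>curvature X u\<bar> \<le> K" using seg sub K by blast+
      show "(z has_vector_derivative frame_field v c (z u)) (at u)"
        using ode u(1) by (simp add: ode_solution_def)
      have k: "c + mink (tangent X u) v = curvature X u" using sol u(1) by (simp add: solves_def)
      have n: "norm (X u) \<le> norm (z u)" "norm (tangent X u) \<le> norm (z u)" "norm (associated X u) \<le> norm (z u)"
        unfolding z_def
        using norm_fst_le[of "X u" "(tangent X u, associated X u)"] norm_snd_le[of "(tangent X u, associated X u)" "X u"]
          norm_fst_le[of "tangent X u" "associated X u"] norm_snd_le[of "associated X u" "tangent X u"]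
        by linarith+
      have "frame_field v c (z u) = (tangent X u, curvature X u *\<^sub>R X u - associated X u, - (curvature X u *\<^sub>R tangent X u))"
        by (simp add: frame_field_def z_def k[symmetric] del: minus_add_distrib)
      also have "norm \<dots> \<le> norm (tangent X u) + ((norm (curvature X u *\<^sub>R X u) + norm (associated X u))
          + norm (curvature X u *\<^sub>R tangent X u))"
        using norm_Pair_le[of "tangent X u" "(curvature X u *\<^sub>R X u - associated X u, - (curvature X u *\<^sub>R tangent X u))"]
          norm_Pair_le[of "curvature X u *\<^sub>R X u - associated X u" "- (curvature X u *\<^sub>R tangent X u)"]
          norm_triangle_ineq4[of "curvature X u *\<^sub>R X u" "associated X u"] by simp
      also have "\<dots> \<le> norm (z u) + ((K * norm (z u) + norm (z u)) + K * norm (z u))"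
        unfolding norm_scaleR using n u(2) K0 by (intro add_mono mult_mono) auto
      finally show "norm (frame_field v c (z u)) \<le> L * norm (z u)"
        by (simp add: L_def algebra_simps)
    qed
    also have "\<dots> \<le> exp (L * \<bar>e - a\<bar>) * norm (z a)"
      using s K0 by (intro mult_right_mono)
        (auto simp: L_def closed_segment_eq_real_ivl split: if_splits intro!: mult_left_mono)
    finally show ?thesis .
  qed
  have "a \<noteq> e" using a e_notin by (auto simp: I_def)
  obtain I' z' where I': "ode_solution (frame_field v c) I' z'" "insert e I \<subseteq> I'" "\<And>s. s \<in> I \<Longrightarrow> z' s = z s"
    using frame.bounded_solution_extends[OF ode sub \<open>a \<noteq> e\<close> bd] by blast
  have "e \<in> frame.domain v c (z' 0)"
    using frame.flow_eq(1)[OF I'(1)] I'(2) \<open>0 \<in> I\<close> by blast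
  moreover have "z' 0 = (X 0, tangent X 0, associated X 0)" using I'(3)[OF \<open>0 \<in> I\<close>] by (simp add: z_def)
  ultimately show False
    using maximal_solution_flow(1)[OF max] e_notin by (simp add: I_def)
qed

text \<open>At a finite end the curvature is always unbounded; the limits \<open>c\<close> and 0
  arise at infinite ends, where the filters on \<open>ereal\<close> reduce to \<open>at_top\<close>
  and \<open>at_bot\<close>.\<close>

lemma end_behaviours:
  assumes "nontrivial_solution v c \<alpha> \<omega> X"
  shows "end_behaviour c (curvature X) (at_left \<omega>)" "end_behaviour c (curvature X) (at_right \<alpha>)"
proof -
  have max: "maximal_solution v c \<alpha> \<omega> X" and nt: "\<not> trivial_curve (einterval \<alpha> \<omega>) X"
    using assms by (auto simp: nontrivial_solution_def)
  have sol: "solves v c (einterval \<alpha> \<omega>) X" and ends: "\<alpha> < 0" "0 < \<omega>"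
    using max by (auto simp: maximal_solution_def)
  define k where "k s = c + mink (tangent X s) v" for s
  interpret coordinate_ode "einterval \<alpha> \<omega>" "\<lambda>s. mink (X s) v" "\<lambda>s. mink (tangent X s) v"
    "\<lambda>s. mink (associated X s) v" k c "mink v v"
    unfolding k_def using solution_coordinate_ode[OF sol nt] .
  have k: "k s = curvature X s" if "s \<in> einterval \<alpha> \<omega>" for s
    using sol that by (simp add: solves_def k_def)
  have Bfun_real: "Bfun (f \<circ> real_of_ereal) (filtermap ereal F) \<longleftrightarrow> Bfun f F" for f :: "real \<Rightarrow> real" and F
    by (simp add: Bfun_def eventually_filtermap)
  show "end_behaviour c (curvature X) (at_left \<omega>)"
  proof (cases \<omega>)
    case (real r)
    have r: "0 < r" using ends real by simp
    have "\<not> Bfun (curvature X) (at_left r)"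
    proof
      assume "Bfun (curvature X) (at_left r)"
      then obtain K b where K: "b < r" "\<And>s. b < s \<Longrightarrow> s < r \<Longrightarrow> \<bar>curvature X s\<bar> \<le> K"
        unfolding Bfun_def eventually_at_left_field by auto
      obtain a where a: "max b 0 < a" "a < r" using dense[of "max b 0" r] K(1) r by auto
      show False
      proof (rule finite_end_unbounded[OF max, of r a K])
        show "ereal r = \<alpha> \<or> ereal r = \<omega>" using real by simp
        have "ereal 0 < ereal a" "ereal a < ereal r" using a by simp_all
        then show "a \<in> einterval \<alpha> \<omega>"
          using less_trans[OF ends(1)[unfolded zero_ereal_def]] real by (simp add: einterval_def)
        show "\<bar>curvature X s\<bar> \<le> K" if "s \<in> closed_segment a r - {r}" for s
          using that a by (intro K(2)) (auto simp: closed_segment_eq_real_ivl)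
      qed
    qed
    then show ?thesis by (simp add: end_behaviour_def real at_left_ereal Bfun_real)
  next
    case PInf
    have ray: "s \<in> einterval \<alpha> \<omega>" if "0 \<le> s" for s
      using that ends(1) PInf by (auto simp: einterval_def intro: less_le_trans)
    have ev: "\<forall>\<^sub>F s in at_top. k s = curvature X s"
      using eventually_ge_at_top[of 0] by eventually_elim (use ray k in auto)
    have "(curvature X \<longlongrightarrow> c) at_top \<or> (curvature X \<longlongrightarrow> 0) at_top" if bf: "Bfun (curvature X) at_top"
    proof -
      obtain K where "K > 0" and K: "\<forall>\<^sub>F s in at_top. norm (curvature X s) \<le> K"
        using bf unfolding Bfun_def by blast
      from K ev have "\<forall>\<^sub>F s in at_top. norm (k s) \<le> K"
        by eventually_elim simp
      with \<open>K > 0\<close> have "Bfun k at_top" unfolding Bfun_def by blast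
      from k_tendsto_at_top[OF ray this] show ?thesis
        using filterlim_cong[OF refl refl ev] by auto
    qed
    then show ?thesis by (auto simp: end_behaviour_def PInf at_left_PInf Bfun_real filterlim_filtermap)
  qed (use ends in auto)
  show "end_behaviour c (curvature X) (at_right \<alpha>)"
  proof (cases \<alpha>)
    case (real r)
    have r: "r < 0" using ends real by simp
    have "\<not> Bfun (curvature X) (at_right r)"
    proof
      assume "Bfun (curvature X) (at_right r)"
      then obtain K b where K: "r < b" "\<And>s. r < s \<Longrightarrow> s < b \<Longrightarrow> \<bar>curvature X s\<bar> \<le> K"
        unfolding Bfun_def eventually_at_right_field by auto
      obtain a where a: "r < a" "a < min b 0" using dense[of r "min b 0"] K(1) r by auto
      show False
      proof (rule finite_end_unbounded[OF max, of r a K])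
        show "ereal r = \<alpha> \<or> ereal r = \<omega>" using real by simp
        have "ereal a < ereal 0" "ereal r < ereal a" using a by simp_all
        then show "a \<in> einterval \<alpha> \<omega>"
          using less_trans[OF _ ends(2)[unfolded zero_ereal_def]] real by (simp add: einterval_def)
        show "\<bar>curvature X s\<bar> \<le> K" if "s \<in> closed_segment a r - {r}" for s
          using that a by (intro K(2)) (auto simp: closed_segment_eq_real_ivl)
      qed
    qed
    then show ?thesis by (simp add: end_behaviour_def real at_right_ereal Bfun_real)
  next
    case MInf
    have ray: "s \<in> einterval \<alpha> \<omega>" if "s \<le> 0" for s
      using that le_less_trans[of "ereal s" "ereal 0" \<omega>] ends(2) MInf by (auto simp: einterval_def zero_ereal_def)
    have ev: "\<forall>\<^sub>F s in at_bot. k s = curvature X s"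
      using eventually_le_at_bot[of 0] by eventually_elim (use ray k in auto)
    have "(curvature X \<longlongrightarrow> c) at_bot \<or> (curvature X \<longlongrightarrow> 0) at_bot" if bf: "Bfun (curvature X) at_bot"
    proof -
      obtain K where "K > 0" and K: "\<forall>\<^sub>F s in at_bot. norm (curvature X s) \<le> K"
        using bf unfolding Bfun_def by blast
      from K ev have "\<forall>\<^sub>F s in at_bot. norm (k s) \<le> K"
        by eventually_elim simp
      with \<open>K > 0\<close> have "Bfun k at_bot" unfolding Bfun_def by blast
      from k_tendsto_at_bot[OF ray this] show ?thesis
        using filterlim_cong[OF refl refl ev] by auto
    qed
    then show ?thesis by (auto simp: end_behaviour_def MInf at_right_MInf Bfun_real filterlim_filtermap)
  qed (use ends in auto)
qed

subsection \<open>The surface of initial values\<close>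

lemma causal_first_component:
  assumes "u \<noteq> 0" "mink u u \<le> 0"
  shows "u$1 \<noteq> 0"
  using mink_causal_timelike[of "vector [1, 0, 0]" u] assms by (auto simp: mink_def)

lemma initial_values_in_surface:
  assumes "v \<noteq> 0" "null_frame X T Y"
  shows "(mink X v, mink T v, mink Y v) \<in> initial_surface v"
proof -
  have "(mink Y v - mink X v) * v$1 > 0" if "\<not> spacelike v"
  proof -
    have "mink v (X - Y) * (v$1 * (X - Y)$1) < 0"
      using that assms(1) by (intro mink_causal_timelike null_frame_timelike[OF assms(2)]) (auto simp: spacelike_def)
    then have "mink v (X - Y) * v$1 < 0"
      using null_frame_timelike(2)[OF assms(2)] by (simp add: mult.assoc[symmetric] mult_less_0_iff)
    then show ?thesis by (simp add: mink_simps mink_commute[of v] algebra_simps)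
  qed
  then show ?thesis
    using null_frame_invariant[OF assms(2), of v] by (simp add: initial_surface_def)
qed

text \<open>Direct construction: a null \<open>X\<close> with the prescribed product with
  \<open>v\<close>, then a unit \<open>T\<close>, where adding a multiple of \<open>X\<close>
  adjusts \<langle>T, v\<rangle> because \<open>x \<noteq> 0\<close>; the first integral leaves no
  choice for \<langle>Y, v\<rangle>.\<close>

lemma frame_with_coordinates_aux:
  assumes p: "(x, \<tau>, y) \<in> initial_surface v" and "x \<noteq> 0"
  shows "\<exists>X T Y. null_frame X T Y \<and> mink X v = x \<and> mink T v = \<tau> \<and> mink Y v = y"
proof -
  have eq: "2 * x * y + \<tau>\<^sup>2 = mink v v" and sgn: "\<not> spacelike v \<Longrightarrow> (y - x) * v$1 > 0"
    using p by (auto simp: initial_surface_def)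
  define \<rho> where "\<rho> = sqrt ((v$2)\<^sup>2 + (v$3)\<^sup>2)"
  have \<rho>: "\<rho> \<ge> 0" "\<rho>\<^sup>2 = (v$2)\<^sup>2 + (v$3)\<^sup>2" by (simp_all add: \<rho>_def)
  have vv: "mink v v = \<rho>\<^sup>2 - (v$1)\<^sup>2" unfolding \<rho>(2) by (simp add: mink_def power2_eq_square)
  have sp: "\<bar>v$1\<bar> < \<rho>" if "spacelike v"
    using that \<rho>(1) vv by (simp add: spacelike_def) (metis abs_of_nonneg abs_le_square_iff not_le)
  have nsp: "x * y \<le> 0" if "\<not> spacelike v"
  proof -
    have "2 * (x * y) + \<tau>\<^sup>2 = mink v v" using eq by simp
    then show ?thesis using that zero_le_power2[of \<tau>] unfolding spacelike_def by linarith
  qed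
  obtain a b where ab: "a\<^sup>2 + b\<^sup>2 = 1" "a * v$2 + b * v$3 = \<rho>"
  proof (cases "\<rho> = 0")
    case True
    then have "v$2 = 0" "v$3 = 0" using \<rho>(2) by (auto simp: sum_power2_eq_zero_iff)
    with True show ?thesis by (intro that[of 1 0]) auto
  next
    case False
    show ?thesis
    proof (rule that[of "v$2 / \<rho>" "v$3 / \<rho>"])
      show "(v$2 / \<rho>)\<^sup>2 + (v$3 / \<rho>)\<^sup>2 = 1"
        using False by (simp add: power_divide add_divide_distrib[symmetric] \<rho>(2)[symmetric])
      show "v$2 / \<rho> * v$2 + v$3 / \<rho> * v$3 = \<rho>"
      proof -
        have "v$2 / \<rho> * v$2 + v$3 / \<rho> * v$3 = \<rho>\<^sup>2 / \<rho>"
          unfolding \<rho>(2) by (simp add: add_divide_distrib power2_eq_square)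
        then show ?thesis using False by (simp add: power2_eq_square)
      qed
    qed
  qed
  \<comment> \<open>The null direction is aligned with the spatial part of \<open>v\<close> or
    opposite to it, so that its product with \<open>v\<close> has the sign of \<open>x\<close>;
    \<open>l\<close> is the remaining scale. For non-spacelike \<open>v\<close> the sign condition
    of \<open>initial_surface\<close> guarantees that sign.\<close>
  obtain l a' b' where l: "l > 0" "a'\<^sup>2 + b'\<^sup>2 = 1" "l * (- v$1 + a' * v$2 + b' * v$3) = x"
  proof (cases "x > 0")
    case True
    have "v$1 < \<rho>"
    proof (cases "spacelike v")
      case False
      then have "y \<le> 0" using nsp True by (simp add: mult_le_0_iff)
      then have "v$1 < 0" using sgn[OF False] True by (simp add: zero_less_mult_iff)
      then show ?thesis using \<rho>(1) by simp
    qed (use sp in auto)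
    have "- v$1 + a * v$2 + b * v$3 = \<rho> - v$1" using ab(2) by simp
    then have "x / (\<rho> - v$1) * (- v$1 + a * v$2 + b * v$3) = x"
      using \<open>v$1 < \<rho>\<close> by (simp only:) simp
    with True ab(1) \<open>v$1 < \<rho>\<close> show ?thesis by (intro that[of "x / (\<rho> - v$1)" a b]) auto
  next
    case False
    with assms(2) have x: "x < 0" by simp
    have "0 < \<rho> + v$1"
    proof (cases "spacelike v")
      case False
      then have "y \<ge> 0" using nsp x by (simp add: mult_le_0_iff)
      then have "v$1 > 0" using sgn[OF False] x by (simp add: zero_less_mult_iff)
      then show ?thesis using \<rho>(1) by simp
    qed (use sp in auto)
    have "- v$1 + - a * v$2 + - b * v$3 = - (\<rho> + v$1)" using ab(2) by simp
    then have "- x / (\<rho> + v$1) * (- v$1 + - a * v$2 + - b * v$3) = x"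
    proof -
      have "- x / w * - w = x" if "0 < w" for w using that by simp
      then show ?thesis using \<open>_ = - (\<rho> + v$1)\<close> \<open>0 < \<rho> + v$1\<close> by metis
    qed
    with x ab(1) \<open>0 < \<rho> + v$1\<close> show ?thesis by (intro that[of "- x / (\<rho> + v$1)" "- a" "- b"]) (auto simp: divide_neg_pos)
  qed
  define X :: "real^3" where "X = vector [l, l * a', l * b']"
  define T0 :: "real^3" where "T0 = vector [0, - b', a']"
  define T where "T = T0 + ((\<tau> - mink T0 v) / x) *\<^sub>R X"
  have XX: "mink X X = 0"
  proof -
    have "mink X X = l\<^sup>2 * (a'\<^sup>2 + b'\<^sup>2 - 1)"
      by (simp add: X_def mink_def power2_eq_square algebra_simps)
    then show ?thesis using l(2) by simp
  qed
  have "X$1 > 0" using l(1) by (simp add: X_def)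
  then have "X \<in> future_cone" using XX by (auto simp: future_cone_def light_cone_def)
  have XT0: "mink X T0 = 0" "mink T0 T0 = 1"
    using l(2) by (simp_all add: X_def T0_def mink_def power2_eq_square add.commute)
  have Xv: "mink X v = x" using l(3) by (simp add: X_def mink_def algebra_simps)
  have "mink X T = 0" "mink T T = 1"
    by (simp_all add: T_def mink_simps XX XT0 mink_commute[of T0 X])
  then obtain Y where Y: "null_frame X T Y"
    using null_frame_exists[OF \<open>X \<in> future_cone\<close>] by blast
  have Tv: "mink T v = \<tau>" using assms(2) by (simp add: T_def mink_simps Xv)
  have "2 * x * mink Y v = 2 * x * y"
    using null_frame_invariant[OF Y, of v] eq unfolding Xv Tv by linarith
  then have "mink Y v = y" using assms(2) by simp
  with Y Xv Tv show ?thesis by blast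
qed

text \<open>Exchanging the null directions reduces \<open>y \<noteq> 0\<close> to the case
  \<open>x \<noteq> 0\<close>; if both vanish, \<open>v\<close> has to be a multiple of
  \<open>T\<close>.\<close>

lemma frame_with_coordinates:
  assumes p: "(x, \<tau>, y) \<in> initial_surface v"
  shows "\<exists>X T Y. null_frame X T Y \<and> mink X v = x \<and> mink T v = \<tau> \<and> mink Y v = y"
proof -
  consider "x \<noteq> 0" | "y \<noteq> 0" | "x = 0" "y = 0" by blast
  then show ?thesis
  proof cases
    case 1
    with p show ?thesis by (rule frame_with_coordinates_aux)
  next
    case 2
    have "(- y, \<tau>, - x) \<in> initial_surface v" using p by (simp add: initial_surface_def algebra_simps)
    then obtain X T Y where f: "null_frame X T Y" "mink X v = - y" "mink T v = \<tau>" "mink Y v = - x"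
      using frame_with_coordinates_aux[of "- y" \<tau> "- x" v] 2 by auto
    show ?thesis
      using null_frame_flip[OF f(1)] f(2-4) by (intro exI[of _ "- Y"] exI[of _ T] exI[of _ "- X"]) (simp add: mink_simps)
  next
    case 3
    define s where "s = sqrt (mink v v)"
    \<comment> \<open>A null vector orthogonal to the spacelike \<open>v\<close>: the first
      coordinate is set to the squared length of the spatial part of \<open>v\<close>, orthogonality
      then fixes the component along that part, and nullity the factor \<open>s\<close> of the
      perpendicular one.\<close>
    define X :: "real^3" where
      "X = vector [(v$2)\<^sup>2 + (v$3)\<^sup>2, v$1 * v$2 - s * v$3, v$1 * v$3 + s * v$2]"
    have "mink v v > 0" "\<tau>\<^sup>2 = mink v v" using p 3 by (auto simp: initial_surface_def spacelike_def)
    then have s: "s\<^sup>2 = mink v v" and "\<tau> \<noteq> 0" by (auto simp: s_def)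
    have "mink X v = 0" by (simp add: X_def mink_def power2_eq_square algebra_simps)
    moreover have "mink X X = ((v$2)\<^sup>2 + (v$3)\<^sup>2) * (s\<^sup>2 - mink v v)"
      by (simp add: X_def mink_def power2_eq_square algebra_simps)
    then have "mink X X = 0" using s by simp
    moreover have "X$1 > 0"
    proof -
      have "(v$2)\<^sup>2 + (v$3)\<^sup>2 = mink v v + (v$1)\<^sup>2" by (simp add: mink_def power2_eq_square)
      then show ?thesis using \<open>mink v v > 0\<close> by (simp add: X_def add_pos_nonneg)
    qed
    ultimately have X: "X \<in> future_cone" "mink X ((1 / \<tau>) *\<^sub>R v) = 0"
      by (auto simp: future_cone_def light_cone_def mink_simps)
    have "mink ((1 / \<tau>) *\<^sub>R v) ((1 / \<tau>) *\<^sub>R v) = 1"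
      using \<open>\<tau>\<^sup>2 = mink v v\<close> \<open>mink v v > 0\<close> by (simp add: mink_simps power2_eq_square[symmetric])
    then obtain Y where Y: "null_frame X ((1 / \<tau>) *\<^sub>R v) Y"
      using null_frame_exists[OF X] by blast
    have "mink Y v = 0" using null_frame_mink(8)[OF Y] \<open>\<tau> \<noteq> 0\<close> by (simp add: mink_simps)
    moreover have "mink ((1 / \<tau>) *\<^sub>R v) v = \<tau>"
      using \<open>\<tau> \<noteq> 0\<close> unfolding mink_simps \<open>\<tau>\<^sup>2 = mink v v\<close>[symmetric] by (simp add: power2_eq_square)
    ultimately show ?thesis using Y \<open>mink X v = 0\<close> 3 by blast
  qed
qed

lemma solution_initial_values:
  assumes "v \<noteq> 0"
  shows "{p. \<exists>\<alpha> \<omega> X. maximal_solution v c \<alpha> \<omega> X \<and> initial_values v X = p} = initial_surface v"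
proof (intro set_eqI iffI)
  fix p assume "p \<in> {p. \<exists>\<alpha> \<omega> X. maximal_solution v c \<alpha> \<omega> X \<and> initial_values v X = p}"
  then obtain \<alpha> \<omega> X where "maximal_solution v c \<alpha> \<omega> X" "initial_values v X = p" by blast
  then show "p \<in> initial_surface v"
    using initial_values_in_surface[OF assms maximal_solution_flow(3)] by (auto simp: initial_values_def)
next
  fix p assume p: "p \<in> initial_surface v"
  obtain x \<tau> y where xy: "p = (x, \<tau>, y)" by (metis prod_cases3)
  obtain X T Y where f: "null_frame X T Y" "mink X v = x" "mink T v = \<tau>" "mink Y v = y"
    using frame_with_coordinates p unfolding xy by blast
  obtain \<alpha> \<omega> Z where "maximal_solution v c \<alpha> \<omega> Z" "Z 0 = X" "tangent Z 0 = T" "associated Z 0 = Y"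
    using maximal_solution_exists[OF f(1)] by blast
  with f xy show "p \<in> {p. \<exists>\<alpha> \<omega> X. maximal_solution v c \<alpha> \<omega> X \<and> initial_values v X = p}"
    by (auto simp: initial_values_def)
qed

lemma nontrivial_initial_values:
  assumes "v \<noteq> 0"
  shows "{p. \<exists>\<alpha> \<omega> X. nontrivial_solution v c \<alpha> \<omega> X \<and> initial_values v X = p} = initial_surface v - degenerate c"
proof -
  have "trivial_curve (einterval \<alpha> \<omega>) X \<longleftrightarrow> initial_values v X \<in> degenerate c"
    if "maximal_solution v c \<alpha> \<omega> X" for \<alpha> \<omega> X
    unfolding initial_values_def
    by (rule trivial_curve_iff) (use that in \<open>auto simp: maximal_solution_def einterval_def zero_ereal_def\<close>)
  then show ?thesis
    unfolding nontrivial_solution_def solution_initial_values[OF assms, of c, symmetric] by blast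
qed

lemma eventually_not_degenerate:
  "\<forall>\<^sub>F e :: real in at_right 0. \<tau> + e \<noteq> 0 \<and> \<tau> + e \<noteq> - c"
proof -
  have ne: "\<forall>\<^sub>F e :: real in at_right 0. e \<noteq> d" for d
    by (rule eventually_neq_at_within)
  show ?thesis using ne[of "- \<tau>"] ne[of "- c - \<tau>"] by eventually_elim auto
qed

text \<open>If \<open>x \<noteq> 0\<close>, a degenerate point is left by moving
  \<open>\<tau>\<close> and recomputing \<open>y\<close>. If \<open>x = 0\<close>, degeneracy gives
  \<open>y = 0\<close>, the sign condition makes \<open>v\<close> spacelike and hence
  \<open>\<tau> = - c\<close> nonzero; the relation no longer involves \<open>y\<close>, which is
  moved instead.\<close>

lemma nontrivial_dense:
  shows "initial_surface v \<subseteq> closure (initial_surface v - degenerate c)"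
proof
  fix p assume p: "p \<in> initial_surface v"
  obtain x \<tau> y where xy: "p = (x, \<tau>, y)" by (metis prod_cases3)
  show "p \<in> closure (initial_surface v - degenerate c)"
  proof (cases "p \<in> degenerate c")
    case False
    with p show ?thesis by (intro subsetD[OF closure_subset]) simp
  next
    case deg: True
    have closureI: "p \<in> closure (initial_surface v - degenerate c)"
      if "(f \<longlongrightarrow> p) (at_right 0)" "\<forall>\<^sub>F e :: real in at_right 0. f e \<in> initial_surface v - degenerate c" for f
    proof (rule Lim_in_closed_set[OF closed_closure _ _ that(1)])
      show "\<forall>\<^sub>F e in at_right 0. f e \<in> closure (initial_surface v - degenerate c)"
        using that(2) by eventually_elim (rule subsetD[OF closure_subset])
    qed simp
    have eq: "2 * x * y + \<tau>\<^sup>2 = mink v v" and sgn: "\<not> spacelike v \<Longrightarrow> (y - x) * v$1 > 0"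
      using p by (auto simp: initial_surface_def xy)
    show ?thesis
    proof (cases "x = 0")
      case False
      define y' where "y' e = (mink v v - (\<tau> + e)\<^sup>2) / (2 * x)" for e
      have "(y' \<longlongrightarrow> (mink v v - (\<tau> + 0)\<^sup>2) / (2 * x)) (at_right 0)"
        unfolding y'_def using False by (intro tendsto_intros) auto
      moreover have "(mink v v - (\<tau> + 0)\<^sup>2) / (2 * x) = y" using eq False by (simp add: field_simps)
      ultimately have y': "(y' \<longlongrightarrow> y) (at_right 0)" by simp
      have "((\<lambda>e. (x, \<tau> + e, y' e)) \<longlongrightarrow> (x, \<tau> + 0, y)) (at_right 0)"
        by (intro tendsto_intros y')
      then have lim: "((\<lambda>e. (x, \<tau> + e, y' e)) \<longlongrightarrow> p) (at_right 0)" by (simp add: xy)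
      have "\<forall>\<^sub>F e in at_right 0. \<not> spacelike v \<longrightarrow> (y' e - x) * v$1 > 0"
      proof (cases "spacelike v")
        case False
        have "((\<lambda>e. (y' e - x) * v$1) \<longlongrightarrow> (y - x) * v$1) (at_right 0)"
          by (intro tendsto_intros y')
        then have "\<forall>\<^sub>F e in at_right 0. (y' e - x) * v$1 > 0"
          using sgn[OF False] by (rule order_tendstoD(1))
        then show ?thesis by eventually_elim simp
      qed simp
      then have "\<forall>\<^sub>F e in at_right 0. (x, \<tau> + e, y' e) \<in> initial_surface v - degenerate c"
        using eventually_not_degenerate[of \<tau> c]
      proof eventually_elim
        case (elim e)
        have "2 * x * y' e + (\<tau> + e)\<^sup>2 = mink v v" using False by (simp add: y'_def)
        with elim show ?case by (simp add: initial_surface_def degenerate_def)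
      qed
      with lim show ?thesis by (rule closureI)
    next
      case True
      then have "y = 0" using deg by (auto simp: degenerate_def xy)
      then have "spacelike v" using sgn True by auto
      then have "\<tau> \<noteq> 0" using eq True by (auto simp: spacelike_def)
      then have \<tau>: "\<tau> = - c" using deg by (auto simp: degenerate_def xy)
      have "((\<lambda>e. (0, - c, e)) \<longlongrightarrow> (0, - c, 0 :: real)) (at_right 0)"
        by (intro tendsto_intros)
      then have lim: "((\<lambda>e. (0, - c, e)) \<longlongrightarrow> p) (at_right 0)" by (simp add: xy True \<tau> \<open>y = 0\<close>)
      have "\<forall>\<^sub>F e in at_right 0. (0, - c, e) \<in> initial_surface v - degenerate c"
        using eventually_at_right_less[of 0]
      proof eventually_elim
        case (elim e)
        then show ?case
          using eq True \<tau> \<open>\<tau> \<noteq> 0\<close> \<open>spacelike v\<close> by (auto simp: initial_surface_def degenerate_def)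
      qed
      with lim show ?thesis by (rule closureI)
    qed
  qed
qed

lemma initial_surface_nonempty:
  assumes "v \<noteq> 0"
  shows "initial_surface v \<noteq> {}"
proof (cases "spacelike v")
  case True
  then have "(0, sqrt (mink v v), 0) \<in> initial_surface v"
    by (simp add: initial_surface_def spacelike_def)
  then show ?thesis by blast
next
  case False
  define s where "s = v$1"
  have "s \<noteq> 0" using False assms causal_first_component[of v] by (simp add: spacelike_def s_def)
  \<comment> \<open>With \<open>\<tau> = 0\<close> and \<open>x = - v$1\<close> the relation
    determines \<open>y\<close>, and \<open>(y - x) * v$1\<close> becomes
    \<open>(v$1)^2 - mink v v / 2\<close>, which is positive.\<close>
  have "(- s, 0, - mink v v / (2 * s)) \<in> initial_surface v"
  proof -
    have "(- mink v v / (2 * s) + s) * s = - mink v v / 2 + s * s"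
      using \<open>s \<noteq> 0\<close> by (simp add: field_simps)
    moreover have "0 < s * s" using \<open>s \<noteq> 0\<close> by (metis not_real_square_gt_zero)
    ultimately have "(- mink v v / (2 * s) + s) * s > 0" using False by (simp add: spacelike_def)
    then show ?thesis using \<open>s \<noteq> 0\<close> by (simp add: initial_surface_def s_def)
  qed
  then show ?thesis by blast
qed

lemma nontrivial_solution_exists:
  assumes "v \<noteq> 0"
  shows "initial_surface v - degenerate c \<noteq> {}"
  using nontrivial_dense[of v c] initial_surface_nonempty[OF assms] by (metis closure_empty subset_empty)

lemma nontrivial_solution_zeros:
  assumes "nontrivial_solution v c \<alpha> \<omega> X"
  shows "finite {s \<in> einterval \<alpha> \<omega>. curvature X s = 0}" "card {s \<in> einterval \<alpha> \<omega>. curvature X s = 0} \<le> 2"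
proof -
  have sol: "solves v c (einterval \<alpha> \<omega>) X" and nt: "\<not> trivial_curve (einterval \<alpha> \<omega>) X"
    using assms by (auto simp: nontrivial_solution_def maximal_solution_def)
  interpret coordinate_ode "einterval \<alpha> \<omega>" "\<lambda>s. mink (X s) v" "\<lambda>s. mink (tangent X s) v"
    "\<lambda>s. mink (associated X s) v" "\<lambda>s. c + mink (tangent X s) v" c "mink v v"
    by (rule solution_coordinate_ode[OF sol nt])
  have "{s \<in> einterval \<alpha> \<omega>. curvature X s = 0} = {s \<in> einterval \<alpha> \<omega>. c + mink (tangent X s) v = 0}"
    using sol by (auto simp: solves_def)
  then show "finite {s \<in> einterval \<alpha> \<omega>. curvature X s = 0}" "card {s \<in> einterval \<alpha> \<omega>. curvature X s = 0} \<le> 2"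
    using zeros by simp_all
qed

lemma nontrivial_solution_components:
  assumes nt: "nontrivial_solution v c \<alpha> \<omega> X"
  defines "S \<equiv> {s \<in> einterval \<alpha> \<omega>. curvature X s \<noteq> 0}"
  shows "finite (components S)" "card (components S) \<le> 3"
    and "\<And>C. C \<in> components S \<Longrightarrow> self_similar_ICF C (\<lambda>s. - associated X s)"
proof -
  define Z where "Z = {s \<in> einterval \<alpha> \<omega>. curvature X s = 0}"
  have Z: "finite Z" "card Z \<le> 2" unfolding Z_def by (rule nontrivial_solution_zeros[OF nt])+
  have sol: "solves v c (einterval \<alpha> \<omega>) X"
    using nt by (auto simp: nontrivial_solution_def maximal_solution_def)
  then have I: "is_interval (einterval \<alpha> \<omega>)" "open (einterval \<alpha> \<omega>)"
    by (auto simp: solves_def arc_length_curve_def spacelike_curve_def open_interval_def)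
  have S: "S = einterval \<alpha> \<omega> - Z" by (auto simp: S_def Z_def)
  show "finite (components S)" "card (components S) \<le> 3"
    using components_minus_finite[OF I(1) Z(1)] Z(2) unfolding S by auto
  fix C assume C: "C \<in> components S"
  have "open S" unfolding S using I(2) Z(1) by (intro open_Diff finite_imp_closed)
  then have "open_interval C"
    using open_components[OF _ C] in_components_connected[OF C] in_components_nonempty[OF C]
    by (simp add: open_interval_def is_interval_connected_1)
  then show "self_similar_ICF C (\<lambda>s. - associated X s)"
    using in_components_subset[OF C] by (intro solves_self_similar(3)[OF sol]) (auto simp: S_def)
qed

section \<open>The classes given by the causal type of \<open>v\<close>\<close>

lemma solution_class_nonempty:
  assumes "v \<noteq> 0" "P v"
  shows "solution_class P c \<noteq> {}"
  using nontrivial_solution_exists[OF assms(1), of c] assms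
  unfolding nontrivial_initial_values[OF assms(1), symmetric] solution_class_def by blast

lemma solution_class_disjoint:
  assumes "\<And>v. \<not> (P v \<and> Q v)"
  shows "solution_class P c \<inter> solution_class Q c = {}"
proof -
  have "v = v'" if "nontrivial_solution v c \<alpha> \<omega> X" "nontrivial_solution v' c \<alpha> \<omega> X" for v v' \<alpha> \<omega> X
    by (rule nontrivial_determines_vector[of v c "einterval \<alpha> \<omega>" X v'])
      (use that in \<open>auto simp: nontrivial_solution_def maximal_solution_def\<close>)
  then show ?thesis using assms unfolding solution_class_def by blast
qed

lemma solution_classes:
  "partition_on (solution_class (\<lambda>_. True) c)
      {solution_class timelike c, solution_class lightlike c, solution_class spacelike c}"
  "card {solution_class timelike c, solution_class lightlike c, solution_class spacelike c} = 3"
proof -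
  let ?t = "solution_class timelike c" and ?l = "solution_class lightlike c" and ?s = "solution_class spacelike c"
  have ne: "?t \<noteq> {}" "?l \<noteq> {}" "?s \<noteq> {}"
    using solution_class_nonempty[of "vector [1, 0, 0]" timelike c]
      solution_class_nonempty[of "vector [1, 1, 0]" lightlike c]
      solution_class_nonempty[of "vector [0, 1, 0]" spacelike c]
    by (auto simp: timelike_def lightlike_def spacelike_def mink_def vec_eq_iff forall_3)
  have dj: "?t \<inter> ?l = {}" "?t \<inter> ?s = {}" "?l \<inter> ?s = {}"
    by (rule solution_class_disjoint; auto simp: timelike_def lightlike_def spacelike_def)+
  have "?t \<union> ?l \<union> ?s = solution_class (\<lambda>_. True) c"
  proof -
    have "timelike v \<or> lightlike v \<or> spacelike v" if "v \<noteq> 0" for v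
      using that by (auto simp: timelike_def lightlike_def spacelike_def)
    then show ?thesis by (auto simp: solution_class_def; blast)
  qed
  with ne dj show "partition_on (solution_class (\<lambda>_. True) c) {?t, ?l, ?s}"
    by (auto simp: partition_on_def disjoint_def)
  have "?t \<noteq> ?l" "?t \<noteq> ?s" "?l \<noteq> ?s" using ne dj by auto
  then show "card {?t, ?l, ?s} = 3" by simp
qed

text \<open>The two parameters are a position on \<open>initial_surface v\<close>: every point
  occurs, and it determines the maximal solution up to an isometry fixing \<open>v\<close>. The
  non-trivial solutions fill an open dense part of this surface, so excluding constant curvature
  does not lower the number of parameters.\<close>

theorem theorem1p7:
  fixes v :: "real^3" and c :: real
  assumes "v \<noteq> 0"
  shows
    "{p. \<exists>\<alpha> \<omega> X. maximal_solution v c \<alpha> \<omega> X \<and> initial_values v X = p} = initial_surface v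
     \<and> (\<forall>\<alpha> \<omega> X \<alpha>' \<omega>' X'.
          maximal_solution v c \<alpha> \<omega> X \<and> maximal_solution v c \<alpha>' \<omega>' X' \<and>
          initial_values v X = initial_values v X' \<longrightarrow>
          \<alpha>' = \<alpha> \<and> \<omega>' = \<omega> \<and>
          (\<exists>M. cone_isometry M \<and> M *v v = v \<and> (\<forall>s\<in>einterval \<alpha> \<omega>. X' s = M *v X s)))
     \<and> (\<exists>N. N = {p. \<exists>\<alpha> \<omega> X. nontrivial_solution v c \<alpha> \<omega> X \<and> initial_values v X = p} \<and>
          N \<noteq> {} \<and> openin (top_of_set (initial_surface v)) N \<and> initial_surface v \<subseteq> closure N)
     \<and> (\<forall>\<alpha> \<omega> X. nontrivial_solution v c \<alpha> \<omega> X \<longrightarrow>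
          self_similar_CF (einterval \<alpha> \<omega>) X
          \<and> (c = 0 \<longrightarrow> soliton_CF (einterval \<alpha> \<omega>) X)
          \<and> finite {s \<in> einterval \<alpha> \<omega>. curvature X s = 0}
          \<and> card {s \<in> einterval \<alpha> \<omega>. curvature X s = 0} \<le> 2
          \<and> end_behaviour c (curvature X) (at_right \<alpha>)
          \<and> end_behaviour c (curvature X) (at_left \<omega>)
          \<and> finite (components {s \<in> einterval \<alpha> \<omega>. curvature X s \<noteq> 0})
          \<and> card (components {s \<in> einterval \<alpha> \<omega>. curvature X s \<noteq> 0}) \<le> 3
          \<and> (\<forall>C \<in> components {s \<in> einterval \<alpha> \<omega>. curvature X s \<noteq> 0}.
               self_similar_ICF C (\<lambda>s. - associated X s)))
     \<and> partition_on (solution_class (\<lambda>_. True) c)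
          {solution_class timelike c, solution_class lightlike c, solution_class spacelike c}
     \<and> card {solution_class timelike c, solution_class lightlike c, solution_class spacelike c} = 3"
proof (intro conjI allI impI)
  show "{p. \<exists>\<alpha> \<omega> X. maximal_solution v c \<alpha> \<omega> X \<and> initial_values v X = p} = initial_surface v"
    by (rule solution_initial_values[OF assms])
next
  fix \<alpha> \<omega> X \<alpha>' \<omega>' X'
  assume *: "maximal_solution v c \<alpha> \<omega> X \<and> maximal_solution v c \<alpha>' \<omega>' X' \<and> initial_values v X = initial_values v X'"
  then show "\<alpha>' = \<alpha>" "\<omega>' = \<omega>"
    using maximal_solution_ends_unique by blast+
  show "\<exists>M. cone_isometry M \<and> M *v v = v \<and> (\<forall>s\<in>einterval \<alpha> \<omega>. X' s = M *v X s)"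
    using * maximal_solution_isometric(1) by blast
next
  let ?N = "initial_surface v - degenerate c"
  have "openin (top_of_set (initial_surface v)) ?N"
    using closed_degenerate[of c] by (simp add: Diff_eq openin_open_Int open_Compl)
  then show "\<exists>N. N = {p. \<exists>\<alpha> \<omega> X. nontrivial_solution v c \<alpha> \<omega> X \<and> initial_values v X = p} \<and>
      N \<noteq> {} \<and> openin (top_of_set (initial_surface v)) N \<and> initial_surface v \<subseteq> closure N"
    using nontrivial_solution_exists[OF assms, of c] nontrivial_dense[of v c]
    by (intro exI[of _ ?N] conjI nontrivial_initial_values[OF assms, symmetric])
next
  fix \<alpha> \<omega> X assume nt: "nontrivial_solution v c \<alpha> \<omega> X"
  then have sol: "solves v c (einterval \<alpha> \<omega>) X"
    by (auto simp: nontrivial_solution_def maximal_solution_def)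
  show "self_similar_CF (einterval \<alpha> \<omega>) X" "c = 0 \<Longrightarrow> soliton_CF (einterval \<alpha> \<omega>) X"
    by (rule solves_self_similar[OF sol]; assumption?)+
  show "finite {s \<in> einterval \<alpha> \<omega>. curvature X s = 0}" "card {s \<in> einterval \<alpha> \<omega>. curvature X s = 0} \<le> 2"
    by (rule nontrivial_solution_zeros[OF nt])+
  show "end_behaviour c (curvature X) (at_right \<alpha>)" "end_behaviour c (curvature X) (at_left \<omega>)"
    by (rule end_behaviours[OF nt])+
  show "finite (components {s \<in> einterval \<alpha> \<omega>. curvature X s \<noteq> 0})"
    "card (components {s \<in> einterval \<alpha> \<omega>. curvature X s \<noteq> 0}) \<le> 3"
    "\<forall>C \<in> components {s \<in> einterval \<alpha> \<omega>. curvature X s \<noteq> 0}. self_similar_ICF C (\<lambda>s. - associated X s)"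
    using nontrivial_solution_components[OF nt] by blast+
qed (rule solution_classes)+

end
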